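(* Let $\Omega$ be a pseudoconvex domain of $\mathbb{C}^n$ with $C^2$-smooth boundary $b\Omega$ and let $z_o\in b\Omega$. Let $f:[1,+\infty)\to[1,+\infty)$ be a smooth monotonic increasing function with $f(t)\le t^{1/2}$. Assume that $\Omega$ has the $f$-Property at $z_o$ and that $$\int_t^\infty \frac{da}{a f(a)}<\infty\quad\text{for some } t>1.$$ Denote by $(g(t))^{-1}$ this finite integral, i.e. $g(t)=\left(\int_t^\infty \frac{da}{a f(a)}\right)^{-1}$, and set $G(\delta)=\left(g^*(\delta^{-1})\right)^{-1}$ for small $\delta>0$, where $g^*$ is the inverse function of $g$. If $b\Omega$ has type $\le F$ at $z_o$ along a one-dimensional complex analytic variety $Z$ passing through $z_o$, then there is a suitable constant $\alpha>0$ such that $F(\delta)\gtrsim G(\alpha\delta)$ for all sufficiently small $\delta>0$; that is, there are constants $\alpha,\beta>0$ such that $F(\delta)\ge \beta\, G(\alpha\delta)$ for all sufficiently small $\delta>0$.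
   Context: Let $r$ be a defining function of $\Omega$ (so $\Omega=\{r<0\}$ near $z_o$, with $dr\neq 0$ on $b\Omega$). $f$-Property: for a smooth monotonic increasing function $f:[1,+\infty)\to[1,+\infty)$ with $f(t)\le t^{1/2}$, $\Omega$ (or its boundary) has the $f$-Property at $z_o\in b\Omega$ if there exist a neighborhood $U$ of $z_o$, constants $C_1,C_2>0$ and a family of functions $\{\phi_\delta\}$ (indexed by small $\delta>0$, with $U,C_1,C_2$ independent of $\delta$) such that 1) $\phi_\delta$ is plurisubharmonic and $C^2$ on $U$, and $-1\le\phi_\delta\le 0$; 2) $\partial\bar\partial\phi_\delta\ge C_1 f(\delta^{-1})^2\,\mathrm{Id}$ (as Hermitian forms) and $|D\phi_\delta|\le C_2\delta^{-1}$ at every $z\in U\cap\{z\in\Omega: -\delta<r(z)<0\}$, where $D\phi_\delta$ denotes the first-order derivatives of $\phi_\delta$. Type along a variety: for a real-valued function $F$ defined for small positive arguments and a one-dimensional complex analytic variety $Z$ through $z_o$, $b\Omega$ has type $\le F$ along $Z$ at $z_o$ if $|r(z)|\le F(|z-z_o|)$ for $z\in Z$, $z\to z_o$ (i.e. for all $z\in Z\setminus\{z_o\}$ sufficiently close to $z_o$). *)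

theory Defs
  imports "HOL-Analysis.Analysis"
begin

text \<open>
  Complex Euclidean space is \<open>complex ^ 'n\<close>; its library norm is the Euclidean one, \<open>*s\<close> is
  multiplication by complex scalars, and \<open>axis j 1\<close>, \<open>axis j \<i>\<close> are the unit vectors in the
  directions \<open>x\<^sub>j\<close>, \<open>y\<^sub>j\<close>, where \<open>z\<^sub>j = x\<^sub>j + \<i> y\<^sub>j\<close>.
\<close>

subsection \<open>Differentiability classes\<close>

definition C2_on :: "'a::real_normed_vector set \<Rightarrow> ('a \<Rightarrow> real) \<Rightarrow> bool" where
  "C2_on U u \<longleftrightarrow> (\<exists>(u' :: 'a \<Rightarrow> 'a \<Rightarrow>\<^sub>L real) (u'' :: 'a \<Rightarrow> 'a \<Rightarrow>\<^sub>L 'a \<Rightarrow>\<^sub>L real).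
     (\<forall>z\<in>U. (u has_derivative blinfun_apply (u' z)) (at z) \<and>
            (u' has_derivative blinfun_apply (u'' z)) (at z)) \<and>
     continuous_on U u'')"

text \<open>Derivatives are taken within \<open>S\<close>, hence are one-sided at the end points of an interval.\<close>

definition smooth_real_on :: "real set \<Rightarrow> (real \<Rightarrow> real) \<Rightarrow> bool" where
  "smooth_real_on S f \<longleftrightarrow> (\<exists>D :: nat \<Rightarrow> real \<Rightarrow> real.
     (\<forall>x\<in>S. D 0 x = f x) \<and>
     (\<forall>k. \<forall>x\<in>S. (D k has_real_derivative D (Suc k) x) (at x within S)))"

subsection \<open>The complex Hessian and plurisubharmonic functions\<close>

definition wirtinger :: "'n \<Rightarrow> (complex ^ 'n \<Rightarrow> complex) \<Rightarrow> complex ^ 'n::finite \<Rightarrow> complex" where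
  "wirtinger j u z =
     (frechet_derivative u (at z) (axis j 1) - \<i> * frechet_derivative u (at z) (axis j \<i>)) / 2"

definition wirtinger_bar :: "'n \<Rightarrow> (complex ^ 'n \<Rightarrow> complex) \<Rightarrow> complex ^ 'n::finite \<Rightarrow> complex" where
  "wirtinger_bar j u z =
     (frechet_derivative u (at z) (axis j 1) + \<i> * frechet_derivative u (at z) (axis j \<i>)) / 2"

text \<open>The sum below is real for real \<open>C\<^sup>2\<close> functions \<open>u\<close>; \<open>Re\<close> only adjusts its type.\<close>

definition levi_form :: "(complex ^ 'n \<Rightarrow> real) \<Rightarrow> complex ^ 'n \<Rightarrow> complex ^ 'n::finite \<Rightarrow> real" where
  "levi_form u z \<zeta> =
     Re (\<Sum>j\<in>UNIV. \<Sum>k\<in>UNIV.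
           wirtinger j (wirtinger_bar k (\<lambda>w. complex_of_real (u w))) z * \<zeta> $ j * cnj (\<zeta> $ k))"

text \<open>
  Only continuous finite-valued plurisubharmonic functions are needed, so continuity replaces the
  usual upper semicontinuity and the circle means are ordinary integrals.
\<close>

definition continuous_psh_on :: "(complex ^ 'n::finite) set \<Rightarrow> (complex ^ 'n \<Rightarrow> real) \<Rightarrow> bool" where
  "continuous_psh_on U u \<longleftrightarrow> continuous_on U u \<and>
     (\<forall>z w. (\<forall>\<tau>::complex. norm \<tau> \<le> 1 \<longrightarrow> z + \<tau> *s w \<in> U) \<longrightarrow>
        u z \<le> 1 / (2 * pi) * integral {0..2 * pi} (\<lambda>\<theta>. u (z + cis \<theta> *s w)))"

subsection \<open>Pseudoconvex domains with \<open>C\<^sup>2\<close> boundary\<close>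

definition defining_function_on ::
  "(complex ^ 'n::finite) set \<Rightarrow> (complex ^ 'n) set \<Rightarrow> (complex ^ 'n \<Rightarrow> real) \<Rightarrow> bool" where
  "defining_function_on V \<Omega> r \<longleftrightarrow> open V \<and> C2_on V r \<and> \<Omega> \<inter> V = {z\<in>V. r z < 0} \<and>
     (\<forall>z\<in>frontier \<Omega> \<inter> V. frechet_derivative r (at z) \<noteq> (\<lambda>v. 0))"

definition C2_boundary :: "(complex ^ 'n::finite) set \<Rightarrow> bool" where
  "C2_boundary \<Omega> \<longleftrightarrow> (\<forall>p\<in>frontier \<Omega>. \<exists>V r. p \<in> V \<and> defining_function_on V \<Omega> r)"

text \<open>
  Pseudoconvexity of a domain: \<open>-log d\<close> is plurisubharmonic on \<open>\<Omega>\<close>, where \<open>d\<close> is the Euclidean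
  distance to the boundary.
\<close>

definition pseudoconvex_domain :: "(complex ^ 'n::finite) set \<Rightarrow> bool" where
  "pseudoconvex_domain \<Omega> \<longleftrightarrow> open \<Omega> \<and> connected \<Omega> \<and> \<Omega> \<noteq> {} \<and>
     continuous_psh_on \<Omega> (\<lambda>z. - ln (infdist z (frontier \<Omega>)))"

subsection \<open>The \<open>f\<close>-Property and the function \<open>G\<close>\<close>

text \<open>The operator norm of the real derivative is the Euclidean length of the gradient.\<close>

definition f_property ::
  "(real \<Rightarrow> real) \<Rightarrow> (complex ^ 'n::finite) set \<Rightarrow> (complex ^ 'n \<Rightarrow> real) \<Rightarrow> complex ^ 'n \<Rightarrow> bool" where
  "f_property f \<Omega> r z\<^sub>0 \<longleftrightarrow>
     (\<exists>U C\<^sub>1 C\<^sub>2. open U \<and> z\<^sub>0 \<in> U \<and> C\<^sub>1 > 0 \<and> C\<^sub>2 > 0 \<and>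
        (\<forall>\<^sub>F \<delta> in at_right 0. \<exists>\<phi> :: complex ^ 'n \<Rightarrow> real.
           continuous_psh_on U \<phi> \<and> C2_on U \<phi> \<and> (\<forall>z\<in>U. -1 \<le> \<phi> z \<and> \<phi> z \<le> 0) \<and>
           (\<forall>z \<in> U \<inter> {z\<in>\<Omega>. - \<delta> < r z \<and> r z < 0}.
              (\<forall>\<zeta>. levi_form \<phi> z \<zeta> \<ge> C\<^sub>1 * (f (1 / \<delta>))\<^sup>2 * (norm \<zeta>)\<^sup>2) \<and>
              onorm (frechet_derivative \<phi> (at z)) \<le> C\<^sub>2 / \<delta>)))"

definition g_of :: "(real \<Rightarrow> real) \<Rightarrow> real \<Rightarrow> real" where
  "g_of f t = 1 / integral {t..} (\<lambda>a. 1 / (a * f a))"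

text \<open>
  When the integral is finite, \<open>g_of f\<close> maps \<open>[1,\<infinity>)\<close> bijectively onto \<open>[g_of f 1,\<infinity>)\<close>, so that
  \<open>G_of f \<delta>\<close> is meaningful for small \<open>\<delta> > 0\<close>.
\<close>

definition G_of :: "(real \<Rightarrow> real) \<Rightarrow> real \<Rightarrow> real" where
  "G_of f \<delta> = 1 / inv_into {1..} (g_of f) (1 / \<delta>)"

subsection \<open>Analytic varieties\<close>

definition holomorphic_fun_on :: "(complex ^ 'n::finite) set \<Rightarrow> (complex ^ 'n \<Rightarrow> complex) \<Rightarrow> bool" where
  "holomorphic_fun_on W h \<longleftrightarrow>
     (\<forall>z\<in>W. \<exists>h'. (h has_derivative h') (at z) \<and> (\<forall>c v. h' (c *s v) = c * h' v))"

definition holomorphic_map_on ::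
  "(complex ^ 'n::finite) set \<Rightarrow> (complex ^ 'n \<Rightarrow> complex ^ 'm::finite) \<Rightarrow> bool" where
  "holomorphic_map_on W \<psi> \<longleftrightarrow> (\<forall>i. holomorphic_fun_on W (\<lambda>z. \<psi> z $ i))"

text \<open>Varieties are locally closed: near each of its points, \<open>Z\<close> is a common zero set.\<close>

definition analytic_variety :: "(complex ^ 'n::finite) set \<Rightarrow> bool" where
  "analytic_variety Z \<longleftrightarrow>
     (\<forall>p\<in>Z. \<exists>W H. open W \<and> p \<in> W \<and> finite H \<and> (\<forall>h\<in>H. holomorphic_fun_on W h) \<and>
        Z \<inter> W = {z\<in>W. \<forall>h\<in>H. h z = 0})"

text \<open>
  The regular points of dimension \<open>d\<close>: those near which \<open>Z\<close> becomes a \<open>d\<close>-dimensional complex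
  linear subspace in suitable local holomorphic coordinates \<open>\<psi>\<close> (with inverse \<open>\<eta>\<close>).
\<close>

definition regular_points :: "(complex ^ 'n::finite) set \<Rightarrow> nat \<Rightarrow> (complex ^ 'n) set" where
  "regular_points Z d = {p\<in>Z. \<exists>W \<psi> \<eta> L. open W \<and> p \<in> W \<and> open (\<psi> ` W) \<and>
     holomorphic_map_on W \<psi> \<and> holomorphic_map_on (\<psi> ` W) \<eta> \<and> (\<forall>z\<in>W. \<eta> (\<psi> z) = z) \<and>
     vec.subspace (L :: (complex ^ 'n) set) \<and> vec.dim L = d \<and> \<psi> ` (Z \<inter> W) = \<psi> ` W \<inter> L}"

text \<open>The dimension at \<open>p\<close>: the upper limit at \<open>p\<close> of the dimensions at nearby regular points.\<close>

definition variety_dim_at :: "(complex ^ 'n::finite) set \<Rightarrow> complex ^ 'n \<Rightarrow> nat" where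
  "variety_dim_at Z p = Max {d. p \<in> closure (regular_points Z d)}"

definition one_dim_variety :: "(complex ^ 'n::finite) set \<Rightarrow> bool" where
  "one_dim_variety Z \<longleftrightarrow> analytic_variety Z \<and> (\<forall>p\<in>Z. variety_dim_at Z p = 1)"

definition type_le_along ::
  "(complex ^ 'n::finite \<Rightarrow> real) \<Rightarrow> (real \<Rightarrow> real) \<Rightarrow> (complex ^ 'n) set \<Rightarrow> complex ^ 'n \<Rightarrow> bool" where
  "type_le_along r F Z z\<^sub>0 \<longleftrightarrow> (\<forall>\<^sub>F z in at z\<^sub>0 within Z. \<bar>r z\<bar> \<le> F (norm (z - z\<^sub>0)))"

end

theory Submission
  imports Defs "HOL-Complex_Analysis.Complex_Analysis"
begin

text \<open>
  Let \<open>\<nu>\<close> point into \<open>\<Omega>\<close> at \<open>z\<^sub>0\<close> and let \<open>\<epsilon> \<ge> 4 F \<delta>\<close>. Near the sphere of radius \<open>\<delta>\<close> the translate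
  \<open>Z + \<epsilon> \<nu>\<close> stays at distance \<open>\<ge> c \<epsilon>\<close> from the boundary, and since the negative logarithm of the boundary
  distance is plurisubharmonic, the maximum principle on \<open>Z\<close> gives the same lower bound on the whole
  piece of the translate in the ball. There the function
  \<open>\<phi> - \<Lambda> |z - p|\<^sup>2 / 2 - ln (dist / \<epsilon>) + M\<close>, with \<open>\<phi>\<close> and \<open>\<Lambda> \<approx> f(1 / m \<epsilon>)\<^sup>2\<close> from the \<open>f\<close>-Property and cut
  off at \<open>0\<close> deep inside \<open>\<Omega>\<close>, is again subharmonic along the translate and at least \<open>1\<close> at the
  centre \<open>p\<close>. The maximum principle therefore bounds \<open>\<Lambda> \<delta>\<^sup>2\<close>, that is, \<open>f(1 / m \<epsilon>) \<le> C / \<delta>\<close>, and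
  \<open>g \<le> 2 f\<close> up to a dilation of the argument turns this into \<open>1 / X \<lesssim> F \<delta>\<close> for \<open>g X = 2 C / \<delta>\<close>.

  For the maximum principle on \<open>Z\<close> it is enough that every point of \<open>Z\<close> lies on a nonconstant holomorphic
  curve in \<open>Z\<close>. Such curves come from eliminating one variable at a time by resultants and solving the
  last equation by Newton-Puiseux.
\<close>

section \<open>Contour integrals depending on a parameter\<close>

text \<open>The obstacle is that the Hessian bound on \<phi> is available only in a strip of width
  comparable to \<epsilon>, whereas the translate of \<open>Z\<close> may run much deeper into
  \<Omega>. The logarithmic term repairs this: once \<open>M\<close> is added it is bounded on the
  sphere, positive at the centre, and negative outside the strip, where the constant 0 takes over.
  All three estimates involve the boundary distance only in units of \<epsilon>, so the resulting
  bound for \<Lambda> \<delta>^2 is independent of \<epsilon>. A second obstacle is that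
  \<open>F\<close> need not be monotone: \<open>F \<delta>\<close> bounds |r| on the sphere of
  radius \<delta> but not inside it. Hence the interior is reached by lowering the shift gradually
  from a fixed size. On the sphere a shift by \<epsilon> \<nu> lowers \<open>r\<close> by
  \<epsilon>/2, and |r| <= \<epsilon>/4 there, which explains the factor 4. The maximum may sit at a
  singular point of \<open>Z\<close>. Only a local mean inequality along one curve through that
  point is used, so no global parametrisation of \<open>Z\<close> is required. Finally, the
  integrand of \<open>g\<close> is decreasing, so over [t/2, t] it integrates to at least 1 / (2
  f(t)); this is the relation between \<open>g\<close> and \<open>f\<close>.\<close>

lemma continuous_on_uncurry:
  assumes "continuous_on (A \<times> B) (\<lambda>(x, w). F x w)" "continuous_on S a" "continuous_on S b"
    and "\<And>s. s \<in> S \<Longrightarrow> a s \<in> A" "\<And>s. s \<in> S \<Longrightarrow> b s \<in> B"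
  shows "continuous_on S (\<lambda>s. F (a s) (b s))"
  using continuous_on_compose2[OF assms(1), of S "\<lambda>s. (a s, b s)"] assms(2-5)
  by (auto intro: continuous_on_Pair)

lemma continuous_on_circlepath_param:
  fixes G :: "'x::topological_space \<Rightarrow> complex \<Rightarrow> complex"
  assumes "continuous_on (X \<times> sphere z \<kappa>) (\<lambda>(x, w). G x w)" and "0 < \<kappa>"
  shows "continuous_on X (\<lambda>x. contour_integral (circlepath z \<kappa>) (G x))"
proof -
  have *: "contour_integral (circlepath z \<kappa>) (G x) =
      integral (cbox 0 1) (\<lambda>s. G x (circlepath z \<kappa> s) * vector_derivative (circlepath z \<kappa>) (at s))" for x
    by (simp add: contour_integral_integral)
  have "continuous_on (X \<times> cbox (0::real) 1)
      ((\<lambda>(x, w). G x w) \<circ> (\<lambda>p. (fst p, circlepath z \<kappa> (snd p))))"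
    using \<open>0 < \<kappa>\<close>
    by (intro continuous_on_compose continuous_on_subset[OF assms(1)])
       (auto simp: circlepath dist_norm norm_mult intro!: continuous_intros)
  then have "continuous_on (X \<times> cbox (0::real) 1)
     (\<lambda>(x, s). G x (circlepath z \<kappa> s) * vector_derivative (circlepath z \<kappa>) (at s))"
    by (auto simp: vector_derivative_circlepath split_def o_def intro!: continuous_intros)
  then show ?thesis
    unfolding * by (rule integral_continuous_on_param)
qed

text \<open>Cauchy's formula writes the derivative as a contour integral of \<open>F\<close> itself,
  so joint continuity of \<open>F\<close> passes to \<open>deriv (F x) w\<close>.\<close>

lemma continuous_on_deriv_param:
  fixes F :: "'x::topological_space \<Rightarrow> complex \<Rightarrow> complex"
  assumes cont: "continuous_on (X \<times> cball z \<kappa>) (\<lambda>(x, w). F x w)"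
    and hol: "\<And>x. x \<in> X \<Longrightarrow> F x holomorphic_on ball z \<kappa>" and "0 < \<kappa>"
  shows "continuous_on (X \<times> ball z \<kappa>) (\<lambda>(x, w). deriv (F x) w)"
proof -
  have "continuous_on ((X \<times> ball z \<kappa>) \<times> sphere z \<kappa>)
     ((\<lambda>(x, w). F x w) \<circ> (\<lambda>p. (fst (fst p), snd p)))"
    by (intro continuous_on_compose continuous_on_subset[OF cont])
       (auto simp: dist_norm norm_mult intro!: continuous_intros)
  then have "continuous_on ((X \<times> ball z \<kappa>) \<times> sphere z \<kappa>)
     (\<lambda>(p, u). F (fst p) u / (u - snd p)^2)"
    by (auto simp: split_def o_def intro!: continuous_intros)
  from continuous_on_circlepath_param[OF this \<open>0 < \<kappa>\<close>]
  have *: "continuous_on (X \<times> ball z \<kappa>)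
    (\<lambda>p. contour_integral (circlepath z \<kappa>) (\<lambda>u. F (fst p) u / (u - snd p)^2) / (2 * pi * \<i>))"
    by (intro continuous_intros) auto
  have "continuous_on (cball z \<kappa>) (F x)" if "x \<in> X" for x
    by (rule continuous_on_uncurry[OF cont]) (use that in \<open>auto intro!: continuous_intros\<close>)
  then show ?thesis
    by (intro continuous_on_eq[OF *]) (auto simp: Cauchy_contour_integral_circlepath_2 hol)
qed

text \<open>The Leibniz rule asks for a jointly continuous derivative in \<open>t\<close>. It comes
  from \<open>continuous_on_deriv_param\<close> with the roles exchanged: \<open>w\<close> is the
  parameter there and \<open>t\<close> the variable.\<close>

lemma holomorphic_on_circlepath_param:
  fixes G :: "complex \<Rightarrow> complex \<Rightarrow> complex"
  assumes cont: "continuous_on (T \<times> sphere z \<kappa>) (\<lambda>(t, w). G t w)"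
    and hol: "\<And>w. w \<in> sphere z \<kappa> \<Longrightarrow> (\<lambda>t. G t w) holomorphic_on T"
    and "0 < \<kappa>" "open T"
  shows "(\<lambda>t. contour_integral (circlepath z \<kappa>) (G t)) holomorphic_on T"
  unfolding holomorphic_on_def
proof
  fix t assume t: "t \<in> T"
    obtain e where e: "e > 0" "cball t e \<subseteq> T"
      using \<open>open T\<close> t open_contains_cball by blast
    have sub: "ball t e \<subseteq> T" using e by auto
    let ?f = "\<lambda>t s. G t (circlepath z \<kappa> s) * vector_derivative (circlepath z \<kappa>) (at s)"
    let ?g = "\<lambda>t s. deriv (\<lambda>t. G t (circlepath z \<kappa> s)) t * vector_derivative (circlepath z \<kappa>) (at s)"
    have cs: "circlepath z \<kappa> s \<in> sphere z \<kappa>" for s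
      using \<open>0 < \<kappa>\<close> by (auto simp: circlepath dist_norm norm_mult)
    have c1: "continuous_on (sphere z \<kappa> \<times> cball t e) (\<lambda>(w, t). G t w)"
      unfolding split_def
      by (rule continuous_on_uncurry[OF cont]) (use e(2) in \<open>auto intro!: continuous_intros\<close>)
    have d: "continuous_on (sphere z \<kappa> \<times> ball t e) (\<lambda>(w, t). deriv (\<lambda>t. G t w) t)"
      using continuous_on_deriv_param[OF c1 _ e(1)] holomorphic_on_subset[OF hol sub] by blast
    have cc: "continuous_on A (circlepath z \<kappa>)" for A
      by (auto simp: circlepath[abs_def] intro!: continuous_intros)
    have cv: "continuous_on A (\<lambda>s. vector_derivative (circlepath z \<kappa>) (at s))" for A
      by (auto simp: vector_derivative_circlepath intro!: continuous_intros)
    have "continuous_on (ball t e \<times> cbox (0::real) 1)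
        (\<lambda>p. deriv (\<lambda>t. G t (circlepath z \<kappa> (snd p))) (fst p))"
      by (rule continuous_on_uncurry[OF d, where a = "\<lambda>p. circlepath z \<kappa> (snd p)" and b = fst])
         (auto intro!: continuous_on_compose2[OF cc[of UNIV]] continuous_on_fst continuous_on_snd
             continuous_on_id cs simp del: mem_sphere)
    moreover have "continuous_on (ball t e \<times> cbox (0::real) 1)
        (\<lambda>p. vector_derivative (circlepath z \<kappa>) (at (snd p)))"
      by (rule continuous_on_compose2[OF cv[of UNIV]]) (auto intro!: continuous_on_snd continuous_on_id)
    ultimately have d': "continuous_on (ball t e \<times> cbox (0::real) 1) (\<lambda>(t, s). ?g t s)"
      unfolding split_def by (rule continuous_on_mult)
    have "(\<lambda>t. integral (cbox 0 1) (?f t)) holomorphic_on ball t e"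
    proof (rule leibniz_rule_holomorphic[OF _ _ d'])
      fix t' s assume "t' \<in> ball t e" "s \<in> cbox (0::real) 1"
      then have "((\<lambda>t. G t (circlepath z \<kappa> s)) has_field_derivative deriv (\<lambda>t. G t (circlepath z \<kappa> s)) t') (at t')"
        using hol[OF cs] sub \<open>open T\<close> by (intro holomorphic_derivI) auto
      then show "((\<lambda>t. ?f t s) has_field_derivative ?g t' s) (at t' within ball t e)"
        by (rule has_field_derivative_at_within[OF DERIV_cmult_right])
    next
      fix t' assume t': "t' \<in> ball t e"
      have "continuous_on (cbox (0::real) 1) (?f t')"
        by (rule continuous_on_mult[OF _ cv],
            rule continuous_on_uncurry[OF cont, where a = "\<lambda>_. t'" and b = "circlepath z \<kappa>"])
           (use cs sub t' cc in auto)
      then show "?f t' integrable_on cbox 0 1" by (rule integrable_continuous)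
    qed auto
    then have "(\<lambda>t. contour_integral (circlepath z \<kappa>) (G t)) holomorphic_on ball t e"
      by (simp add: contour_integral_integral)
    then have "(\<lambda>t. contour_integral (circlepath z \<kappa>) (G t)) field_differentiable at t"
      using e(1) by (intro holomorphic_on_imp_differentiable_at[of _ "ball t e"]) auto
    then show "(\<lambda>t. contour_integral (circlepath z \<kappa>) (G t)) field_differentiable at t within T"
      by (rule field_differentiable_at_within)
qed

section \<open>The polynomial whose roots are the values at the zeros\<close>

text \<open>The \<open>l a\<close> are the Lagrange basis polynomials. They depend on the nodes
  alone, so every coefficient of a polynomial is a fixed linear combination of its values.\<close>

lemma polynomial_interpolation:
  fixes A :: "complex set"
  assumes "finite A" "card A = Suc N"
  obtains l where "\<And>p. degree p \<le> N \<Longrightarrow> p = (\<Sum>a\<in>A. smult (poly p a) (l a))"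
proof -
  define l where "l a = smult (inverse (\<Prod>b\<in>A - {a}. a - b)) (\<Prod>b\<in>A - {a}. [:- b, 1:])" for a
  have val: "poly (l a) b = (if a = b then 1 else 0)" if "a \<in> A" "b \<in> A" for a b
    using that assms(1) by (auto simp: l_def poly_prod prod_zero_iff)
  have deg: "degree (l a) \<le> N" if "a \<in> A" for a
  proof -
    have "degree (\<Prod>b\<in>A - {a}. [:- b, 1:]) = (\<Sum>b\<in>A - {a}. degree [:- b, 1:])"
      by (rule degree_prod_eq_sum_degree) auto
    also have "\<dots> = N" using assms that by simp
    finally show ?thesis unfolding l_def by (metis degree_smult_le)
  qed
  have "p = (\<Sum>a\<in>A. smult (poly p a) (l a))" if p: "degree p \<le> N" for p
  proof (rule poly_eqI_degree[where A = A])
    fix x assume "x \<in> A"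
    have "poly (\<Sum>a\<in>A. smult (poly p a) (l a)) x = (\<Sum>a\<in>A. if a = x then poly p a else 0)"
      unfolding poly_sum poly_smult by (intro sum.cong) (auto simp: val \<open>x \<in> A\<close>)
    also have "\<dots> = poly p x" using assms \<open>x \<in> A\<close> by simp
    finally show "poly p x = poly (\<Sum>a\<in>A. smult (poly p a) (l a)) x" ..
  next
    show "degree p < card A" using p assms by simp
    have "degree (\<Sum>a\<in>A. smult (poly p a) (l a)) \<le> N"
      using assms by (intro degree_sum_le) (auto intro: order_trans[OF degree_smult_le] deg)
    then show "degree (\<Sum>a\<in>A. smult (poly p a) (l a)) < card A" using assms by simp
  qed
  then show ?thesis using that by blast
qed

definition zeros_in :: "real \<Rightarrow> (complex \<Rightarrow> complex) \<Rightarrow> complex set" where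
  "zeros_in \<kappa> F = {w \<in> ball 0 \<kappa>. F w = 0}"

text \<open>The characteristic polynomial of multiplication by \<open>k\<close> modulo
  \<open>F\<close>. For the identity \<open>k\<close> it is the Weierstrass polynomial of
  \<open>F\<close>; its constant coefficient is, up to sign, the product of the values of
  \<open>k\<close> at the zeros of \<open>F\<close>, that is, the resultant of \<open>F\<close> and
  \<open>k\<close>.\<close>

definition root_poly :: "real \<Rightarrow> (complex \<Rightarrow> complex) \<Rightarrow> (complex \<Rightarrow> complex) \<Rightarrow> complex poly" where
  "root_poly \<kappa> F k = (\<Prod>p\<in>zeros_in \<kappa> F. [:- k p, 1:] ^ nat (zorder F p))"

context
  fixes F :: "complex \<Rightarrow> complex" and \<kappa> \<kappa>2 :: real
  assumes F: "F holomorphic_on ball 0 \<kappa>2" and \<kappa>: "0 < \<kappa>" "\<kappa> < \<kappa>2"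
    and nz: "\<And>w. norm w = \<kappa> \<Longrightarrow> F w \<noteq> 0"
begin

lemma exists_nonzero: "\<exists>w\<in>ball 0 \<kappa>2. F w \<noteq> 0"
  using nz[of "of_real \<kappa>"] \<kappa> by (intro bexI[of _ "of_real \<kappa>"]) auto

lemma finite_zeros_cball:
  assumes "\<kappa>' < \<kappa>2" shows "finite {w \<in> cball 0 \<kappa>'. F w = 0}"
proof (cases "F constant_on ball 0 \<kappa>2")
  case True
  then have "{w \<in> cball 0 \<kappa>'. F w = 0} = {}"
    using exists_nonzero assms by (fastforce simp: constant_on_def)
  then show ?thesis by (simp only: finite.emptyI)
next
  case False
  then show ?thesis
    using assms F by (intro holomorphic_compact_finite_zeros[of F "ball 0 \<kappa>2"]) auto
qed

lemma finite_zeros_in: "finite (zeros_in \<kappa> F)"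
  by (rule finite_subset[OF _ finite_zeros_cball[OF \<kappa>(2)]]) (auto simp: zeros_in_def)

lemma zorder_pos: "p \<in> zeros_in \<kappa> F \<Longrightarrow> 0 < zorder F p"
  using zorder_exist_zero[of F "ball 0 \<kappa>2" p] F \<kappa> exists_nonzero by (auto simp: zeros_in_def)

lemma argument_principle_circle:
  assumes h: "h holomorphic_on ball 0 \<kappa>2"
  shows "contour_integral (circlepath 0 \<kappa>) (\<lambda>w. deriv F w * h w / F w) =
    2 * pi * \<i> * (\<Sum>p\<in>zeros_in \<kappa> F. of_nat (nat (zorder F p)) * h p)"
proof -
  \<comment> \<open>Zeros of \<open>F\<close> may accumulate at the circle of radius \<kappa>2; in
    the disc of intermediate radius there are only finitely many, as the argument principle
    requires.\<close>
  define \<kappa>1 where "\<kappa>1 = (\<kappa> + \<kappa>2) / 2"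
  have \<kappa>1: "\<kappa> < \<kappa>1" "\<kappa>1 < \<kappa>2" using \<kappa> by (auto simp: \<kappa>1_def)
  have sub: "ball 0 \<kappa>1 \<subseteq> ball 0 \<kappa>2" using \<kappa>1 by auto
  let ?Z = "{w \<in> ball 0 \<kappa>1. F w = 0 \<or> w \<in> {}}"
  have fin: "finite ?Z"
    by (rule finite_subset[OF _ finite_zeros_cball[OF \<kappa>1(2)]]) auto
  have "contour_integral (circlepath 0 \<kappa>) (\<lambda>w. deriv F w * h w / F w) =
     2 * pi * \<i> * (\<Sum>p\<in>?Z. winding_number (circlepath 0 \<kappa>) p * h p * zorder F p)"
  proof (rule argument_principle)
    show "F holomorphic_on ball 0 \<kappa>1 - {}" "h holomorphic_on ball 0 \<kappa>1"
      using F h sub by (auto intro: holomorphic_on_subset)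
    show "path_image (circlepath 0 \<kappa>) \<subseteq> ball 0 \<kappa>1 - ?Z"
      using nz \<kappa> \<kappa>1 by (auto simp: path_image_circlepath_nonneg)
    show "\<forall>z. z \<notin> ball 0 \<kappa>1 \<longrightarrow> winding_number (circlepath 0 \<kappa>) z = 0"
      using \<kappa> \<kappa>1 by (auto intro!: winding_number_zero_outside[of _ "cball 0 \<kappa>"]
          simp: path_image_circlepath_nonneg)
  qed (use fin in auto)
  also have "(\<Sum>p\<in>?Z. winding_number (circlepath 0 \<kappa>) p * h p * zorder F p) =
      (\<Sum>p\<in>zeros_in \<kappa> F. winding_number (circlepath 0 \<kappa>) p * h p * zorder F p)"
  proof (rule sum.mono_neutral_right[OF fin])
    show "zeros_in \<kappa> F \<subseteq> ?Z" using \<kappa>1 by (auto simp: zeros_in_def)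
    show "\<forall>p\<in>?Z - zeros_in \<kappa> F. winding_number (circlepath 0 \<kappa>) p * h p * zorder F p = 0"
    proof
      fix p assume p: "p \<in> ?Z - zeros_in \<kappa> F"
      then have "\<not> norm p < \<kappa>" "norm p \<noteq> \<kappa>" using nz by (auto simp: zeros_in_def)
      then have "winding_number (circlepath 0 \<kappa>) p = 0"
        using \<kappa> by (intro winding_number_zero_outside[of _ "cball 0 \<kappa>"])
          (auto simp: path_image_circlepath_nonneg)
      then show "winding_number (circlepath 0 \<kappa>) p * h p * zorder F p = 0" by simp
    qed
  qed
  also have "\<dots> = (\<Sum>p\<in>zeros_in \<kappa> F. of_nat (nat (zorder F p)) * h p)"
  proof (rule sum.cong[OF refl])
    fix p assume p: "p \<in> zeros_in \<kappa> F"
    then have "winding_number (circlepath 0 \<kappa>) p = 1"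
      by (intro winding_number_circlepath) (auto simp: zeros_in_def)
    then show "winding_number (circlepath 0 \<kappa>) p * h p * zorder F p = of_nat (nat (zorder F p)) * h p"
      using zorder_pos[OF p] by (simp add: mult.commute)
  qed
  finally show ?thesis .
qed

lemma degree_root_poly: "degree (root_poly \<kappa> F k) = (\<Sum>p\<in>zeros_in \<kappa> F. nat (zorder F p))"
  unfolding root_poly_def by (subst degree_prod_eq_sum_degree) (auto simp: degree_power_eq)

lemma lead_coeff_root_poly: "lead_coeff (root_poly \<kappa> F k) = 1"
  unfolding root_poly_def by (simp add: lead_coeff_prod lead_coeff_power)

lemma poly_root_poly_eq_0_iff: "poly (root_poly \<kappa> F k) c = 0 \<longleftrightarrow> (\<exists>p\<in>zeros_in \<kappa> F. k p = c)"
  using finite_zeros_in zorder_pos by (force simp: root_poly_def poly_prod prod_zero_iff)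

lemma degree_root_poly_integral:
  "of_nat (degree (root_poly \<kappa> F k)) =
    contour_integral (circlepath 0 \<kappa>) (\<lambda>w. deriv F w * 1 / F w) / (2 * pi * \<i>)"
  by (subst argument_principle_circle) (auto simp: degree_root_poly)

text \<open>For \<open>c\<close> beyond the bound of |k| the function \<open>1 - k / c\<close> has
  positive real part, hence a holomorphic logarithm. The argument principle with this weight gives
  the sum of the logarithms over the zeros, and the exponential turns it into the product.\<close>

lemma poly_root_poly_integral:
  assumes k: "k holomorphic_on ball 0 \<kappa>2" and C: "\<And>w. w \<in> ball 0 \<kappa>2 \<Longrightarrow> norm (k w) < C"
    and c: "C < c"
  shows "poly (root_poly \<kappa> F k) (of_real c) = of_real c ^ degree (root_poly \<kappa> F k) *
    exp (contour_integral (circlepath 0 \<kappa>)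
      (\<lambda>w. deriv F w * Ln (1 - k w / of_real c) / F w) / (2 * pi * \<i>))"
proof -
  have C0: "0 < C" using C[of 0] \<kappa> le_less_trans[OF norm_ge_zero] by force
  then have c0: "0 < c" using c by simp
  have Re: "0 < Re (1 - k w / of_real c)" if "w \<in> ball 0 \<kappa>2" for w
  proof -
    have "Re (k w / of_real c) \<le> norm (k w / of_real c)" by (rule complex_Re_le_cmod)
    also have "\<dots> < 1" using C[OF that] c c0 by (simp add: norm_divide)
    finally show ?thesis by simp
  qed
  have nonpos: "1 - k w / of_real c \<notin> \<real>\<^sub>\<le>\<^sub>0" if "w \<in> ball 0 \<kappa>2" for w
    using Re[OF that] by (metis complex_nonpos_Reals_iff not_less)
  have nz': "1 - k w / of_real c \<noteq> 0" if "w \<in> ball 0 \<kappa>2" for w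
    using Re[OF that] by force
  have zb: "p \<in> ball 0 \<kappa>2" if "p \<in> zeros_in \<kappa> F" for p
    using that \<kappa> by (auto simp: zeros_in_def)
  have "exp (contour_integral (circlepath 0 \<kappa>)
      (\<lambda>w. deriv F w * Ln (1 - k w / of_real c) / F w) / (2 * pi * \<i>)) =
      exp (\<Sum>p\<in>zeros_in \<kappa> F. of_nat (nat (zorder F p)) * Ln (1 - k p / of_real c))"
    by (subst argument_principle_circle) (use nonpos c0 in \<open>auto intro!: holomorphic_intros k\<close>)
  also have "\<dots> = (\<Prod>p\<in>zeros_in \<kappa> F. (1 - k p / of_real c) ^ nat (zorder F p))"
    unfolding exp_sum[OF finite_zeros_in] by (intro prod.cong) (simp_all add: exp_of_nat_mult exp_Ln[OF nz'[OF zb]] del: exp_Ln)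
  finally have *: "exp (contour_integral (circlepath 0 \<kappa>)
      (\<lambda>w. deriv F w * Ln (1 - k w / of_real c) / F w) / (2 * pi * \<i>)) =
      (\<Prod>p\<in>zeros_in \<kappa> F. (1 - k p / of_real c) ^ nat (zorder F p))" .
  show ?thesis
    unfolding * degree_root_poly power_sum prod.distrib[symmetric] power_mult_distrib[symmetric]
    using c0 by (simp add: root_poly_def poly_prod right_diff_distrib)
qed

end

lemma continuous_on_root_integral:
  fixes F h :: "'x::topological_space \<Rightarrow> complex \<Rightarrow> complex"
  assumes "continuous_on (X \<times> ball 0 \<kappa>2) (\<lambda>(x, w). F x w)"
    and "\<And>x. x \<in> X \<Longrightarrow> F x holomorphic_on ball 0 \<kappa>2" and \<kappa>: "0 < \<kappa>" "\<kappa> < \<kappa>2"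
    and "\<And>x w. x \<in> X \<Longrightarrow> norm w = \<kappa> \<Longrightarrow> F x w \<noteq> 0"
    and "continuous_on (X \<times> ball 0 \<kappa>2) (\<lambda>(x, w). h x w)"
  shows "continuous_on X (\<lambda>x. contour_integral (circlepath 0 \<kappa>) (\<lambda>w. deriv (F x) w * h x w / F x w))"
proof (rule continuous_on_circlepath_param[OF _ \<kappa>(1)])
  define \<kappa>1 where "\<kappa>1 = (\<kappa> + \<kappa>2) / 2"
  have \<kappa>1: "0 < \<kappa>1" "\<kappa> < \<kappa>1" "\<kappa>1 < \<kappa>2" using \<kappa> by (auto simp: \<kappa>1_def)
  have "continuous_on (X \<times> ball 0 \<kappa>1) (\<lambda>(x, w). deriv (F x) w)"
    using assms \<kappa>1 by (intro continuous_on_deriv_param)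
      (auto intro!: continuous_on_subset[OF assms(1)] holomorphic_on_subset[OF assms(2)])
  then have "continuous_on (X \<times> sphere 0 \<kappa>) (\<lambda>(x, w). deriv (F x) w)"
    by (rule continuous_on_subset) (use \<kappa>1 in auto)
  moreover have "continuous_on (X \<times> sphere 0 \<kappa>) (\<lambda>(x, w). F x w)"
    by (rule continuous_on_subset[OF assms(1)]) (use \<kappa> in auto)
  moreover have "continuous_on (X \<times> sphere 0 \<kappa>) (\<lambda>(x, w). h x w)"
    by (rule continuous_on_subset[OF assms(6)]) (use \<kappa> in auto)
  ultimately show "continuous_on (X \<times> sphere 0 \<kappa>) (\<lambda>(x, w). deriv (F x) w * h x w / F x w)"
    using assms(5) by (auto simp: split_def intro!: continuous_on_divide continuous_on_mult)
qed

lemma holomorphic_on_deriv_param: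
  fixes F :: "complex \<Rightarrow> complex \<Rightarrow> complex"
  assumes cont: "continuous_on (T \<times> cball z \<kappa>) (\<lambda>(t, w). F t w)"
    and hol: "\<And>t. t \<in> T \<Longrightarrow> F t holomorphic_on ball z \<kappa>" and "0 < \<kappa>"
    and hol': "\<And>w. w \<in> cball z \<kappa> \<Longrightarrow> (\<lambda>t. F t w) holomorphic_on T" and "open T" and w: "w \<in> ball z \<kappa>"
  shows "(\<lambda>t. deriv (F t) w) holomorphic_on T"
proof -
  have "continuous_on (T \<times> sphere z \<kappa>) (\<lambda>(t, u). F t u)"
    by (rule continuous_on_subset[OF cont]) auto
  then have "continuous_on (T \<times> sphere z \<kappa>) (\<lambda>(t, u). F t u / (u - w)^2)"
    using w by (auto simp: split_def intro!: continuous_intros)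
  then have "(\<lambda>t. contour_integral (circlepath z \<kappa>) (\<lambda>u. F t u / (u - w)^2)) holomorphic_on T"
    by (rule holomorphic_on_circlepath_param)
       (use w assms(3,5) in \<open>auto intro!: holomorphic_intros hol'\<close>)
  then have *: "(\<lambda>t. contour_integral (circlepath z \<kappa>) (\<lambda>u. F t u / (u - w)^2) / (2 * pi * \<i>)) holomorphic_on T"
    by (intro holomorphic_intros) auto
  have "continuous_on (cball z \<kappa>) (F t)" if "t \<in> T" for t
    by (rule continuous_on_uncurry[OF cont]) (use that in \<open>auto intro!: continuous_intros\<close>)
  then show ?thesis
    by (intro holomorphic_transform[OF *]) (simp add: Cauchy_contour_integral_circlepath_2[OF _ hol w])
qed

lemma holomorphic_on_root_integral:
  fixes F h :: "complex \<Rightarrow> complex \<Rightarrow> complex"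
  assumes "continuous_on (T \<times> ball 0 \<kappa>2) (\<lambda>(t, w). F t w)"
    and "\<And>t. t \<in> T \<Longrightarrow> F t holomorphic_on ball 0 \<kappa>2" and \<kappa>: "0 < \<kappa>" "\<kappa> < \<kappa>2"
    and "\<And>t w. t \<in> T \<Longrightarrow> norm w = \<kappa> \<Longrightarrow> F t w \<noteq> 0"
    and "continuous_on (T \<times> ball 0 \<kappa>2) (\<lambda>(t, w). h t w)"
    and "open T" "\<And>w. w \<in> ball 0 \<kappa>2 \<Longrightarrow> (\<lambda>t. F t w) holomorphic_on T"
    and "\<And>w. w \<in> ball 0 \<kappa>2 \<Longrightarrow> (\<lambda>t. h t w) holomorphic_on T"
  shows "(\<lambda>t. contour_integral (circlepath 0 \<kappa>) (\<lambda>w. deriv (F t) w * h t w / F t w)) holomorphic_on T"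
proof (rule holomorphic_on_circlepath_param)
  define \<kappa>1 where "\<kappa>1 = (\<kappa> + \<kappa>2) / 2"
  have \<kappa>1: "0 < \<kappa>1" "\<kappa> < \<kappa>1" "\<kappa>1 < \<kappa>2" using \<kappa> by (auto simp: \<kappa>1_def)
  have c1: "continuous_on (T \<times> cball 0 \<kappa>1) (\<lambda>(t, w). F t w)"
    by (rule continuous_on_subset[OF assms(1)]) (use \<kappa>1 in auto)
  have h1: "F t holomorphic_on ball 0 \<kappa>1" if "t \<in> T" for t
    by (rule holomorphic_on_subset[OF assms(2)[OF that]]) (use \<kappa>1 in auto)
  have "continuous_on (T \<times> ball 0 \<kappa>1) (\<lambda>(t, w). deriv (F t) w)"
    by (rule continuous_on_deriv_param[OF c1 h1 \<kappa>1(1)])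
  then have "continuous_on (T \<times> sphere 0 \<kappa>) (\<lambda>(x, w). deriv (F x) w)"
    by (rule continuous_on_subset) (use \<kappa>1 in auto)
  moreover have "continuous_on (T \<times> sphere 0 \<kappa>) (\<lambda>(x, w). F x w)"
    by (rule continuous_on_subset[OF assms(1)]) (use \<kappa> in auto)
  moreover have "continuous_on (T \<times> sphere 0 \<kappa>) (\<lambda>(x, w). h x w)"
    by (rule continuous_on_subset[OF assms(6)]) (use \<kappa> in auto)
  ultimately show "continuous_on (T \<times> sphere 0 \<kappa>) (\<lambda>(x, w). deriv (F x) w * h x w / F x w)"
    using assms(5) by (auto simp: split_def intro!: continuous_on_divide continuous_on_mult)
  fix w :: complex assume w: "w \<in> sphere 0 \<kappa>"
  have "(\<lambda>t. deriv (F t) w) holomorphic_on T"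
    by (rule holomorphic_on_deriv_param[OF c1 h1 \<kappa>1(1) _ \<open>open T\<close>]) (use \<kappa>1 assms(8) w in auto)
  then show "(\<lambda>t. deriv (F t) w * h t w / F t w) holomorphic_on T"
    using assms(5,8,9) w \<kappa> by (intro holomorphic_on_divide holomorphic_on_mult) auto
qed (use assms in auto)

text \<open>The nodes \<open>C + 1 + m\<close> all lie beyond \<open>C\<close>, where the
  exponential formula for \<open>root_poly\<close> is valid, and the weights \<open>c m\<close> do
  not depend on the polynomial.\<close>

lemma coeff_eq_combination_of_values:
  obtains c :: "nat \<Rightarrow> complex" where
    "\<And>p :: complex poly. degree p \<le> N \<Longrightarrow>
       coeff p j = (\<Sum>m\<le>N. c m * poly p (of_real (C + 1 + real m)))"
proof -
  let ?a = "\<lambda>m. complex_of_real (C + 1 + real m)"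
  have inj: "inj_on ?a {..N}" by (auto intro!: inj_onI)
  obtain l where l: "\<And>p. degree p \<le> N \<Longrightarrow> p = (\<Sum>a\<in>?a ` {..N}. smult (poly p a) (l a))"
    using polynomial_interpolation[of "?a ` {..N}" N] card_image[OF inj] by auto
  have "coeff p j = (\<Sum>m\<le>N. coeff (l (?a m)) j * poly p (?a m))" if "degree p \<le> N" for p
    by (subst l[OF that]) (simp only: coeff_sum coeff_smult sum.reindex[OF inj] o_def mult.commute)
  then show ?thesis by (rule that)
qed

text \<open>The number of zeros is a contour integral, so it is continuous in the parameter; being
  integer valued it is constant on the connected set \<open>X\<close>.\<close>

lemma degree_root_poly_constant:
  fixes F :: "'x::topological_space \<Rightarrow> complex \<Rightarrow> complex"
  assumes "connected X" "continuous_on (X \<times> ball 0 \<kappa>2) (\<lambda>(x, w). F x w)"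
    and "\<And>x. x \<in> X \<Longrightarrow> F x holomorphic_on ball 0 \<kappa>2" and "0 < \<kappa>" "\<kappa> < \<kappa>2"
    and "\<And>x w. x \<in> X \<Longrightarrow> norm w = \<kappa> \<Longrightarrow> F x w \<noteq> 0"
  obtains N where "\<And>x k. x \<in> X \<Longrightarrow> degree (root_poly \<kappa> (F x) k) = N"
proof -
  define n where "n x = (\<Sum>p\<in>zeros_in \<kappa> (F x). nat (zorder (F x) p))" for x
  have deg: "degree (root_poly \<kappa> (F x) k) = n x" if "x \<in> X" for x k
    unfolding n_def by (rule degree_root_poly[OF assms(3)[OF that] assms(4,5) assms(6)[OF that]])
  have "continuous_on X (\<lambda>x. contour_integral (circlepath 0 \<kappa>) (\<lambda>w. deriv (F x) w * 1 / F x w) / (2 * pi * \<i>))"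
    by (intro continuous_intros continuous_on_root_integral[where h = "\<lambda>_ _. 1"]) (use assms in auto)
  then have cont: "continuous_on X (\<lambda>x. of_nat (n x) :: complex)"
  proof (rule continuous_on_eq)
    fix x assume "x \<in> X"
    then show "contour_integral (circlepath 0 \<kappa>) (\<lambda>w. deriv (F x) w * 1 / F x w) / (2 * pi * \<i>) = of_nat (n x)"
      using degree_root_poly_integral[of "F x" \<kappa>2 \<kappa> "\<lambda>_. 0"] assms deg by simp
  qed
  have "(\<lambda>x. of_nat (n x) :: complex) constant_on X"
  proof (rule continuous_discrete_range_constant[OF assms(1) cont])
    have "1 \<le> norm (of_nat m - of_nat n :: complex)" if "m \<noteq> n" for m n :: nat
    proof -
      have "of_nat m - of_nat n = (of_int (int m - int n) :: complex)" by simp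
      then show ?thesis using that by (simp only: norm_of_int)
    qed
    then show "\<exists>e>0. \<forall>y. y \<in> X \<and> of_nat (n y) \<noteq> (of_nat (n x) :: complex) \<longrightarrow>
        e \<le> norm (of_nat (n y) - (of_nat (n x) :: complex))" for x
      by (intro exI[of _ 1]) auto
  qed
  then obtain c where c: "\<And>x. x \<in> X \<Longrightarrow> of_nat (n x) = (c::complex)"
    by (auto simp: constant_on_def)
  show ?thesis
  proof (cases "X = {}")
    case True then show ?thesis using that by simp
  next
    case False
    then obtain x0 where x0: "x0 \<in> X" by auto
    have "n x = n x0" if "x \<in> X" for x
      using c[OF that] c[OF x0] of_nat_eq_iff[where 'a = complex] by metis
    then show ?thesis using that[of "n x0"] deg by simp
  qed
qed

context
  fixes F k :: "'x::topological_space \<Rightarrow> complex \<Rightarrow> complex" and X :: "'x set" and \<kappa> \<kappa>2 C :: real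
  assumes connected: "connected X"
    and contF: "continuous_on (X \<times> ball 0 \<kappa>2) (\<lambda>(x, w). F x w)"
    and holF: "\<And>x. x \<in> X \<Longrightarrow> F x holomorphic_on ball 0 \<kappa>2" and \<kappa>: "0 < \<kappa>" "\<kappa> < \<kappa>2"
    and nz: "\<And>x w. x \<in> X \<Longrightarrow> norm w = \<kappa> \<Longrightarrow> F x w \<noteq> 0"
    and contk: "continuous_on (X \<times> ball 0 \<kappa>2) (\<lambda>(x, w). k x w)"
    and holk: "\<And>x. x \<in> X \<Longrightarrow> k x holomorphic_on ball 0 \<kappa>2"
    and bound: "\<And>x w. x \<in> X \<Longrightarrow> w \<in> ball 0 \<kappa>2 \<Longrightarrow> norm (k x w) < C"
begin

text \<open>Far away from the values of \<open>k\<close> the polynomial can be written as the exponential of a contour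
  integral; interpolation carries the regularity from there to the coefficients.\<close>

lemma coeff_root_poly_eq:
  obtains c :: "nat \<Rightarrow> complex" and N where "\<And>x. x \<in> X \<Longrightarrow> coeff (root_poly \<kappa> (F x) (k x)) j =
    (\<Sum>m\<le>N. c m * (of_real (C + 1 + real m) ^ N * exp (contour_integral (circlepath 0 \<kappa>)
      (\<lambda>w. deriv (F x) w * Ln (1 - k x w / of_real (C + 1 + real m)) / F x w) / (2 * pi * \<i>))))"
proof -
  obtain N where N: "\<And>x k. x \<in> X \<Longrightarrow> degree (root_poly \<kappa> (F x) k) = N"
    by (rule degree_root_poly_constant[OF connected contF holF \<kappa> nz]) (assumption | rule that)+
  obtain c where c: "\<And>p :: complex poly. degree p \<le> N \<Longrightarrow> coeff p j = (\<Sum>m\<le>N. c m * poly p (of_real (C + 1 + real m)))"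
    by (rule coeff_eq_combination_of_values[where N = N and j = j and C = C]) (rule that)
  show ?thesis
  proof (rule that)
    fix x assume x: "x \<in> X"
    have "poly (root_poly \<kappa> (F x) (k x)) (of_real (C + 1 + real m)) =
      of_real (C + 1 + real m) ^ degree (root_poly \<kappa> (F x) (k x)) * exp (contour_integral (circlepath 0 \<kappa>)
      (\<lambda>w. deriv (F x) w * Ln (1 - k x w / of_real (C + 1 + real m)) / F x w) / (2 * pi * \<i>))" for m
      by (rule poly_root_poly_integral[OF holF[OF x] \<kappa> nz[OF x] holk[OF x] bound[OF x]]) auto
    then show "coeff (root_poly \<kappa> (F x) (k x)) j =
      (\<Sum>m\<le>N. c m * (of_real (C + 1 + real m) ^ N * exp (contour_integral (circlepath 0 \<kappa>)
      (\<lambda>w. deriv (F x) w * Ln (1 - k x w / of_real (C + 1 + real m)) / F x w) / (2 * pi * \<i>))))"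
      by (subst c) (simp_all only: N[OF x])
  qed
qed

lemma one_minus_div_nonpos:
  assumes "x \<in> X" "w \<in> ball 0 \<kappa>2"
  shows "1 - k x w / of_real (C + 1 + real m) \<notin> \<real>\<^sub>\<le>\<^sub>0"
proof -
  have C: "norm (k x w) < C" using bound assms by blast
  then have C0: "0 < C" using le_less_trans[OF norm_ge_zero] by blast
  have "Re (k x w / of_real (C + 1 + real m)) \<le> norm (k x w / of_real (C + 1 + real m))"
    by (rule complex_Re_le_cmod)
  also have "\<dots> = norm (k x w) / (C + 1 + real m)"
    using C0 by (simp only: norm_divide norm_of_real)
  also have "\<dots> < 1" using C C0 by simp
  finally show ?thesis by (simp add: complex_nonpos_Reals_iff)
qed

lemma continuous_on_Ln_root_param:
  "continuous_on (X \<times> ball 0 \<kappa>2) (\<lambda>(x, w). Ln (1 - k x w / of_real (C + 1 + real m)))"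
proof (cases "X = {}")
  \<comment> \<open>Positivity of \<open>C\<close>, and with it a nonzero denominator, is known only
    if \<open>k\<close> has a value at all.\<close>
  case False
  then obtain x where "x \<in> X" by auto
  then have "norm (k x 0) < C" using bound \<kappa> by force
  then have "0 < C" by (rule le_less_trans[OF norm_ge_zero])
  then have "complex_of_real (C + 1 + real m) \<noteq> 0" by (simp del: of_real_add)
  moreover have "continuous_on (X \<times> ball 0 \<kappa>2) (\<lambda>p. k (fst p) (snd p))"
    using contk by (simp add: split_def)
  ultimately show ?thesis
    unfolding split_def using one_minus_div_nonpos
    by (intro continuous_on_Ln' continuous_on_diff continuous_on_divide continuous_on_const) auto
qed simp

lemma continuous_on_coeff_root_poly: "continuous_on X (\<lambda>x. coeff (root_poly \<kappa> (F x) (k x)) j)"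
proof -
  note h = continuous_on_Ln_root_param
  obtain c N where eq: "\<And>x. x \<in> X \<Longrightarrow> coeff (root_poly \<kappa> (F x) (k x)) j =
    (\<Sum>m\<le>N. c m * (of_real (C + 1 + real m) ^ N * exp (contour_integral (circlepath 0 \<kappa>)
      (\<lambda>w. deriv (F x) w * Ln (1 - k x w / of_real (C + 1 + real m)) / F x w) / (2 * pi * \<i>))))"
    by (rule coeff_root_poly_eq[where j = j]) (assumption | rule that)+
  have J: "continuous_on X (\<lambda>x. contour_integral (circlepath 0 \<kappa>)
      (\<lambda>w. deriv (F x) w * Ln (1 - k x w / of_real (C + 1 + real m)) / F x w))" for m
    by (rule continuous_on_root_integral[OF contF holF \<kappa> nz h])
  show ?thesis
    by (rule continuous_on_eq[OF _ eq[symmetric]])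
       (intro continuous_on_sum continuous_on_mult continuous_on_const continuous_on_exp continuous_on_divide J, simp)
qed

end

lemma holomorphic_on_coeff_root_poly:
  fixes F k :: "complex \<Rightarrow> complex \<Rightarrow> complex"
  assumes connected: "connected T"
    and contF: "continuous_on (T \<times> ball 0 \<kappa>2) (\<lambda>(x, w). F x w)"
    and holF: "\<And>x. x \<in> T \<Longrightarrow> F x holomorphic_on ball 0 \<kappa>2" and \<kappa>: "0 < \<kappa>" "\<kappa> < \<kappa>2"
    and nz: "\<And>x w. x \<in> T \<Longrightarrow> norm w = \<kappa> \<Longrightarrow> F x w \<noteq> 0"
    and contk: "continuous_on (T \<times> ball 0 \<kappa>2) (\<lambda>(x, w). k x w)"
    and holk: "\<And>x. x \<in> T \<Longrightarrow> k x holomorphic_on ball 0 \<kappa>2"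
    and bound: "\<And>x w. x \<in> T \<Longrightarrow> w \<in> ball 0 \<kappa>2 \<Longrightarrow> norm (k x w) < C"
    and "open T"
    and holF': "\<And>w. w \<in> ball 0 \<kappa>2 \<Longrightarrow> (\<lambda>x. F x w) holomorphic_on T"
    and holk': "\<And>w. w \<in> ball 0 \<kappa>2 \<Longrightarrow> (\<lambda>x. k x w) holomorphic_on T"
  shows "(\<lambda>x. coeff (root_poly \<kappa> (F x) (k x)) j) holomorphic_on T"
proof -
  note h = continuous_on_Ln_root_param[OF connected contF holF \<kappa> nz contk holk bound]
  have h': "(\<lambda>x. Ln (1 - k x w / of_real (C + 1 + real m))) holomorphic_on T" if w: "w \<in> ball 0 \<kappa>2" for w m
  proof (cases "T = {}")
    case False
    then obtain x where "x \<in> T" by auto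
    then have "norm (k x 0) < C" using bound \<kappa> by force
    then have "0 < C" by (rule le_less_trans[OF norm_ge_zero])
    then have "complex_of_real (C + 1 + real m) \<noteq> 0" by (simp del: of_real_add)
    moreover have "1 - k x w / of_real (C + 1 + real m) \<notin> \<real>\<^sub>\<le>\<^sub>0" if "x \<in> T" for x
      by (rule one_minus_div_nonpos[OF connected contF holF \<kappa> nz contk holk bound that w])
    ultimately show ?thesis
      by (intro holomorphic_on_diff holomorphic_on_divide holomorphic_on_Ln' holomorphic_on_const holk'[OF w])
  qed (simp add: holomorphic_on_def)
  obtain c N where eq: "\<And>x. x \<in> T \<Longrightarrow> coeff (root_poly \<kappa> (F x) (k x)) j =
    (\<Sum>m\<le>N. c m * (of_real (C + 1 + real m) ^ N * exp (contour_integral (circlepath 0 \<kappa>)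
      (\<lambda>w. deriv (F x) w * Ln (1 - k x w / of_real (C + 1 + real m)) / F x w) / (2 * pi * \<i>))))"
    by (rule coeff_root_poly_eq[OF connected contF holF \<kappa> nz contk holk bound, where j = j]) (assumption | rule that)+
  have J: "(\<lambda>x. contour_integral (circlepath 0 \<kappa>)
      (\<lambda>w. deriv (F x) w * Ln (1 - k x w / of_real (C + 1 + real m)) / F x w)) holomorphic_on T" for m
    by (rule holomorphic_on_root_integral[OF contF holF \<kappa> nz h \<open>open T\<close> holF' h'])
  show ?thesis
    by (rule holomorphic_transform[OF _ eq[symmetric]])
       (intro holomorphic_on_sum holomorphic_on_mult holomorphic_on_const holomorphic_on_exp' holomorphic_on_divide J, simp)
qed

section \<open>Weierstrass polynomials of functions of two variables\<close>

text \<open>A tube argument: zeros over parameters tending to \<open>x0\<close> would accumulate, by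
  compactness of \<open>K\<close>, at a zero over \<open>x0\<close>.\<close>

lemma nonvanishing_nbhd:
  fixes F :: "'x::metric_space \<Rightarrow> complex \<Rightarrow> complex"
  assumes cont: "continuous_on (X \<times> K) (\<lambda>(x, w). F x w)" and "compact K" "x0 \<in> X"
    and nz: "\<And>w. w \<in> K \<Longrightarrow> F x0 w \<noteq> 0"
  obtains \<rho> where "\<rho> > 0" "\<And>x w. x \<in> X \<Longrightarrow> dist x x0 < \<rho> \<Longrightarrow> w \<in> K \<Longrightarrow> F x w \<noteq> 0"
proof -
  have "\<exists>\<rho>>0. \<forall>x\<in>X. \<forall>w\<in>K. dist x x0 < \<rho> \<longrightarrow> F x w \<noteq> 0"
  proof (rule ccontr)
    assume "\<not> ?thesis"
    then have "\<exists>x w. x \<in> X \<and> w \<in> K \<and> dist x x0 < inverse (real (Suc n)) \<and> F x w = 0" for n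
      by (metis inverse_positive_iff_positive of_nat_0_less_iff zero_less_Suc)
    then obtain x w where xw: "\<And>n. x n \<in> X" "\<And>n. w n \<in> K" "\<And>n. F (x n) (w n) = 0"
      and d: "\<And>n. dist (x n) x0 < inverse (real (Suc n))" by metis
    have x: "x \<longlonglongrightarrow> x0"
      by (rule metric_tendsto_imp_tendsto[OF LIMSEQ_inverse_real_of_nat])
         (use d in \<open>auto intro!: always_eventually less_imp_le simp: dist_real_def\<close>)
    obtain w0 f where w0: "w0 \<in> K" "strict_mono f" "(w \<circ> f) \<longlonglongrightarrow> w0"
      using \<open>compact K\<close> xw(2) unfolding compact_def by blast
    have "(\<lambda>n. (x (f n), w (f n))) \<longlonglongrightarrow> (x0, w0)"
      using LIMSEQ_subseq_LIMSEQ[OF x w0(2)] w0(3) by (auto simp: o_def intro!: tendsto_Pair)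
    then have "(\<lambda>n. (\<lambda>(x, w). F x w) (x (f n), w (f n))) \<longlonglongrightarrow> (\<lambda>(x, w). F x w) (x0, w0)"
      using continuous_on_tendsto_compose[OF cont, of "\<lambda>n. (x (f n), w (f n))" "(x0, w0)"] xw w0 \<open>x0 \<in> X\<close>
      by simp
    then have "F x0 w0 = 0" using xw(3) by (simp add: LIMSEQ_const_iff)
    then show False using nz w0 by blast
  qed
  then show ?thesis using that by blast
qed

text \<open>Holomorphy on a bidisc, expressed through substitution of holomorphic functions of one
  variable. This form is stable under the coordinate changes of the Newton-Puiseux step and keeps
  all derivatives one-dimensional.\<close>

definition hol2 :: "real \<Rightarrow> (complex \<Rightarrow> complex \<Rightarrow> complex) \<Rightarrow> bool" where
  "hol2 R F \<longleftrightarrow> continuous_on (ball 0 R \<times> ball 0 R) (\<lambda>(t, w). F t w) \<and>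
     (\<forall>T a b. open T \<longrightarrow> a holomorphic_on T \<longrightarrow> b holomorphic_on T \<longrightarrow> a ` T \<subseteq> ball 0 R \<longrightarrow>
        b ` T \<subseteq> ball 0 R \<longrightarrow> (\<lambda>s. F (a s) (b s)) holomorphic_on T)"

lemma hol2_compose:
  assumes "hol2 R F" "open T" "a holomorphic_on T" "b holomorphic_on T"
    "\<And>s. s \<in> T \<Longrightarrow> norm (a s) < R" "\<And>s. s \<in> T \<Longrightarrow> norm (b s) < R"
  shows "(\<lambda>s. F (a s) (b s)) holomorphic_on T"
proof -
  have "a ` T \<subseteq> ball 0 R" "b ` T \<subseteq> ball 0 R" using assms(5,6) by auto
  then show ?thesis using assms(1-4) by (auto simp: hol2_def)
qed

text \<open>\<open>P t\<close> is the monic polynomial whose roots are the zeros of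
  \<open>F t\<close> in a small disc. Only the equality of zero sets is kept; the invertible factor
  of the preparation theorem is not constructed.\<close>

lemma weierstrass_polynomial:
  assumes F: "hol2 R F" and "0 < R" "0 < N"
    and g: "g holomorphic_on ball 0 r" "0 < r" "g 0 \<noteq> 0" "\<And>w. w \<in> ball 0 r \<Longrightarrow> F 0 w = w ^ N * g w"
  obtains \<rho> \<kappa> P where "0 < \<rho>" "\<rho> \<le> R" "0 < \<kappa>" "\<kappa> < R"
    "\<And>j. (\<lambda>t. coeff (P t) j) holomorphic_on ball 0 \<rho>"
    "\<And>t. t \<in> ball 0 \<rho> \<Longrightarrow> degree (P t) = N" "\<And>t. t \<in> ball 0 \<rho> \<Longrightarrow> lead_coeff (P t) = 1"
    "\<And>t w. t \<in> ball 0 \<rho> \<Longrightarrow> w \<in> ball 0 \<kappa> \<Longrightarrow> F t w = 0 \<longleftrightarrow> poly (P t) w = 0"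
    "P 0 = monom 1 N"
proof -
  have contF: "continuous_on (ball 0 R \<times> ball 0 R) (\<lambda>(t, w). F t w)"
    using F by (simp add: hol2_def)
  have "continuous (at 0) g"
    using g by (metis centre_in_ball continuous_on_eq_continuous_at holomorphic_on_imp_continuous_on open_ball)
  then obtain r' where r': "r' > 0" "\<And>w. norm w < r' \<Longrightarrow> g w \<noteq> 0"
    using continuous_at_avoid[of 0 g 0] g(3) by (auto simp: dist_norm)
  \<comment> \<open>Small enough that 0 is the only zero of \<open>F 0\<close> in the closed disc;
    by compactness of the circle \<open>F t\<close> then has no zero on it for small
    \<open>t\<close>.\<close>
  define \<kappa> where "\<kappa> = min (min r r') R / 2"
  have \<kappa>: "0 < \<kappa>" "\<kappa> < r" "\<kappa> < r'" "\<kappa> < R" using g(2) r'(1) \<open>0 < R\<close> by (auto simp: \<kappa>_def)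
  have F0: "F 0 w = 0 \<longleftrightarrow> w = 0" if "norm w \<le> \<kappa>" for w
    using that \<kappa> g(4)[of w] r'(2)[of w] \<open>0 < N\<close> by auto
  have "continuous_on (ball 0 R \<times> sphere 0 \<kappa>) (\<lambda>(t, w). F t w)"
    by (rule continuous_on_subset[OF contF]) (use \<kappa> in auto)
  then obtain \<rho>' where \<rho>': "\<rho>' > 0"
    "\<And>t w. t \<in> ball 0 R \<Longrightarrow> dist t 0 < \<rho>' \<Longrightarrow> w \<in> sphere 0 \<kappa> \<Longrightarrow> F t w \<noteq> 0"
    by (rule nonvanishing_nbhd[of _ _ F 0]) (use \<open>0 < R\<close> F0 \<kappa> in auto)
  define \<rho> where "\<rho> = min \<rho>' R"
  have \<rho>: "0 < \<rho>" "\<rho> \<le> R" and nz: "\<And>t w. t \<in> ball 0 \<rho> \<Longrightarrow> norm w = \<kappa> \<Longrightarrow> F t w \<noteq> 0"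
    using \<rho>' \<open>0 < R\<close> by (auto simp: \<rho>_def dist_norm)
  have contF': "continuous_on (ball 0 \<rho> \<times> ball 0 R) (\<lambda>(t, w). F t w)"
    by (rule continuous_on_subset[OF contF]) (use \<rho> in auto)
  have holF: "F t holomorphic_on ball 0 R" if "t \<in> ball 0 \<rho>" for t
    using hol2_compose[OF F, of "ball 0 R" "\<lambda>_. t" "\<lambda>w. w"] that \<rho> by (auto intro!: holomorphic_intros)
  have holF': "(\<lambda>t. F t w) holomorphic_on ball 0 \<rho>" if "w \<in> ball 0 R" for w
    using hol2_compose[OF F, of "ball 0 \<rho>" "\<lambda>t. t" "\<lambda>_. w"] that \<rho> by (auto intro!: holomorphic_intros)
  define P where "P t = root_poly \<kappa> (F t) (\<lambda>w. w)" for t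
  have 0: "(0::complex) \<in> ball 0 \<rho>" using \<rho> by simp
  have "zeros_in \<kappa> (F 0) = {0}" using F0 \<kappa> by (auto simp: zeros_in_def)
  moreover have "zorder (F 0) 0 = int N"
    using g by (intro zorder_eqI[of "ball 0 r" 0 g]) (auto simp: mult.commute)
  ultimately have P0: "P 0 = monom 1 N"
    by (simp add: P_def root_poly_def monom_altdef)
  obtain N' where N': "\<And>t k. t \<in> ball 0 \<rho> \<Longrightarrow> degree (root_poly \<kappa> (F t) k) = N'"
    by (rule degree_root_poly_constant[OF _ contF' holF \<kappa>(1,4) nz]) (assumption | rule that | simp)+
  then have "N' = N" using 0 P0 by (metis P_def degree_monom_eq one_neq_zero)
  show ?thesis
  proof (rule that[of \<rho> \<kappa> P])
    show "(\<lambda>t. coeff (P t) j) holomorphic_on ball 0 \<rho>" for j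
      unfolding P_def
      by (rule holomorphic_on_coeff_root_poly[OF _ contF' holF \<kappa>(1,4) nz, where C = R])
         (auto intro!: holF' holomorphic_intros continuous_intros simp: split_def)
    show "degree (P t) = N" if "t \<in> ball 0 \<rho>" for t
      using N'[OF that] \<open>N' = N\<close> by (simp add: P_def)
    show "lead_coeff (P t) = 1" if "t \<in> ball 0 \<rho>" for t
      using lead_coeff_root_poly[OF holF[OF that] \<kappa>(1,4) nz[OF that]] by (simp add: P_def)
    show "F t w = 0 \<longleftrightarrow> poly (P t) w = 0" if "t \<in> ball 0 \<rho>" "w \<in> ball 0 \<kappa>" for t w
      using poly_root_poly_eq_0_iff[OF holF[OF that(1)] \<kappa>(1,4) nz[OF that(1)], of "\<lambda>w. w" w] that(2)
      by (auto simp: P_def zeros_in_def)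
  qed (use \<rho> \<kappa> P0 in auto)
qed

section \<open>Puiseux curves\<close>

text \<open>The ratio \<open>p / q\<close> is the least of the quotients of the vanishing order of
  \<open>a j\<close> by \<open>N - j\<close>, a slope of the Newton polygon. Minimality makes every
  \<open>b j\<close> holomorphic after the substitution \<open>t = s ^ q\<close>,
  \<open>w = s ^ p * v\<close>; equality for one index gives a nonzero \<open>b j 0\<close>.\<close>

lemma newton_polygon:
  fixes a :: "nat \<Rightarrow> complex \<Rightarrow> complex"
  assumes hol: "\<And>j. j < M \<Longrightarrow> a j holomorphic_on ball 0 \<rho>" and a0: "\<And>j. j < M \<Longrightarrow> a j 0 = 0"
    and ex: "j1 < M" "t1 \<in> ball 0 \<rho>" "a j1 t1 \<noteq> 0" and "M < N" "0 < \<rho>"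
  obtains q p \<sigma> b where "0 < q" "0 < p" "0 < \<sigma>" "\<sigma> \<le> 1" "\<sigma> \<le> \<rho>"
    "\<And>j. j < M \<Longrightarrow> b j holomorphic_on ball 0 \<sigma>"
    "\<And>j s. j < M \<Longrightarrow> s \<in> ball 0 \<sigma> \<Longrightarrow> a j (s ^ q) = s ^ (p * (N - j)) * b j s"
    "\<exists>j<M. b j 0 \<noteq> 0"
proof -
  define J where "J = {j. j < M \<and> (\<exists>t\<in>ball 0 \<rho>. a j t \<noteq> 0)}"
  have J: "finite J" "j1 \<in> J" using ex by (auto simp: J_def)
  have "\<exists>n r g. 0 < n \<and> 0 < r \<and> g holomorphic_on ball 0 r \<and> g 0 \<noteq> 0 \<and>
      (\<forall>t\<in>ball 0 r. a j t = g t * t ^ n)" if "j \<in> J" for j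
  proof -
    have "a j holomorphic_on ball 0 \<rho>" "\<exists>t\<in>ball 0 \<rho>. a j t \<noteq> 0" "a j 0 = 0"
      using that hol a0 by (auto simp: J_def)
    then obtain r where "zorder (a j) 0 > 0" "r > 0" "zor_poly (a j) 0 holomorphic_on cball 0 r"
       "\<forall>w\<in>cball 0 r. a j w = zor_poly (a j) 0 w * (w - 0) ^ nat (zorder (a j) 0) \<and> zor_poly (a j) 0 w \<noteq> 0"
      using zorder_exist_zero[of "a j" "ball 0 \<rho>" 0] \<open>0 < \<rho>\<close> by auto
    then show ?thesis
      by (intro exI[of _ "nat (zorder (a j) 0)"] exI[of _ r] exI[of _ "zor_poly (a j) 0"])
         (auto intro: holomorphic_on_subset)
  qed
  then obtain n r g where ng: "\<And>j. j \<in> J \<Longrightarrow> 0 < n j" "\<And>j. j \<in> J \<Longrightarrow> 0 < r j"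
    "\<And>j. j \<in> J \<Longrightarrow> g j holomorphic_on ball 0 (r j)" "\<And>j. j \<in> J \<Longrightarrow> g j 0 \<noteq> (0::complex)"
    "\<And>j t. j \<in> J \<Longrightarrow> t \<in> ball 0 (r j) \<Longrightarrow> a j t = g j t * t ^ n j" by metis
  \<comment> \<open>The factorial is divisible by every \<open>N - j\<close>, so that all the
    slopes, multiplied by \<open>q\<close>, are integers \<open>e j\<close>.\<close>
  define q :: nat where "q = fact N"
  define e where "e j = q * n j div (N - j)" for j
  have e: "e j * (N - j) = q * n j" "0 < e j" if "j \<in> J" for j
  proof -
    have Nj: "0 < N - j" "N - j \<le> N" using that \<open>M < N\<close> by (auto simp: J_def)
    have "N - j dvd q" unfolding q_def by (rule dvd_fact) (use Nj in auto)
    then show "e j * (N - j) = q * n j" by (simp add: e_def)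
    moreover have "0 < q * n j" using ng(1)[OF that] by (simp add: q_def)
    ultimately show "0 < e j" by (metis mult_0 not_gr_zero)
  qed
  define p where "p = Min (e ` J)"
  have p_le: "p \<le> e j" if "j \<in> J" for j using that J by (simp add: p_def)
  have "p \<in> e ` J" unfolding p_def using J by (intro Min_in) auto
  then obtain j0 where j0: "j0 \<in> J" "p = e j0" by auto
  \<comment> \<open>The bound 1 gives |s^q| <= |s|, which keeps the substitution inside all the
    discs involved.\<close>
  define \<sigma> where "\<sigma> = Min (insert 1 (insert \<rho> (r ` J)))"
  have \<sigma>: "0 < \<sigma>" "\<sigma> \<le> 1" "\<sigma> \<le> \<rho>" "\<And>j. j \<in> J \<Longrightarrow> \<sigma> \<le> r j"
    using J ng(2) \<open>0 < \<rho>\<close> unfolding \<sigma>_def by (auto intro!: Min_le simp del: Min_insert)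
  have q0: "0 < q" by (simp add: q_def)
  have sq: "norm (s ^ q) < \<sigma>" if "s \<in> ball 0 \<sigma>" for s :: complex
  proof -
    have s: "norm s < \<sigma>" using that by simp
    have "norm s ^ q \<le> norm s ^ 1" using q0 s \<sigma> by (intro power_decreasing) auto
    then show ?thesis using s by (simp add: norm_power)
  qed
  have pq: "p * (N - j) \<le> q * n j" if "j \<in> J" for j
    using mult_right_mono[OF p_le[OF that], of "N - j"] e(1)[OF that] by simp
  \<comment> \<open>Coefficients outside \<open>J\<close> vanish identically, so 0 is the right
    value there.\<close>
  define b where "b j s = (if j \<in> J then s ^ (q * n j - p * (N - j)) * g j (s ^ q) else 0)" for j s
  show ?thesis
  proof (rule that[of q p \<sigma> b])
    show "b j holomorphic_on ball 0 \<sigma>" if "j < M" for j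
    proof (cases "j \<in> J")
      case True
      have "(\<lambda>s::complex. s ^ q) ` ball 0 \<sigma> \<subseteq> ball 0 (r j)" using less_le_trans[OF sq \<sigma>(4)[OF True]] by (auto simp: dist_norm)
      then have "(g j \<circ> (\<lambda>s. s ^ q)) holomorphic_on ball 0 \<sigma>"
        by (intro holomorphic_on_compose_gen[OF _ ng(3)[OF True]] holomorphic_intros) auto
      then show ?thesis using True unfolding b_def[abs_def] o_def by (auto intro!: holomorphic_intros)
    qed (simp add: b_def[abs_def])
    show "a j (s ^ q) = s ^ (p * (N - j)) * b j s" if "j < M" "s \<in> ball 0 \<sigma>" for j s
    proof (cases "j \<in> J")
      case True
      have "s ^ q \<in> ball 0 (r j)" using sq[OF that(2)] \<sigma>(4)[OF True] by simp
      then have "a j (s ^ q) = g j (s ^ q) * s ^ (q * n j)"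
        using ng(5)[OF True] by (simp add: power_mult)
      also have "s ^ (q * n j) = s ^ (p * (N - j)) * s ^ (q * n j - p * (N - j))"
        using pq[OF True] by (simp flip: power_add)
      finally show ?thesis using True by (simp add: b_def mult_ac)
    next
      case False
      have "s ^ q \<in> ball 0 \<rho>" using sq[OF that(2)] \<sigma>(3) by simp
      then show ?thesis using False that by (auto simp: b_def J_def)
    qed
    have "q * n j0 - p * (N - j0) = 0" using e(1)[OF j0(1)] j0(2) by simp
    then have "b j0 0 \<noteq> 0" using ng(4)[OF j0(1)] j0(1) q0 by (simp add: b_def zero_power)
    then show "\<exists>j<M. b j 0 \<noteq> 0" using j0(1) by (auto simp: J_def)
    show "0 < p" using e(2) j0 by simp
  qed (use \<sigma> q0 in auto)
qed

text \<open>This keeps the rescaled zeros in a compact disc. If |w| > 1, every lower term is at most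
  \<open>B\<close> times |w|^(N-1), and dividing the equation by this power gives the bound.\<close>

lemma root_bound:
  fixes w :: complex
  assumes "w ^ N + (\<Sum>j<M. b j * w ^ j) = 0" "M < N" "\<And>j. j < M \<Longrightarrow> norm (b j) \<le> B"
  shows "norm w \<le> 1 + real M * B"
proof (cases "norm w \<le> 1")
  case True
  have "0 \<le> real M * B"
  proof (cases M)
    case (Suc m) then show ?thesis using assms(3)[of 0] order_trans[OF norm_ge_zero, of "b 0" B] by simp
  qed simp
  then show ?thesis using True by simp
next
  case False
  then have w: "1 < norm w" by simp
  have "norm w * norm w ^ (N - 1) = norm (w ^ N)"
    using \<open>M < N\<close> by (cases N) (simp_all add: norm_power norm_mult)
  also have "w ^ N = - (\<Sum>j<M. b j * w ^ j)" using assms(1) by (simp add: eq_neg_iff_add_eq_0)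
  also have "norm \<dots> \<le> (\<Sum>j<M. norm (b j * w ^ j))" by (simp add: norm_sum)
  also have "\<dots> \<le> (\<Sum>j<M. B * norm w ^ (N - 1))"
  proof (rule sum_mono)
    fix j assume j: "j \<in> {..<M}"
    have "norm w ^ j \<le> norm w ^ (N - 1)" using w j \<open>M < N\<close> by (intro power_increasing) auto
    then show "norm (b j * w ^ j) \<le> B * norm w ^ (N - 1)"
      unfolding norm_mult norm_power
      by (intro mult_mono) (use j assms(3)[of j] order_trans[OF norm_ge_zero, of "b j" B] in auto)
  qed
  finally have *: "norm w * norm w ^ (N - 1) \<le> (real M * B) * norm w ^ (N - 1)" by simp
  have "norm w \<le> real M * B"
    by (rule mult_right_le_imp_le[OF *]) (rule zero_less_power, use w in linarith)
  then show ?thesis by simp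
qed

text \<open>The Tschirnhaus shift by the mean \<open>c t\<close> of the roots removes the
  coefficient of index \<open>N - 1\<close>. Without it the rescaled polynomial could again be a
  pure \<open>N\<close>-th power, and the induction on the multiplicity would not advance.\<close>

lemma shifted_polynomial:
  fixes P :: "complex \<Rightarrow> complex poly"
  assumes hol: "\<And>j. (\<lambda>t. coeff (P t) j) holomorphic_on ball 0 \<rho>"
    and deg: "\<And>t. t \<in> ball 0 \<rho> \<Longrightarrow> degree (P t) = N"
    and lead: "\<And>t. t \<in> ball 0 \<rho> \<Longrightarrow> lead_coeff (P t) = 1"
    and P0: "P 0 = monom 1 N" and "0 < \<rho>" "0 < N"
  obtains c a where "c holomorphic_on ball 0 \<rho>" "c 0 = 0"
    "\<And>j. j < N - 1 \<Longrightarrow> a j holomorphic_on ball 0 \<rho>" "\<And>j. j < N - 1 \<Longrightarrow> a j 0 = 0"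
    "\<And>t w. t \<in> ball 0 \<rho> \<Longrightarrow> poly (P t) (w + c t) = w ^ N + (\<Sum>j<N - 1. a j t * w ^ j)"
proof -
  define c where "c t = - coeff (P t) (N - 1) / of_nat N" for t
  define a where "a j t = (\<Sum>i\<le>N. coeff (P t) i * of_nat (i choose j) * c t ^ (i - j))" for j t
  have c: "c holomorphic_on ball 0 \<rho>"
    unfolding c_def[abs_def] by (intro holomorphic_intros hol) (use \<open>0 < N\<close> in auto)
  have c0: "c 0 = 0" using \<open>0 < N\<close> by (simp add: c_def P0)
  have "poly (P t) (w + c t) = w ^ N + (\<Sum>j<N - 1. a j t * w ^ j)" if t: "t \<in> ball 0 \<rho>" for t w
  proof -
    have lead': "coeff (P t) N = 1" using lead[OF t] deg[OF t] by simp
    have "poly (P t) (w + c t) = (\<Sum>i\<le>N. coeff (P t) i * (w + c t) ^ i)"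
      by (simp add: poly_altdef deg[OF t])
    also have "\<dots> = (\<Sum>i\<le>N. \<Sum>j\<le>N. coeff (P t) i * of_nat (i choose j) * c t ^ (i - j) * w ^ j)"
    proof (intro sum.cong refl)
      fix i assume i: "i \<in> {..N}"
      have "(w + c t) ^ i = (\<Sum>j\<le>i. of_nat (i choose j) * w ^ j * c t ^ (i - j))"
        by (rule binomial_ring)
      also have "\<dots> = (\<Sum>j\<le>N. of_nat (i choose j) * w ^ j * c t ^ (i - j))"
        using i by (intro sum.mono_neutral_left) (auto simp: binomial_eq_0)
      finally show "coeff (P t) i * (w + c t) ^ i =
          (\<Sum>j\<le>N. coeff (P t) i * of_nat (i choose j) * c t ^ (i - j) * w ^ j)"
        by (simp add: sum_distrib_left mult_ac)
    qed
    also have "\<dots> = (\<Sum>j\<le>N. a j t * w ^ j)"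
      by (subst sum.swap) (simp add: a_def sum_distrib_right)
    also have "\<dots> = a N t * w ^ N + a (N - 1) t * w ^ (N - 1) + (\<Sum>j<N - 1. a j t * w ^ j)"
      using \<open>0 < N\<close> by (cases N) (simp_all add: lessThan_Suc_atMost[symmetric])
    also have "a N t = coeff (P t) N * of_nat (N choose N) * c t ^ (N - N)"
      unfolding a_def by (subst sum.remove[of _ N]) (auto intro!: sum.neutral)
    also have "\<dots> = 1" by (simp add: lead')
    also have "a (N - 1) t = (\<Sum>i\<in>{N - 1, N}. coeff (P t) i * of_nat (i choose (N - 1)) * c t ^ (i - (N - 1)))"
      unfolding a_def by (rule sum.mono_neutral_right) (auto simp: binomial_eq_0)
    also have "\<dots> = coeff (P t) (N - 1) + of_nat N * c t"
      using \<open>0 < N\<close> lead' by (cases N) simp_all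
    also have "\<dots> = 0" using \<open>0 < N\<close> by (simp add: c_def)
    finally show ?thesis by simp
  qed
  moreover have "a j 0 = 0" if "j < N - 1" for j
    unfolding a_def P0 using that c0 by (intro sum.neutral) (auto simp: zero_power)
  moreover have "a j holomorphic_on ball 0 \<rho>" for j
    unfolding a_def[abs_def] by (intro holomorphic_intros hol c)
  ultimately show ?thesis using that[of c a] c c0 by blast
qed

text \<open>Order \<open>N\<close> at \<open>w0\<close> would mean that \<open>p\<close> is the
  \<open>N\<close>-th power of \<open>w - w0\<close>. Its coefficient of index \<open>N - 1\<close>
  is \<open>- N * w0\<close> and vanishes, so \<open>w0 = 0\<close> and \<open>p\<close> is
  \<open>w ^ N\<close>, against \<open>b j0 \<noteq> 0\<close>. Hence the multiplicity drops
  strictly.\<close>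

lemma monic_without_subleading_order:
  fixes p :: "complex poly"
  assumes p: "\<And>w. poly p w = w ^ N + (\<Sum>j<N - 1. b j * w ^ j)" and b: "j0 < N - 1" "b j0 \<noteq> 0"
  obtains m q where "m < N" "\<And>w. poly p (w0 + w) = w ^ m * poly q w" "poly q 0 \<noteq> 0"
proof -
  define p' where "p' = monom 1 N + (\<Sum>j<N - 1. monom (b j) j)"
  have "poly p = poly p'" by (rule ext) (simp add: p p'_def poly_sum poly_monom)
  then have pp: "p = p'" by (simp only: poly_eq_poly_eq_iff)
  have coeff: "coeff p i = (if i = N then 1 else if i < N - 1 then b i else 0)" for i
    unfolding pp p'_def using b by (auto simp: coeff_sum)
  have degp: "degree p = N"
  proof (rule antisym)
    show "degree p \<le> N" by (rule degree_le) (auto simp: coeff)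
    show "N \<le> degree p" by (rule le_degree) (simp add: coeff)
  qed
  then have "p \<noteq> 0" using b by auto
  obtain q where q: "p = [:- w0, 1:] ^ order w0 p * q" "\<not> [:- w0, 1:] dvd q"
    using order_decomp[OF \<open>p \<noteq> 0\<close>] by blast
  have "order w0 p \<noteq> N"
  proof
    assume N: "order w0 p = N"
    have "q \<noteq> 0" using q \<open>p \<noteq> 0\<close> by auto
    have "degree p = degree ([:- w0, 1:] ^ N) + degree q"
      using q(1) N \<open>q \<noteq> 0\<close> degree_mult_eq[of "[:- w0, 1:] ^ N" q] by simp
    then have "degree q = 0" using degp by (simp add: degree_linear_power)
    then obtain d where d: "q = [:d:]" by (rule degree_eq_zeroE)
    have p: "p = smult d ([:- w0, 1:] ^ N)" using q(1) N d by simp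
    have "coeff p N = d" unfolding p by (simp add: coeff_linear_poly_power)
    then have "d = 1" by (simp add: coeff)
    have "coeff p (N - 1) = - of_nat N * w0"
      unfolding p
      using b \<open>d = 1\<close> coeff_linear_poly_power[of "N - 1" N "- w0" 1] binomial_symmetric[of 1 N] by simp
    moreover have "N \<noteq> 0" "N - 1 \<noteq> N" using b by auto
    ultimately have "w0 = 0" by (simp add: coeff del: One_nat_def)
    moreover have "j0 < N" using b by simp
    ultimately have "coeff p j0 = 0"
      unfolding p by (simp add: coeff_linear_poly_power)
    then show False using b by (auto simp: coeff split: if_splits)
  qed
  then have "order w0 p < N" using order_degree[OF \<open>p \<noteq> 0\<close>, of w0] degp by simp
  moreover have "poly p (w0 + w) = w ^ order w0 p * poly (pcompose q [:w0, 1:]) w" for w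
    by (subst q(1)) (simp add: poly_pcompose poly_power)
  moreover have "poly (pcompose q [:w0, 1:]) 0 \<noteq> 0"
    using q(2) by (simp add: poly_pcompose poly_eq_0_iff_dvd)
  ultimately show ?thesis by (rule that)
qed

lemma complex_nth_root_exists:
  assumes "0 < q" "t \<noteq> 0" obtains s :: complex where "s ^ q = t" "s \<noteq> 0"
proof -
  have "exp (Ln t / of_nat q) ^ q = t"
    using assms by (simp flip: exp_of_nat_mult)
  then show ?thesis using that by (metis exp_not_eq_zero)
qed

lemma continuous_at_0_small:
  fixes c :: "complex \<Rightarrow> complex"
  assumes "c holomorphic_on ball 0 \<rho>" "0 < \<rho>" "c 0 = 0" "0 < e"
  obtains d where "0 < d" "d \<le> \<rho>" "\<And>t. norm t < d \<Longrightarrow> norm (c t) < e"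
proof -
  have "continuous (at 0) c"
    using assms by (metis centre_in_ball continuous_on_eq_continuous_at holomorphic_on_imp_continuous_on open_ball)
  then obtain d where "0 < d" "\<And>t. dist t 0 < d \<Longrightarrow> dist (c t) (c 0) < e"
    using \<open>0 < e\<close> unfolding continuous_at_eps_delta dist_norm by blast
  then show ?thesis using that[of "min d \<rho>"] assms by auto
qed

text \<open>The identity theorem, in the form needed to carry the vanishing of the other equations
  from a sequence of common zeros to a whole curve.\<close>

lemma holomorphic_zero_if_zero_on_sequence:
  fixes h :: "complex \<Rightarrow> complex"
  assumes "h holomorphic_on ball 0 \<sigma>" "0 < \<sigma>" "t \<longlonglongrightarrow> 0" "\<And>n. t n \<noteq> 0"
    and "\<forall>\<^sub>F n in sequentially. h (t n) = 0" "s \<in> ball 0 \<sigma>"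
  shows "h s = 0"
proof -
  have "\<forall>\<^sub>F n in sequentially. t n \<in> ball 0 \<sigma>"
    using assms(2,3) by (intro topological_tendstoD) auto
  with assms(5) have "\<forall>\<^sub>F n in sequentially. h (t n) = 0 \<and> t n \<in> ball 0 \<sigma>"
    by eventually_elim auto
  then obtain n0 where n0: "\<And>n. n \<ge> n0 \<Longrightarrow> h (t n) = 0 \<and> t n \<in> ball 0 \<sigma>"
    by (auto simp: eventually_sequentially)
  let ?U = "{t n | n. n \<ge> n0}"
  have "0 islimpt ?U"
    unfolding islimpt_sequential
    by (intro exI[of _ "\<lambda>n. t (n + n0)"]) (use assms(3,4) in \<open>auto intro: LIMSEQ_ignore_initial_segment\<close>)
  then show ?thesis
    using n0 assms by (intro analytic_continuation[of h "ball 0 \<sigma>" ?U 0 s]) auto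
qed

text \<open>Induction on the order \<open>N\<close> of \<open>F1 0\<close> at the origin. Either all
  zeros of \<open>F1\<close> near the origin lie on one graph, or a Newton-Puiseux substitution
  centred at a limit of rescaled common zeros lowers the order. The other members of
  \<open>H\<close> are carried along: the given common zeros force them to vanish on the curve found
  at the end.\<close>

lemma puiseux_curve:
  assumes "0 < R" "\<And>F. F \<in> H \<Longrightarrow> hol2 R F" "F1 \<in> H"
    and "g holomorphic_on ball 0 r" "0 < r" "g 0 \<noteq> 0" "\<And>w. w \<in> ball 0 r \<Longrightarrow> F1 0 w = w ^ N * g w"
    and "\<And>e. e > 0 \<Longrightarrow> \<exists>t w. t \<noteq> 0 \<and> norm t < e \<and> norm w < e \<and> (\<forall>F\<in>H. F t w = 0)"
  shows "\<exists>\<sigma>>0. \<exists>a b. a holomorphic_on ball 0 \<sigma> \<and> b holomorphic_on ball 0 \<sigma> \<and> a 0 = 0 \<and> b 0 = 0 \<and>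
    (\<forall>s\<in>ball 0 \<sigma>. (s \<noteq> 0 \<longrightarrow> a s \<noteq> 0) \<and> norm (a s) < R \<and> norm (b s) < R \<and> (\<forall>F\<in>H. F (a s) (b s) = 0))"
  using assms
proof (induction N arbitrary: R H F1 g r rule: less_induct)
  case (less N)
  note R = less.prems(1) and hol = less.prems(2) and F1 = less.prems(3)
  have "\<exists>t w. t \<noteq> 0 \<and> norm t < inverse (real (Suc n)) \<and> norm w < inverse (real (Suc n)) \<and> (\<forall>F\<in>H. F t w = 0)" for n
    by (rule less.prems(8)) simp
  then obtain t w where tw: "\<And>n. t n \<noteq> 0" "\<And>n. norm (t n) < inverse (real (Suc n))"
    "\<And>n. norm (w n) < inverse (real (Suc n))" "\<And>n F. F \<in> H \<Longrightarrow> F (t n) (w n) = 0" by metis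
  have t: "t \<longlonglongrightarrow> 0" and w: "w \<longlonglongrightarrow> 0"
    by (rule Lim_null_comparison[OF _ LIMSEQ_inverse_real_of_nat];
        use tw in \<open>auto intro!: always_eventually less_imp_le\<close>)+
  have ev: "\<forall>\<^sub>F n in sequentially. norm (t n) < e" "\<forall>\<^sub>F n in sequentially. norm (w n) < e" if "0 < e" for e
    using that t w by (auto simp: tendsto_iff dist_norm)
  \<comment> \<open>For \<open>N = 0\<close> the value \<open>F1 0 0\<close> is nonzero, although
    zeros of \<open>F1\<close> accumulate at the origin.\<close>
  have "N \<noteq> 0"
  proof
    assume "N = 0"
    then have "F1 0 0 \<noteq> 0" using less.prems(5,6) less.prems(7)[of 0] by simp
    have cont: "continuous_on (ball 0 R \<times> ball 0 R) (\<lambda>(t, w). F1 t w)"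
      using hol[OF F1] by (simp add: hol2_def)
    have "\<forall>\<^sub>F n in sequentially. (t n, w n) \<in> ball 0 R \<times> ball 0 R"
      using ev(1)[OF R] ev(2)[OF R] by eventually_elim auto
    then have "(\<lambda>n. (\<lambda>(t, w). F1 t w) (t n, w n)) \<longlonglongrightarrow> (\<lambda>(t, w). F1 t w) (0, 0)"
      using R by (intro continuous_on_tendsto_compose[OF cont] tendsto_Pair t w) auto
    then have "F1 0 0 = 0" using tw(4)[OF F1] by (simp add: LIMSEQ_const_iff)
    then show False using \<open>F1 0 0 \<noteq> 0\<close> by simp
  qed
  then have "0 < N" by simp
  obtain \<rho> \<kappa> P where W: "0 < \<rho>" "\<rho> \<le> R" "0 < \<kappa>" "\<kappa> < R"
    "\<And>j. (\<lambda>t. coeff (P t) j) holomorphic_on ball 0 \<rho>"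
    "\<And>t. t \<in> ball 0 \<rho> \<Longrightarrow> degree (P t) = N" "\<And>t. t \<in> ball 0 \<rho> \<Longrightarrow> lead_coeff (P t) = 1"
    "\<And>t w. t \<in> ball 0 \<rho> \<Longrightarrow> w \<in> ball 0 \<kappa> \<Longrightarrow> F1 t w = 0 \<longleftrightarrow> poly (P t) w = 0" "P 0 = monom 1 N"
    by (rule weierstrass_polynomial[OF hol[OF F1] R \<open>0 < N\<close> less.prems(4-7)]) (assumption | rule that)+
  obtain c a where c: "c holomorphic_on ball 0 \<rho>" "c 0 = 0"
    and a: "\<And>j. j < N - 1 \<Longrightarrow> a j holomorphic_on ball 0 \<rho>" "\<And>j. j < N - 1 \<Longrightarrow> a j 0 = 0"
    and P: "\<And>t w. t \<in> ball 0 \<rho> \<Longrightarrow> poly (P t) (w + c t) = w ^ N + (\<Sum>j<N - 1. a j t * w ^ j)"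
    by (rule shifted_polynomial[OF W(5-7,9,1) \<open>0 < N\<close>]) (assumption | rule that)+
  have zero: "(w - c t) ^ N + (\<Sum>j<N - 1. a j t * (w - c t) ^ j) = 0"
    if "t \<in> ball 0 \<rho>" "w \<in> ball 0 \<kappa>" "F1 t w = 0" for t w
    using P[OF that(1), of "w - c t"] W(8)[OF that(1,2)] that(3) by simp
  show ?case
  proof (cases "\<forall>j<N - 1. \<forall>t\<in>ball 0 \<rho>. a j t = 0")
    \<comment> \<open>The shifted polynomial is a pure \<open>N\<close>-th power, so every zero of
      \<open>F1\<close> near the origin lies on the graph of \<open>c\<close>.\<close>
    case True
    obtain \<sigma> where \<sigma>: "0 < \<sigma>" "\<sigma> \<le> \<rho>" "\<And>t. norm t < \<sigma> \<Longrightarrow> norm (c t) < \<kappa>"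
      using continuous_at_0_small[OF c(1) W(1) c(2) W(3)] by blast
    have cw: "\<forall>\<^sub>F n in sequentially. w n = c (t n)"
      using ev(1)[OF W(1)] ev(2)[OF W(3)]
    proof eventually_elim
      case (elim n)
      then have "(w n - c (t n)) ^ N = 0"
        using zero[of "t n" "w n"] tw(4)[OF F1] True by simp
      then show ?case by simp
    qed
    have "F s (c s) = 0" if F: "F \<in> H" and s: "s \<in> ball 0 \<sigma>" for F s
    proof (rule holomorphic_zero_if_zero_on_sequence[OF _ \<sigma>(1) t tw(1) _ s])
      show "(\<lambda>s. F s (c s)) holomorphic_on ball 0 \<sigma>"
        using \<sigma> W(2,4) by (intro hol2_compose[OF hol[OF F]] holomorphic_intros holomorphic_on_subset[OF c(1)])
          (fastforce simp: subset_ball)+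
      show "\<forall>\<^sub>F n in sequentially. F (t n) (c (t n)) = 0"
        using cw by eventually_elim (metis tw(4)[OF F])
    qed
    moreover have "c holomorphic_on ball 0 \<sigma>"
      by (rule holomorphic_on_subset[OF c(1)]) (use \<sigma> in auto)
    moreover have "norm s < R" "norm (c s) < R" if "s \<in> ball 0 \<sigma>" for s
      using that \<sigma>(2) \<sigma>(3)[of s] W(2,4) by auto
    ultimately show ?thesis
      by - (rule exI[of _ \<sigma>], rule conjI[OF \<sigma>(1)], rule exI[of _ "\<lambda>s. s"], rule exI[of _ c],
          simp add: c(2))
  next
    case False
    then obtain j1 t1 where j1: "j1 < N - 1" "t1 \<in> ball 0 \<rho>" "a j1 t1 \<noteq> 0" by blast
    have "N - 1 < N" using \<open>0 < N\<close> by simp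
    obtain q p \<sigma> b where qp: "0 < q" "0 < p" and \<sigma>: "0 < \<sigma>" "\<sigma> \<le> 1" "\<sigma> \<le> \<rho>"
      and b: "\<And>j. j < N - 1 \<Longrightarrow> b j holomorphic_on ball 0 \<sigma>"
      and ab: "\<And>j s. j < N - 1 \<Longrightarrow> s \<in> ball 0 \<sigma> \<Longrightarrow> a j (s ^ q) = s ^ (p * (N - j)) * b j s"
      and b0: "\<exists>j<N - 1. b j 0 \<noteq> 0"
      by (rule newton_polygon[where a = a and M = "N - 1", OF a j1 \<open>N - 1 < N\<close> W(1)]) (assumption | rule that)+
    \<comment> \<open>The strict transform: the substitution turns the Weierstrass polynomial into
      \<open>s ^ (p * N) * Q s v\<close>.\<close>
    define Q where "Q s v = v ^ N + (\<Sum>j<N - 1. b j s * v ^ j)" for s v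
    have Q: "(s ^ p * v) ^ N + (\<Sum>j<N - 1. a j (s ^ q) * (s ^ p * v) ^ j) = s ^ (p * N) * Q s v"
      if s: "s \<in> ball 0 \<sigma>" for s v
    proof -
      have *: "a j (s ^ q) * (s ^ p * v) ^ j = s ^ (p * N) * (b j s * v ^ j)" if "j < N - 1" for j
      proof -
        have "p * N = p * (N - j) + p * j" using that by (simp flip: add_mult_distrib2)
        then have "s ^ (p * N) = s ^ (p * (N - j)) * s ^ (p * j)" by (simp add: power_add)
        then show ?thesis using ab[OF that s] by (simp add: power_mult_distrib power_mult)
      qed
      have "(s ^ p * v) ^ N = s ^ (p * N) * v ^ N" by (simp add: power_mult_distrib power_mult)
      then show ?thesis
        unfolding Q_def distrib_left sum_distrib_left
        by (intro arg_cong2[where f = "(+)"] sum.cong refl) (auto intro: *)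
    qed
    \<comment> \<open>The given zeros are lifted through the substitution: \<open>s n\<close> is a
      root of \<open>t n\<close> of degree \<open>q\<close>, and \<open>v n\<close> below is the
      rescaled second coordinate.\<close>
    have "\<exists>s. s ^ q = t n \<and> s \<noteq> 0" for n
      using complex_nth_root_exists[OF qp(1) tw(1)[of n]] by blast
    then obtain s where s: "\<And>n. s n ^ q = t n" "\<And>n. s n \<noteq> 0" by metis
    have "(\<lambda>n. root q (norm (t n))) \<longlonglongrightarrow> root q 0"
      using t by (intro tendsto_real_root) (simp add: tendsto_norm_zero)
    moreover have "root q (norm (t n)) = norm (s n)" for n
      using qp(1) by (simp flip: s(1) add: norm_power real_root_power_cancel)
    ultimately have s0: "s \<longlonglongrightarrow> 0" using qp(1) by (simp add: tendsto_norm_zero_iff)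
    define v where "v n = (w n - c (t n)) / s n ^ p" for n
    have evs: "\<forall>\<^sub>F n in sequentially. norm (s n) < e" if "0 < e" for e
      using that s0 by (auto simp: tendsto_iff dist_norm)
    have Qv: "\<forall>\<^sub>F n in sequentially. Q (s n) (v n) = 0"
      using ev(1)[OF W(1)] ev(2)[OF W(3)] evs[OF \<sigma>(1)]
    proof eventually_elim
      case (elim n)
      have "s n ^ p * v n = w n - c (t n)" using s(2)[of n] by (simp add: v_def)
      then have "s n ^ (p * N) * Q (s n) (v n) = 0"
        using Q[of "s n" "v n"] zero[of "t n" "w n"] elim tw(4)[OF F1] s(1)[of n] by simp
      then show ?case using s(2)[of n] by simp
    qed
    have "\<exists>B. \<forall>s\<in>cball 0 (\<sigma> / 2). norm (b j s) \<le> B" if "j < N - 1" for j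
    proof -
      have "continuous_on (cball 0 (\<sigma> / 2)) (b j)"
        using b[OF that] \<sigma>(1) by (auto intro!: holomorphic_on_imp_continuous_on elim!: holomorphic_on_subset)
      then have "bounded (b j ` cball 0 (\<sigma> / 2))"
        by (intro compact_imp_bounded compact_continuous_image) auto
      then show ?thesis by (auto simp: bounded_iff)
    qed
    then obtain Bf where Bf: "\<And>j s. j < N - 1 \<Longrightarrow> s \<in> cball 0 (\<sigma> / 2) \<Longrightarrow> norm (b j s) \<le> Bf j" by metis
    define B where "B = (\<Sum>j<N - 1. \<bar>Bf j\<bar>)"
    have B: "norm (b j s) \<le> B" if "j < N - 1" "s \<in> cball 0 (\<sigma> / 2)" for j s
    proof -
      have "norm (b j s) \<le> \<bar>Bf j\<bar>" using Bf[OF that] by simp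
      also have "\<dots> \<le> B" unfolding B_def by (rule member_le_sum) (use that in auto)
      finally show ?thesis .
    qed
    have "0 < \<sigma> / 2" using \<sigma> by simp
    have "\<forall>\<^sub>F n in sequentially. v n \<in> cball 0 (1 + real (N - 1) * B) \<and> Q (s n) (v n) = 0"
      using evs[OF \<open>0 < \<sigma> / 2\<close>] Qv
    proof eventually_elim
      case (elim n)
      then have "norm (v n) \<le> 1 + real (N - 1) * B"
        by (intro root_bound[where N = N and b = "\<lambda>j. b j (s n)"]) (use B \<open>0 < N\<close> in \<open>auto simp: Q_def\<close>)
      then show ?case using elim by simp
    qed
    then obtain n0 where n0: "\<And>n. n \<ge> n0 \<Longrightarrow> v n \<in> cball 0 (1 + real (N - 1) * B)"
      "\<And>n. n \<ge> n0 \<Longrightarrow> Q (s n) (v n) = 0" by (auto simp: eventually_sequentially)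
    \<comment> \<open>A limit of the rescaled zeros serves as the new centre, so common zeros
      accumulate there by construction.\<close>
    obtain w0 f where f: "strict_mono f" "((\<lambda>n. v (n + n0)) \<circ> f) \<longlonglongrightarrow> w0"
      using compact_cball[of 0 "1 + real (N - 1) * B"] n0(1) unfolding compact_def
      by (metis le_add2)
    define p0 where "p0 = monom 1 N + (\<Sum>j<N - 1. monom (b j 0) j)"
    have p0: "poly p0 v = v ^ N + (\<Sum>j<N - 1. b j 0 * v ^ j)" for v
      by (simp add: p0_def poly_sum poly_monom)
    obtain m q' where m: "m < N" "\<And>w. poly p0 (w0 + w) = w ^ m * poly q' w" "poly q' 0 \<noteq> 0"
      using monic_without_subleading_order[OF p0] b0 by metis
    have "0 < R / 2" using R by simp
    obtain d where d: "0 < d" "d \<le> \<rho>" "\<And>t. norm t < d \<Longrightarrow> norm (c t) < R / 2"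
      using continuous_at_0_small[OF c(1) W(1) c(2) \<open>0 < R / 2\<close>] by blast
    \<comment> \<open>One half of \<open>R\<close> is reserved for the term
      \<open>s ^ p * (w0 + w)\<close>, the other half for \<open>c (s ^ q)\<close>.\<close>
    define R' where "R' = min (min \<sigma> d) (R / (2 * (norm w0 + 1)))"
    have R': "0 < R'" "R' \<le> \<sigma>" "R' \<le> d" "R' * (norm w0 + 1) \<le> R / 2"
    proof -
      have "0 < R / (2 * (norm w0 + 1))"
        using R by (intro divide_pos_pos mult_pos_pos add_nonneg_pos) auto
      then show "0 < R'" "R' \<le> \<sigma>" "R' \<le> d" using \<sigma> d by (auto simp: R'_def)
      have "R' * (norm w0 + 1) \<le> R / (2 * (norm w0 + 1)) * (norm w0 + 1)"
        by (intro mult_right_mono) (auto simp: R'_def)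
      also have "\<dots> = R / 2"
      proof -
        have "x \<noteq> 0 \<Longrightarrow> R / (2 * x) * x = R / 2" for x by simp
        moreover have "norm w0 + 1 \<noteq> 0" using norm_ge_zero[of w0] by linarith
        ultimately show ?thesis by blast
      qed
      finally show "R' * (norm w0 + 1) \<le> R / 2" .
    qed
    have sq: "norm (s ^ k) \<le> norm s" if "norm s < R'" "0 < k" for s :: complex and k
    proof -
      have "norm s ^ k \<le> norm s ^ 1" using that R' \<sigma> by (intro power_decreasing) auto
      then show ?thesis by (simp add: norm_power)
    qed
    have small1: "norm (s ^ q) < R" "norm (s ^ q) < d" if "norm s < R'" for s :: complex
      using sq[OF that qp(1)] that R'(3) d(2) W(2) by auto
    have small2: "norm (s ^ p * (w0 + w) + c (s ^ q)) < R" if "norm s < R'" "norm w < R'" for s w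
    proof -
      have "norm (s ^ p * (w0 + w)) \<le> norm s * (norm w0 + 1)"
        unfolding norm_mult using sq[OF that(1) qp(2)] that(2) R' \<sigma> norm_triangle_ineq[of w0 w]
        by (intro mult_mono) auto
      also have "\<dots> \<le> R' * (norm w0 + 1)" using that by (intro mult_right_mono) auto
      finally have "norm (s ^ p * (w0 + w)) \<le> R / 2" using R' by simp
      then show ?thesis using d(3)[OF small1(2)[OF that(1)]] norm_triangle_ineq[of "s ^ p * (w0 + w)" "c (s ^ q)"]
        by simp
    qed
    define \<Phi> where "\<Phi> F s w = F (s ^ q) (s ^ p * (w0 + w) + c (s ^ q))" for F :: "complex \<Rightarrow> complex \<Rightarrow> complex" and s w
    \<comment> \<open>\<open>\<Phi> F1\<close> cannot drive the induction, since for
      \<open>s = 0\<close> it vanishes identically in \<open>w\<close>. The strict transform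
      \<open>G\<close>, centred at \<open>w0\<close>, is added to the family for this purpose; its
      order \<open>m\<close> is less than \<open>N\<close>.\<close>
    define G where "G s w = Q s (w0 + w)" for s w
    have cq: "(\<lambda>x. c (\<alpha> x ^ q)) holomorphic_on T"
      if "\<alpha> holomorphic_on T" "\<And>x. x \<in> T \<Longrightarrow> norm (\<alpha> x) < R'" for \<alpha> T
    proof -
      have "(\<lambda>x. \<alpha> x ^ q) ` T \<subseteq> ball 0 \<rho>" using small1(2)[OF that(2)] d(2) by fastforce
      then have "(c \<circ> (\<lambda>x. \<alpha> x ^ q)) holomorphic_on T"
        by (intro holomorphic_on_compose_gen[OF _ c(1)] holomorphic_intros that)
      then show ?thesis by (simp add: o_def)
    qed
    have bq: "(\<lambda>x. b j (\<alpha> x)) holomorphic_on T"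
      if "j < N - 1" "\<alpha> holomorphic_on T" "\<And>x. x \<in> T \<Longrightarrow> norm (\<alpha> x) < R'" for j \<alpha> T
    proof -
      have "\<alpha> ` T \<subseteq> ball 0 \<sigma>" using that(3) R'(2) by fastforce
      then have "(b j \<circ> \<alpha>) holomorphic_on T"
        by (intro holomorphic_on_compose_gen[OF _ b[OF that(1)]] that)
      then show ?thesis by (simp add: o_def)
    qed
    have holG: "hol2 R' G"
      unfolding hol2_def
    proof (intro conjI allI impI)
      have "continuous_on (ball 0 R' \<times> ball 0 R') (\<lambda>x. b j (fst x))" if "j < N - 1" for j
        by (rule continuous_on_compose2[OF holomorphic_on_imp_continuous_on[OF b[OF that]]])
           (use R'(2) in \<open>auto intro!: continuous_intros\<close>)
      then show "continuous_on (ball 0 R' \<times> ball 0 R') (\<lambda>(t, w). G t w)"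
        unfolding split_def G_def Q_def by (auto intro!: continuous_intros)
      fix T \<alpha> \<beta> assume "open T" "\<alpha> holomorphic_on T" "\<beta> holomorphic_on T"
        "\<alpha> ` T \<subseteq> ball 0 R'" "\<beta> ` T \<subseteq> ball 0 R'"
      then show "(\<lambda>s. G (\<alpha> s) (\<beta> s)) holomorphic_on T"
        unfolding G_def Q_def by (intro holomorphic_intros bq) auto
    qed
    have hol\<Phi>: "hol2 R' (\<Phi> F)" if F: "F \<in> H" for F
      unfolding hol2_def
    proof (intro conjI allI impI)
      have cF: "continuous_on (ball 0 R \<times> ball 0 R) (\<lambda>(t, w). F t w)"
        using hol[OF F] by (simp add: hol2_def)
      have cc: "continuous_on (ball 0 R' \<times> ball 0 R') (\<lambda>x :: complex \<times> complex. c (fst x ^ q))"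
      proof (rule continuous_on_compose2[OF holomorphic_on_imp_continuous_on[OF c(1)]])
        show "(\<lambda>x :: complex \<times> complex. fst x ^ q) ` (ball 0 R' \<times> ball 0 R') \<subseteq> ball 0 \<rho>"
          using small1(2) d(2) by fastforce
      qed (intro continuous_intros)
      show "continuous_on (ball 0 R' \<times> ball 0 R') (\<lambda>(t, w). \<Phi> F t w)"
        unfolding split_def \<Phi>_def
        by (rule continuous_on_uncurry[OF cF, where a = "\<lambda>x. fst x ^ q" and
              b = "\<lambda>x. fst x ^ p * (w0 + snd x) + c (fst x ^ q)"])
           (use small1(1) small2 cc in \<open>auto intro!: continuous_intros\<close>)
      fix T \<alpha> \<beta> assume "open T" "\<alpha> holomorphic_on T" "\<beta> holomorphic_on T"
        "\<alpha> ` T \<subseteq> ball 0 R'" "\<beta> ` T \<subseteq> ball 0 R'"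
      moreover from this have "norm (\<alpha> x) < R'" "norm (\<beta> x) < R'" if "x \<in> T" for x
        using that by fastforce+
      ultimately show "(\<lambda>s. \<Phi> F (\<alpha> s) (\<beta> s)) holomorphic_on T"
        unfolding \<Phi>_def
        by (intro hol2_compose[OF hol[OF F]] holomorphic_intros cq small1(1) small2)
    qed
    have zeros: "\<exists>s w. s \<noteq> 0 \<and> norm s < e \<and> norm w < e \<and> (\<forall>F\<in>insert G (\<Phi> ` H). F s w = 0)" if "0 < e" for e
    proof -
      let ?k = "\<lambda>n. f n + n0"
      have "(\<lambda>n. v (?k n) - w0) \<longlonglongrightarrow> 0" using f(2) by (simp add: o_def LIM_zero)
      then have "\<forall>\<^sub>F n in sequentially. norm (v (?k n) - w0) < e"
        using \<open>0 < e\<close> by (auto simp: tendsto_iff dist_norm)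
      moreover have "filterlim ?k at_top sequentially"
        by (rule filterlim_compose[OF filterlim_add_const_nat_at_top filterlim_subseq[OF f(1)]])
      then have "\<forall>\<^sub>F n in sequentially. norm (s (?k n)) < e"
        using evs[OF \<open>0 < e\<close>] unfolding filterlim_iff by blast
      ultimately have "\<forall>\<^sub>F n in sequentially. norm (v (?k n) - w0) < e \<and> norm (s (?k n)) < e"
        by eventually_elim auto
      then obtain n where n: "norm (v (?k n) - w0) < e" "norm (s (?k n)) < e"
        using eventually_happens'[OF sequentially_bot] by blast
      have "s (?k n) ^ p * v (?k n) + c (t (?k n)) = w (?k n)"
        using s(2)[of "?k n"] by (simp add: v_def)
      then have "\<Phi> F (s (?k n)) (v (?k n) - w0) = 0" if "F \<in> H" for F
        using tw(4)[OF that, of "?k n"] s(1)[of "?k n"] by (simp add: \<Phi>_def)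
      moreover have "G (s (?k n)) (v (?k n) - w0) = 0"
        using n0(2)[of "?k n"] by (simp add: G_def)
      ultimately show ?thesis
        using n s(2)[of "?k n"] by (intro exI[of _ "s (?k n)"] exI[of _ "v (?k n) - w0"]) auto
    qed
    have hH: "hol2 R' F" if "F \<in> insert G (\<Phi> ` H)" for F
      using that holG hol\<Phi> by auto
    have g0: "G 0 w = w ^ m * poly q' w" for w using m(2)[of w] p0 by (simp add: G_def Q_def)
    have "\<exists>\<sigma>>0. \<exists>a b. a holomorphic_on ball 0 \<sigma> \<and> b holomorphic_on ball 0 \<sigma> \<and> a 0 = 0 \<and> b 0 = 0 \<and>
      (\<forall>s\<in>ball 0 \<sigma>. (s \<noteq> 0 \<longrightarrow> a s \<noteq> 0) \<and> norm (a s) < R' \<and> norm (b s) < R' \<and>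
         (\<forall>F\<in>insert G (\<Phi> ` H). F (a s) (b s) = 0))"
      by (rule less.IH[OF m(1) R'(1), where H = "insert G (\<Phi> ` H)" and ?F1.0 = G and g = "poly q'" and r = 1];
          (rule hH zeros g0 | intro holomorphic_intros | use m(3) in simp); assumption?)
    then obtain \<tau> \<alpha> \<beta> where \<tau>: "0 < \<tau>" "\<alpha> holomorphic_on ball 0 \<tau>" "\<beta> holomorphic_on ball 0 \<tau>"
      "\<alpha> 0 = 0" "\<beta> 0 = 0" and \<alpha>: "\<And>s. s \<in> ball 0 \<tau> \<Longrightarrow> s \<noteq> 0 \<Longrightarrow> \<alpha> s \<noteq> 0"
      "\<And>s. s \<in> ball 0 \<tau> \<Longrightarrow> norm (\<alpha> s) < R'" "\<And>s. s \<in> ball 0 \<tau> \<Longrightarrow> norm (\<beta> s) < R'"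
      "\<And>s F. s \<in> ball 0 \<tau> \<Longrightarrow> F \<in> H \<Longrightarrow> \<Phi> F (\<alpha> s) (\<beta> s) = 0" by auto
    show ?thesis
    proof (rule exI[of _ \<tau>], rule conjI[OF \<tau>(1)], rule exI[of _ "\<lambda>s. \<alpha> s ^ q"],
        rule exI[of _ "\<lambda>s. \<alpha> s ^ p * (w0 + \<beta> s) + c (\<alpha> s ^ q)"], intro conjI ballI impI)
      show "(\<lambda>s. \<alpha> s ^ q) holomorphic_on ball 0 \<tau>"
        "(\<lambda>s. \<alpha> s ^ p * (w0 + \<beta> s) + c (\<alpha> s ^ q)) holomorphic_on ball 0 \<tau>"
        using \<tau> \<alpha>(2) by (auto intro!: holomorphic_intros cq)
    qed (use \<tau> \<alpha> qp c(2) small1(1) small2 in \<open>auto simp: zero_power \<Phi>_def\<close>)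
  qed
qed

section \<open>Holomorphic curves in an analytic set\<close>

lemma norm_vec_smult: "norm (c *s (v :: complex ^ 'n)) = norm c * norm v"
proof -
  have "norm (c *s v) = L2_set (\<lambda>i. norm c * norm (v $ i)) UNIV"
    by (simp add: norm_vec_def norm_mult)
  also have "\<dots> = norm c * norm v" by (simp add: norm_vec_def L2_set_right_distrib)
  finally show ?thesis .
qed

lemma continuous_on_vec_smult [continuous_intros]:
  fixes g :: "'a::topological_space \<Rightarrow> complex ^ 'n"
  assumes "continuous_on S f" "continuous_on S g"
  shows "continuous_on S (\<lambda>x. f x *s g x)"
  unfolding vector_scalar_mult_def
  by (intro continuous_on_vec_lambda continuous_on_mult assms continuous_on_component)

definition hol_curve :: "complex set \<Rightarrow> (complex \<Rightarrow> complex ^ 'n) \<Rightarrow> bool" where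
  "hol_curve T \<gamma> \<longleftrightarrow> (\<forall>i. (\<lambda>t. \<gamma> t $ i) holomorphic_on T)"

lemma hol_curve_add [intro]: "hol_curve T \<gamma> \<Longrightarrow> hol_curve T \<delta> \<Longrightarrow> hol_curve T (\<lambda>t. \<gamma> t + \<delta> t)"
  by (auto simp: hol_curve_def intro: holomorphic_intros)

lemma hol_curve_smult [intro]: "f holomorphic_on T \<Longrightarrow> hol_curve T \<delta> \<Longrightarrow> hol_curve T (\<lambda>t. f t *s \<delta> t)"
  by (auto simp: hol_curve_def intro: holomorphic_intros)

lemma hol_curve_const [intro]: "hol_curve T (\<lambda>t. v)"
  by (auto simp: hol_curve_def)

lemma hol_curve_subset: "hol_curve T \<gamma> \<Longrightarrow> S \<subseteq> T \<Longrightarrow> hol_curve S \<gamma>"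
  by (auto simp: hol_curve_def intro: holomorphic_on_subset)

lemma hol_curve_compose: "hol_curve T \<gamma> \<Longrightarrow> a holomorphic_on S \<Longrightarrow> a ` S \<subseteq> T \<Longrightarrow> hol_curve S (\<lambda>s. \<gamma> (a s))"
  unfolding hol_curve_def using holomorphic_on_compose_gen[unfolded o_def] by blast

lemma hol_curve_imp_continuous_on:
  assumes "hol_curve T \<gamma>" shows "continuous_on T \<gamma>"
proof -
  have "continuous_on T (\<lambda>t. \<chi> i. \<gamma> t $ i)"
    using assms unfolding hol_curve_def
    by (intro continuous_on_vec_lambda) (blast intro: holomorphic_on_imp_continuous_on)
  then show ?thesis by simp
qed

text \<open>Holomorphy of a function of several variables, tested on holomorphic curves. The
  coefficient lemmas for \<open>root_poly\<close> have one complex parameter, so this is the form in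
  which resultants can be shown to be holomorphic.\<close>

definition curve_hol :: "real \<Rightarrow> (complex ^ 'n \<Rightarrow> complex) \<Rightarrow> bool" where
  "curve_hol R h \<longleftrightarrow> continuous_on (ball 0 R) h \<and>
     (\<forall>T \<gamma>. open T \<longrightarrow> hol_curve T \<gamma> \<longrightarrow> \<gamma> ` T \<subseteq> ball 0 R \<longrightarrow> (\<lambda>t. h (\<gamma> t)) holomorphic_on T)"

lemma curve_holD:
  assumes "curve_hol R h" "open T" "hol_curve T \<gamma>" "\<And>t. t \<in> T \<Longrightarrow> norm (\<gamma> t) < R"
  shows "(\<lambda>t. h (\<gamma> t)) holomorphic_on T"
proof -
  have "\<gamma> ` T \<subseteq> ball 0 R" using assms(4) by auto
  then show ?thesis using assms(1-3) by (auto simp: curve_hol_def)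
qed

text \<open>Combinations of \<open>H\<close> are formed because a single resultant detects common
  zeros of only two functions.\<close>

inductive_set lin_span :: "('a \<Rightarrow> complex) set \<Rightarrow> ('a \<Rightarrow> complex) set" for H where
  base: "h \<in> H \<Longrightarrow> h \<in> lin_span H"
| comb: "k \<in> lin_span H \<Longrightarrow> l \<in> lin_span H \<Longrightarrow> (\<lambda>z. k z + c * l z) \<in> lin_span H"

lemma curve_hol_lin_span:
  assumes "k \<in> lin_span H" "\<And>h. h \<in> H \<Longrightarrow> curve_hol R h" shows "curve_hol R k"
  using assms
  by induction (auto simp: curve_hol_def intro!: continuous_intros holomorphic_intros)

lemma lin_span_zero: "k \<in> lin_span H \<Longrightarrow> (\<And>h. h \<in> H \<Longrightarrow> h z = 0) \<Longrightarrow> k z = 0"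
  by (induction rule: lin_span.induct) auto

text \<open>To repair a zero of \<open>k\<close> at \<open>p\<close>, a multiple
  \<open>c * h\<close> is added; each of the finitely many other points excludes at most one value
  of \<open>c\<close>.\<close>

lemma lin_span_nonzero:
  assumes "finite A" "\<And>p. p \<in> A \<Longrightarrow> \<exists>h\<in>H. h p \<noteq> 0" "H \<noteq> {}"
  shows "\<exists>k\<in>lin_span H. \<forall>p\<in>A. k p \<noteq> 0"
  using assms
proof (induction A)
  case empty then show ?case by (auto intro: lin_span.base)
next
  case (insert p A)
  then obtain k h where k: "k \<in> lin_span H" "\<And>q. q \<in> A \<Longrightarrow> k q \<noteq> 0" and h: "h \<in> H" "h p \<noteq> 0" by fastforce
  show ?case
  proof (cases "k p = 0")
    case False then show ?thesis using k by auto
  next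
    case True
    have "finite (insert 0 ((\<lambda>q. - k q / h q) ` A))" using insert by simp
    then obtain c where c: "c \<notin> insert 0 ((\<lambda>q. - k q / h q) ` A)"
      using ex_new_if_finite[OF infinite_UNIV_char_0] by blast
    have "k q + c * h q \<noteq> 0" if "q \<in> A" for q
    proof
      assume *: "k q + c * h q = 0"
      then have "h q \<noteq> 0" using k(2)[OF that] by auto
      then have "c = - k q / h q" using * by (simp add: field_simps eq_neg_iff_add_eq_0 add.commute)
      then show False using c that by blast
    qed
    then show ?thesis
      using True c h k by (intro bexI[of _ "\<lambda>z. k z + c * h z"]) (auto intro: lin_span.intros)
  qed
qed

section \<open>Elimination of one variable by resultants\<close>

context
  fixes h1 :: "complex ^ 'n \<Rightarrow> complex" and v :: "complex ^ 'n" and R R1 \<kappa> \<kappa>2 :: real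
  assumes h1: "curve_hol R h1" and \<kappa>: "0 < \<kappa>" "\<kappa> < \<kappa>2" and R1: "0 < R1"
    and small: "\<And>x w. norm x < R1 \<Longrightarrow> norm w < \<kappa>2 \<Longrightarrow> norm (x + w *s v) \<le> R / 2" and R: "0 < R"
    and nz: "\<And>x w. norm x < R1 \<Longrightarrow> norm w = \<kappa> \<Longrightarrow> h1 (x + w *s v) \<noteq> 0"
begin

text \<open>Up to sign, the product of the values of \<open>k\<close> at the zeros of
  \<open>h1\<close> in a small disc of the line through \<open>x\<close> in direction
  \<open>v\<close>, counted with multiplicity.\<close>

definition resultant :: "(complex ^ 'n \<Rightarrow> complex) \<Rightarrow> complex ^ 'n \<Rightarrow> complex" where
  "resultant k x = coeff (root_poly \<kappa> (\<lambda>w. h1 (x + w *s v)) (\<lambda>w. k (x + w *s v))) 0"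

lemma slice_hol:
  assumes "curve_hol R k" "norm x < R1" shows "(\<lambda>w. k (x + w *s v)) holomorphic_on ball 0 \<kappa>2"
proof (rule curve_holD[OF assms(1)])
  show "norm (x + t *s v) < R" if "t \<in> ball 0 \<kappa>2" for t
    using small[OF assms(2), of t] that R by simp
qed (simp, intro hol_curve_add hol_curve_const hol_curve_smult holomorphic_on_ident)

lemma slice_cont:
  assumes "curve_hol R k" shows "continuous_on (ball 0 R1 \<times> ball 0 \<kappa>2) (\<lambda>(x, w). k (x + w *s v))"
  unfolding split_def
proof (rule continuous_on_compose2[of "ball 0 R" k])
  show "continuous_on (ball 0 R) k" using assms by (simp add: curve_hol_def)
  show "(\<lambda>x. fst x + snd x *s v) ` (ball 0 R1 \<times> ball 0 \<kappa>2) \<subseteq> ball 0 R"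
    using small R by force
qed (intro continuous_intros)

lemma slice_bound:
  assumes "curve_hol R k"
  obtains C where "\<And>x w. norm x < R1 \<Longrightarrow> norm w < \<kappa>2 \<Longrightarrow> norm (k (x + w *s v)) < C"
proof -
  have "continuous_on (cball 0 (R / 2)) k"
    using assms R by (auto simp: curve_hol_def elim!: continuous_on_subset)
  then have "bounded (k ` cball 0 (R / 2))"
    by (intro compact_imp_bounded compact_continuous_image) auto
  then obtain C where "\<forall>z\<in>cball 0 (R / 2). norm (k z) \<le> C"
    by (auto simp: bounded_iff)
  then have C: "norm (k z) \<le> C" if "norm z \<le> R / 2" for z using that by simp
  show ?thesis
  proof (rule that[of "C + 1"])
    fix x :: "complex ^ 'n" and w :: complex assume "norm x < R1" "norm w < \<kappa>2"
    then show "norm (k (x + w *s v)) < C + 1" using C[OF small] by force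
  qed
qed

lemma curve_hol_resultant:
  assumes k: "curve_hol R k" shows "curve_hol R1 (resultant k)"
proof -
  obtain C where C: "\<And>x w. norm x < R1 \<Longrightarrow> norm w < \<kappa>2 \<Longrightarrow> norm (k (x + w *s v)) < C"
    by (rule slice_bound[OF k]) (rule that)
  show ?thesis
    unfolding curve_hol_def
  proof (intro conjI allI impI)
    show "continuous_on (ball 0 R1) (resultant k)"
      unfolding resultant_def[abs_def]
      by (rule continuous_on_coeff_root_poly[OF _ slice_cont[OF h1] _ \<kappa> _ slice_cont[OF k], where C = C])
         (use slice_hol h1 k nz C in auto)
    fix T and \<gamma> :: "complex \<Rightarrow> complex ^ 'n"
    assume T: "open T" and \<gamma>: "hol_curve T \<gamma>" and sub: "\<gamma> ` T \<subseteq> ball 0 R1"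
    show "(\<lambda>t. resultant k (\<gamma> t)) holomorphic_on T"
      unfolding holomorphic_on_open[OF T]
    proof
      fix t assume "t \<in> T"
      then obtain e where e: "0 < e" "ball t e \<subseteq> T" using T open_contains_ball by blast
      have \<gamma>': "hol_curve (ball t e) \<gamma>" by (rule hol_curve_subset[OF \<gamma> e(2)])
      have nb: "norm (\<gamma> s) < R1" if "s \<in> ball t e" for s using that sub e(2) by fastforce
      have cont: "continuous_on (ball t e \<times> ball 0 \<kappa>2) (\<lambda>(s, w). l (\<gamma> s + w *s v))" if "curve_hol R l" for l
        unfolding split_def
        by (rule continuous_on_uncurry[OF slice_cont[OF that], where a = "\<lambda>p. \<gamma> (fst p)" and b = snd])
           (use nb in \<open>auto intro!: continuous_intros continuous_on_compose2[OF hol_curve_imp_continuous_on[OF \<gamma>']]\<close>)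
      have hol: "(\<lambda>s. l (\<gamma> s + w *s v)) holomorphic_on ball t e" if "curve_hol R l" "w \<in> ball 0 \<kappa>2" for l w
      proof (rule curve_holD[OF that(1)])
        show "norm (\<gamma> s + w *s v) < R" if "s \<in> ball t e" for s
          using small[OF nb[OF that], of w] \<open>w \<in> ball 0 \<kappa>2\<close> R by simp
      qed (use \<gamma>' in auto)
      have "(\<lambda>s. resultant k (\<gamma> s)) holomorphic_on ball t e"
        unfolding resultant_def
        by (rule holomorphic_on_coeff_root_poly[OF _ cont[OF h1] _ \<kappa> _ cont[OF k], where C = C])
           (use slice_hol[OF h1] slice_hol[OF k] hol h1 k nz C nb in auto)
      then show "\<exists>f'. ((\<lambda>s. resultant k (\<gamma> s)) has_field_derivative f') (at t)"
        using e(1) by (auto simp: holomorphic_on_open)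
    qed
  qed
qed

lemma resultant_eq_0_iff:
  assumes "norm x < R1"
  shows "resultant k x = 0 \<longleftrightarrow> (\<exists>w\<in>ball 0 \<kappa>. h1 (x + w *s v) = 0 \<and> k (x + w *s v) = 0)"
  unfolding resultant_def poly_0_coeff_0[symmetric]
  using poly_root_poly_eq_0_iff[OF slice_hol[OF h1 assms] \<kappa> nz[OF assms], of "\<lambda>w. k (x + w *s v)" 0]
  by (auto simp: zeros_in_def)

text \<open>The resultants describe the projection of the common zero set along \<open>v\<close>. If
  no zero of \<open>h1\<close> on the line were common to all of \<open>H\<close>, some combination
  in \<open>lin_span H\<close> would be nonzero at all these finitely many zeros, and so would be
  its resultant.\<close>

lemma resultants_eq_0_iff:
  assumes x: "norm x < R1" and "h1 \<in> H"
  shows "(\<forall>k\<in>lin_span H. resultant k x = 0) \<longleftrightarrow> (\<exists>w\<in>ball 0 \<kappa>. \<forall>h\<in>H. h (x + w *s v) = 0)"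
proof
  assume "\<exists>w\<in>ball 0 \<kappa>. \<forall>h\<in>H. h (x + w *s v) = 0"
  then obtain w where "w \<in> ball 0 \<kappa>" "\<And>h. h \<in> H \<Longrightarrow> h (x + w *s v) = 0" by blast
  then show "\<forall>k\<in>lin_span H. resultant k x = 0"
    using resultant_eq_0_iff[OF x] lin_span_zero \<open>h1 \<in> H\<close> by metis
next
  assume *: "\<forall>k\<in>lin_span H. resultant k x = 0"
  show "\<exists>w\<in>ball 0 \<kappa>. \<forall>h\<in>H. h (x + w *s v) = 0"
  proof (rule ccontr)
    assume no: "\<not> ?thesis"
    let ?A = "(\<lambda>w. x + w *s v) ` zeros_in \<kappa> (\<lambda>w. h1 (x + w *s v))"
    have "finite ?A"
      using finite_zeros_in[OF slice_hol[OF h1 x] \<kappa> nz[OF x]] by simp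
    moreover have "\<exists>h\<in>H. h p \<noteq> 0" if "p \<in> ?A" for p
      using no that by (auto simp: zeros_in_def)
    ultimately obtain k where "k \<in> lin_span H" "\<And>p. p \<in> ?A \<Longrightarrow> k p \<noteq> 0"
      using lin_span_nonzero[of ?A H] \<open>h1 \<in> H\<close> by blast
    then show False using * resultant_eq_0_iff[OF x] by (fastforce simp: zeros_in_def)
  qed
qed

end

section \<open>Curve selection at an accumulation point of common zeros\<close>

lemma norm_vec_smult_axis: "norm (s *s axis j (1::complex) :: complex ^ 'n) = norm s"
proof -
  have "norm (axis j (1::complex) :: complex ^ 'n) = L2_set (\<lambda>i. if i = j then 1 else 0) UNIV"
    unfolding norm_vec_def by (rule L2_set_cong) (auto simp: axis_def)
  also have "\<dots> = sqrt (\<Sum>i\<in>UNIV. if i = j then 1 else 0)"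
    unfolding L2_set_def by (intro arg_cong[of _ _ sqrt] sum.cong) auto
  also have "\<dots> = 1" by simp
  finally show ?thesis by (simp add: norm_vec_smult)
qed

text \<open>\<open>S\<close> holds the coordinates that are still free, and the induction runs on
  their number. Projecting along a direction \<open>v\<close> on which some equation is nontrivial
  removes one of them; the curve found in the projection is lifted back by
  \<open>puiseux_curve\<close>.\<close>

lemma curve_selection_at_0:
  fixes S :: "'n::finite set" and H :: "(complex ^ 'n \<Rightarrow> complex) set"
  assumes "0 < R" "\<And>h. h \<in> H \<Longrightarrow> curve_hol R h"
    and "\<And>e. 0 < e \<Longrightarrow> \<exists>z. z \<noteq> 0 \<and> norm z < e \<and> (\<forall>j. j \<notin> S \<longrightarrow> z $ j = 0) \<and> (\<forall>h\<in>H. h z = 0)"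
  shows "\<exists>\<sigma>>0. \<exists>\<gamma>. hol_curve (ball 0 \<sigma>) \<gamma> \<and> \<gamma> 0 = 0 \<and>
    (\<forall>s\<in>ball 0 \<sigma>. (s \<noteq> 0 \<longrightarrow> \<gamma> s \<noteq> 0) \<and> norm (\<gamma> s) < R \<and> (\<forall>j. j \<notin> S \<longrightarrow> \<gamma> s $ j = 0) \<and> (\<forall>h\<in>H. h (\<gamma> s) = 0))"
  using assms
proof (induction "card S" arbitrary: S H R rule: less_induct)
  case less
  note R = less.prems(1) and ch = less.prems(2) and zs = less.prems(3)
  show ?case
  proof (cases "\<forall>h\<in>H. \<forall>z. norm z < R \<longrightarrow> (\<forall>j. j \<notin> S \<longrightarrow> z $ j = 0) \<longrightarrow> h z = 0")
    \<comment> \<open>No nontrivial equation is left on the coordinate subspace, so an axis is a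
      suitable curve; a nonzero common zero guarantees that \<open>S\<close> is not empty.\<close>
    case True
    obtain z :: "complex ^ 'n" where z: "z \<noteq> 0" "\<And>j. j \<notin> S \<Longrightarrow> z $ j = 0" using zs[OF zero_less_one] by metis
    have "\<exists>j. z $ j \<noteq> 0" using z(1) by (simp add: vec_eq_iff)
    then obtain j where j: "j \<in> S" using z(2) by blast
    have "hol_curve (ball 0 R) (\<lambda>s. s *s axis j 1)"
      by (intro hol_curve_smult hol_curve_const holomorphic_on_ident)
    moreover have "(s *s axis j 1 :: complex ^ 'n) \<noteq> 0" if "s \<noteq> 0" for s
      using that by (metis norm_eq_zero norm_vec_smult_axis)
    moreover have "(s *s axis j 1 :: complex ^ 'n) $ i = 0" if "i \<notin> S" for s i
      using that j by (auto simp: axis_def)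
    moreover have "h (s *s axis j 1) = 0" if "h \<in> H" "norm s < R" for h s
      using True that calculation(3) by (auto simp: norm_vec_smult_axis)
    ultimately show ?thesis
      using R by (intro exI[of _ R] conjI exI[of _ "\<lambda>s. s *s axis j 1"]) (auto simp: norm_vec_smult_axis)
  next
    case False
    then obtain h1 v where h1: "h1 \<in> H" "h1 v \<noteq> 0" and v: "norm v < R" "\<And>j. j \<notin> S \<Longrightarrow> v $ j = 0" by blast
    have "h1 0 = 0"
    proof -
      have "\<exists>z. norm z < inverse (real (Suc n)) \<and> h1 z = 0" for n
        using zs[of "inverse (real (Suc n))"] h1(1) by (meson inverse_positive_iff_positive of_nat_0_less_iff zero_less_Suc)
      then obtain z where z: "\<And>n. norm (z n) < inverse (real (Suc n))" "\<And>n. h1 (z n) = 0" by metis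
      have "z \<longlonglongrightarrow> 0"
        by (rule Lim_null_comparison[OF _ LIMSEQ_inverse_real_of_nat])
           (use z in \<open>auto intro!: always_eventually less_imp_le\<close>)
      moreover have "continuous (at 0) h1"
        using ch[OF h1(1)] R unfolding curve_hol_def by (meson centre_in_ball continuous_on_eq_continuous_at open_ball)
      ultimately have "(\<lambda>n. h1 (z n)) \<longlonglongrightarrow> h1 0" by (rule isCont_tendsto_compose[rotated])
      then show "h1 0 = 0" using z(2) by (simp add: LIMSEQ_const_iff)
    qed
    have "v \<noteq> 0" using h1(2) \<open>h1 0 = 0\<close> by auto
    then have "\<exists>j. v $ j \<noteq> 0" by (simp add: vec_eq_iff)
    \<comment> \<open>Coordinate \<open>j\<close> is eliminated: a multiple of \<open>v\<close>
      moves any point into the hyperplane \<open>z $ j = 0\<close> without leaving the coordinates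
      in \<open>S\<close>.\<close>
    then obtain j where j: "v $ j \<noteq> 0" by blast
    then have "j \<in> S" using v(2) by auto
    define \<phi> where "\<phi> w = h1 (w *s v)" for w
    define A where "A = R / norm v"
    have A: "1 < A" using v(1) \<open>v \<noteq> 0\<close> by (simp add: A_def)
    have "\<phi> holomorphic_on ball 0 A"
      unfolding \<phi>_def[abs_def]
    proof (rule curve_holD[OF ch[OF h1(1)]])
      show "norm (t *s v) < R" if "t \<in> ball 0 A" for t
        using that \<open>v \<noteq> 0\<close> by (simp add: norm_vec_smult A_def field_simps)
    qed (simp, intro hol_curve_const hol_curve_smult holomorphic_on_ident)
    moreover have "\<exists>w\<in>ball 0 A. \<phi> w \<noteq> 0" using h1(2) A by (intro bexI[of _ 1]) (auto simp: \<phi>_def)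
    moreover have "\<phi> 0 = 0" using \<open>h1 0 = 0\<close> by (simp add: \<phi>_def)
    ultimately obtain r where r: "0 < r" "zor_poly \<phi> 0 holomorphic_on cball 0 r"
       "\<And>w. w \<in> cball 0 r \<Longrightarrow> \<phi> w = zor_poly \<phi> 0 w * (w - 0) ^ nat (zorder \<phi> 0) \<and> zor_poly \<phi> 0 w \<noteq> 0"
      using zorder_exist_zero[of \<phi> "ball 0 A" 0] A by auto
    define N g where "N = nat (zorder \<phi> 0)" and "g = zor_poly \<phi> 0"
    have g: "g holomorphic_on ball 0 r" "g 0 \<noteq> 0" "\<And>w. w \<in> ball 0 r \<Longrightarrow> h1 (w *s v) = w ^ N * g w"
      using r(1) r(3) holomorphic_on_subset[OF r(2) ball_subset_cball]
      by (auto simp: g_def N_def \<phi>_def mult.commute)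
    have h1nz: "h1 (w *s v) \<noteq> 0" if "w \<noteq> 0" "norm w \<le> r" for w
      using r(3)[of w] that by (auto simp: \<phi>_def)
    \<comment> \<open>Within radius \<open>r\<close> the only zero of \<open>h1\<close> on the line
      is the origin; the second bound keeps \<open>x + w *s v\<close> in the ball of radius
      \<open>R / 2\<close>.\<close>
    define \<kappa>2 where "\<kappa>2 = min r (R / (4 * norm v))"
    define \<kappa> where "\<kappa> = \<kappa>2 / 2"
    have \<kappa>: "0 < \<kappa>" "\<kappa> < \<kappa>2" "\<kappa>2 \<le> r" "\<kappa>2 * norm v \<le> R / 4"
    proof -
      have "0 < \<kappa>2" using r(1) R \<open>v \<noteq> 0\<close> by (simp add: \<kappa>2_def)
      then show "0 < \<kappa>" "\<kappa> < \<kappa>2" "\<kappa>2 \<le> r" by (auto simp: \<kappa>_def \<kappa>2_def)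
      have "\<kappa>2 * norm v \<le> R / (4 * norm v) * norm v" by (intro mult_right_mono) (auto simp: \<kappa>2_def)
      then show "\<kappa>2 * norm v \<le> R / 4" using \<open>v \<noteq> 0\<close> by simp
    qed
    have small0: "norm (x + w *s v) \<le> R / 2" if "norm x < R / 4" "norm w < \<kappa>2" for x w
    proof -
      have "norm (w *s v) \<le> \<kappa>2 * norm v"
        using that by (simp add: norm_vec_smult mult_right_mono)
      then show ?thesis using \<kappa>(4) that(1) norm_triangle_ineq[of x "w *s v"] by linarith
    qed
    have "continuous_on (ball 0 (R / 4) \<times> sphere 0 \<kappa>) (\<lambda>(x, w). h1 (x + w *s v))"
      unfolding split_def
    proof (rule continuous_on_compose2[of "ball 0 R" h1])
      show "continuous_on (ball 0 R) h1" using ch[OF h1(1)] by (simp add: curve_hol_def)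
      show "(\<lambda>x. fst x + snd x *s v) ` (ball 0 (R / 4) \<times> sphere 0 \<kappa>) \<subseteq> ball 0 R"
        using small0 \<kappa>(2) R by force
    qed (intro continuous_intros)
    then obtain \<rho> where \<rho>: "\<rho> > 0"
      "\<And>x w. x \<in> ball 0 (R / 4) \<Longrightarrow> dist x 0 < \<rho> \<Longrightarrow> w \<in> sphere 0 \<kappa> \<Longrightarrow> h1 (x + w *s v) \<noteq> 0"
      by (rule nonvanishing_nbhd[of _ _ "\<lambda>x w. h1 (x + w *s v)" 0]) (use R h1nz \<kappa> in auto)
    define R1 where "R1 = min \<rho> (R / 4)"
    have R1: "0 < R1" using \<rho>(1) R by (simp add: R1_def)
    have small: "norm (x + w *s v) \<le> R / 2" if "norm x < R1" "norm w < \<kappa>2" for x w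
      using small0 that by (simp add: R1_def)
    have nz: "h1 (x + w *s v) \<noteq> 0" if "norm x < R1" "norm w = \<kappa>" for x w
      using \<rho>(2)[of x w] that by (simp add: R1_def)
    let ?r = "resultant h1 v \<kappa>"
    have res_hol: "curve_hol R1 (?r k)" if "curve_hol R k" for k
      by (rule curve_hol_resultant[OF ch[OF h1(1)] \<kappa>(1,2) R1 small R nz that])
    have res_iff: "(\<forall>k\<in>lin_span H. ?r k x = 0) \<longleftrightarrow> (\<exists>w\<in>ball 0 \<kappa>. \<forall>h\<in>H. h (x + w *s v) = 0)"
      if "norm x < R1" for x
      by (rule resultants_eq_0_iff[OF ch[OF h1(1)] \<kappa>(1,2) R1 small R nz that h1(1)])
    have "card (S - {j}) < card S" by (rule card_Diff1_less[OF finite \<open>j \<in> S\<close>])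
    moreover have "curve_hol R1 h" if "h \<in> ?r ` lin_span H" for h
      using that res_hol curve_hol_lin_span[OF _ ch] by auto
    moreover have "\<exists>x. x \<noteq> 0 \<and> norm x < e \<and> (\<forall>i. i \<notin> S - {j} \<longrightarrow> x $ i = 0) \<and> (\<forall>h\<in>?r ` lin_span H. h x = 0)"
      if "0 < e" for e
    proof -
      \<comment> \<open>\<open>M\<close> bounds the projection, |x| <= M |z|. The two entries of
        \<open>e'\<close> ensure that |w| < \<kappa> and that \<open>x\<close> stays within
        \<open>e\<close> and \<open>R1\<close>.\<close>
      define M where "M = 1 + norm v / norm (v $ j)"
      have M: "1 \<le> M" by (simp add: M_def)
      define e' where "e' = min (\<kappa> * norm (v $ j)) (min e R1 / M)"
      have "0 < e'" using \<kappa>(1) j \<open>0 < e\<close> R1 M by (simp add: e'_def)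
      then obtain z where z: "z \<noteq> 0" "norm z < e'" "\<And>i. i \<notin> S \<Longrightarrow> z $ i = 0" "\<And>h. h \<in> H \<Longrightarrow> h z = 0"
        using zs by metis
      define w where "w = z $ j / v $ j"
      define x where "x = z - w *s v"
      have zj: "norm (z $ j) \<le> norm z" by (rule Finite_Cartesian_Product.norm_nth_le)
      have "norm (z $ j) < \<kappa> * norm (v $ j)" using z(2) zj by (simp add: e'_def)
      then have w\<kappa>: "norm w < \<kappa>" using j by (simp add: w_def norm_divide field_simps)
      have "norm x \<le> norm z + norm w * norm v"
        unfolding x_def norm_vec_smult[symmetric] by (rule norm_triangle_ineq4)
      also have "norm w * norm v \<le> norm z * (norm v / norm (v $ j))"
        using mult_right_mono[OF zj, of "norm v / norm (v $ j)"] by (simp add: w_def norm_divide)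
      finally have "norm x \<le> norm z * M" by (simp add: M_def distrib_left)
      also have "\<dots> < min e R1 / M * M" using z(2) M by (intro mult_strict_right_mono) (auto simp: e'_def)
      finally have x: "norm x < e" "norm x < R1" using M by auto
      \<comment> \<open>A nonzero common zero does not project to the origin, because
        \<open>h1\<close> has no small zero other than 0 on the line itself.\<close>
      have "x \<noteq> 0"
      proof
        assume "x = 0"
        then have "z = w *s v" by (simp add: x_def)
        moreover from this have "w \<noteq> 0" using z(1) by auto
        ultimately show False using h1nz[of w] w\<kappa> \<kappa> z(4)[OF h1(1)] by auto
      qed
      moreover have "x $ i = 0" if "i \<notin> S - {j}" for i
        using that z(3)[of i] v(2)[of i] j by (cases "i = j") (auto simp: x_def w_def)
      moreover have "\<forall>k\<in>lin_span H. ?r k x = 0"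
      proof -
        have "x + w *s v = z" by (simp add: x_def)
        then show ?thesis using res_iff[OF x(2)] w\<kappa> z(4) by (metis mem_ball_0)
      qed
      ultimately show ?thesis using x(1) by auto
    qed
    ultimately obtain \<sigma> \<gamma> where \<sigma>: "0 < \<sigma>" and \<gamma>: "hol_curve (ball 0 \<sigma>) \<gamma>" "\<gamma> 0 = 0"
      "\<And>s. s \<in> ball 0 \<sigma> \<Longrightarrow> s \<noteq> 0 \<Longrightarrow> \<gamma> s \<noteq> 0" "\<And>s. s \<in> ball 0 \<sigma> \<Longrightarrow> norm (\<gamma> s) < R1"
      "\<And>s i. s \<in> ball 0 \<sigma> \<Longrightarrow> i \<notin> S - {j} \<Longrightarrow> \<gamma> s $ i = 0"
      "\<And>s k. s \<in> ball 0 \<sigma> \<Longrightarrow> k \<in> lin_span H \<Longrightarrow> ?r k (\<gamma> s) = 0"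
      using less.hyps[of "S - {j}" R1 "?r ` lin_span H"] R1 by (auto simp: image_iff)
    define \<tau> where "\<tau> = min \<sigma> \<kappa>2"
    have \<tau>: "0 < \<tau>" "\<tau> \<le> \<sigma>" "\<tau> \<le> \<kappa>2" using \<sigma> \<kappa> by (auto simp: \<tau>_def)
    define \<Phi> where "\<Phi> h t w = h (\<gamma> t + w *s v)" for h :: "complex ^ 'n \<Rightarrow> complex" and t w
    have nb: "norm (\<gamma> t + w *s v) < R" if "t \<in> ball 0 \<sigma>" "norm w < \<kappa>2" for t w
      using small[OF \<gamma>(4)[OF that(1)] that(2)] R by linarith
    have cont\<Phi>: "continuous_on (ball 0 \<sigma> \<times> ball 0 \<kappa>2) (\<lambda>(t, w). \<Phi> h t w)" if "h \<in> H" for h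
      unfolding split_def \<Phi>_def
    proof (rule continuous_on_compose2[of "ball 0 R" h])
      show "continuous_on (ball 0 R) h" using ch[OF that] by (simp add: curve_hol_def)
      show "continuous_on (ball 0 \<sigma> \<times> ball 0 \<kappa>2) (\<lambda>x. \<gamma> (fst x) + snd x *s v)"
        by (intro continuous_intros continuous_on_compose2[OF hol_curve_imp_continuous_on[OF \<gamma>(1)]]) auto
      show "(\<lambda>x. \<gamma> (fst x) + snd x *s v) ` (ball 0 \<sigma> \<times> ball 0 \<kappa>2) \<subseteq> ball 0 R"
        using nb by auto
    qed
    have comp: "hol_curve T (\<lambda>s. \<gamma> (a s) + b s *s v)"
      if "a holomorphic_on T" "b holomorphic_on T" "a ` T \<subseteq> ball 0 \<sigma>" for T a b
      using that by (intro hol_curve_add hol_curve_compose[OF \<gamma>(1)] hol_curve_smult hol_curve_const)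
    have hol\<Phi>: "hol2 \<tau> (\<Phi> h)" if "h \<in> H" for h
      unfolding hol2_def
    proof (intro conjI allI impI)
      show "continuous_on (ball 0 \<tau> \<times> ball 0 \<tau>) (\<lambda>(t, w). \<Phi> h t w)"
        by (rule continuous_on_subset[OF cont\<Phi>[OF that]]) (use \<tau> in auto)
      fix T a b assume ab: "open T" "a holomorphic_on T" "b holomorphic_on T"
        and "a ` T \<subseteq> ball 0 \<tau>" "b ` T \<subseteq> ball 0 \<tau>"
      then have ab': "a ` T \<subseteq> ball 0 \<sigma>" "b ` T \<subseteq> ball 0 \<kappa>2" using \<tau> by auto
      show "(\<lambda>s. \<Phi> h (a s) (b s)) holomorphic_on T"
        unfolding \<Phi>_def
      proof (intro curve_holD[OF ch[OF that] ab(1)] comp ab ab')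
        show "norm (\<gamma> (a s) + b s *s v) < R" if "s \<in> T" for s
          using that ab' by (intro nb) auto
      qed
    qed
    \<comment> \<open>Vanishing resultants give a common zero over \<open>\<gamma> t\<close>. It is
      close to 0 because, for small \<open>t\<close>, \<open>h1\<close> has no zero in the compact
      annulus \<open>?K\<close>.\<close>
    have "\<exists>t w. t \<noteq> 0 \<and> norm t < e \<and> norm w < e \<and> (\<forall>F\<in>\<Phi> ` H. F t w = 0)" if "0 < e" for e
    proof -
      let ?K = "cball 0 \<kappa> - ball (0::complex) e"
      have "compact ?K" by (intro compact_diff) auto
      moreover have "continuous_on (ball 0 \<sigma> \<times> ?K) (\<lambda>(t, w). \<Phi> h1 t w)"
        by (rule continuous_on_subset[OF cont\<Phi>[OF h1(1)]]) (use \<kappa> in auto)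
      moreover have "\<Phi> h1 0 w \<noteq> 0" if "w \<in> ?K" for w
      proof -
        have "w \<noteq> 0" "norm w \<le> r" using that \<kappa> \<open>0 < e\<close> by auto
        then show ?thesis using h1nz[of w] \<gamma>(2) by (simp add: \<Phi>_def)
      qed
      ultimately obtain d where d: "0 < d" "\<And>t w. t \<in> ball 0 \<sigma> \<Longrightarrow> dist t 0 < d \<Longrightarrow> w \<in> ?K \<Longrightarrow> \<Phi> h1 t w \<noteq> 0"
        using nonvanishing_nbhd[of "ball 0 \<sigma>" ?K "\<Phi> h1" 0] \<sigma> by (metis centre_in_ball)
      define t :: complex where "t = of_real (min d (min \<sigma> e) / 2)"
      have t: "t \<noteq> 0" "norm t < d" "norm t < \<sigma>" "norm t < e"
        using d(1) \<sigma> \<open>0 < e\<close> by (auto simp: t_def simp del: of_real_divide)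
      then obtain w where w: "w \<in> ball 0 \<kappa>" "\<And>h. h \<in> H \<Longrightarrow> \<Phi> h t w = 0"
        using res_iff[OF \<gamma>(4), of t] \<gamma>(6)[of t] by (auto simp: \<Phi>_def)
      have "norm w < e"
        using d(2)[of t w] w t h1(1) by (force simp: dist_norm)
      then show ?thesis using t w by blast
    qed
    moreover have "\<Phi> h1 0 w = w ^ N * g w" if "w \<in> ball 0 r" for w
      using g(3)[OF that] \<gamma>(2) by (simp add: \<Phi>_def)
    ultimately have "\<exists>\<theta>>0. \<exists>a b. a holomorphic_on ball 0 \<theta> \<and> b holomorphic_on ball 0 \<theta> \<and> a 0 = 0 \<and> b 0 = 0 \<and>
        (\<forall>s\<in>ball 0 \<theta>. (s \<noteq> 0 \<longrightarrow> a s \<noteq> 0) \<and> norm (a s) < \<tau> \<and> norm (b s) < \<tau> \<and> (\<forall>F\<in>\<Phi> ` H. F (a s) (b s) = 0))"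
      using hol\<Phi> h1(1) by (intro puiseux_curve[OF \<tau>(1) _ _ g(1) r(1) g(2), where ?F1.0 = "\<Phi> h1"]) auto
    then obtain \<theta> a b where \<theta>: "0 < \<theta>" and ab: "a holomorphic_on ball 0 \<theta>" "b holomorphic_on ball 0 \<theta>"
      "a 0 = 0" "b 0 = 0" "\<forall>s\<in>ball 0 \<theta>. s \<noteq> 0 \<longrightarrow> a s \<noteq> 0"
      "\<forall>s\<in>ball 0 \<theta>. norm (a s) < \<tau>" "\<forall>s\<in>ball 0 \<theta>. norm (b s) < \<tau>"
      "\<forall>s\<in>ball 0 \<theta>. \<forall>h\<in>H. \<Phi> h (a s) (b s) = 0" by auto
    have a\<sigma>: "a s \<in> ball 0 \<sigma>" "norm (b s) < \<kappa>2" if "s \<in> ball 0 \<theta>" for s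
      using bspec[OF ab(6) that] bspec[OF ab(7) that] \<tau> by auto
    \<comment> \<open>The curve \<gamma> has no \<open>j\<close>-th coordinate, so the
      \<open>j\<close>-th coordinate of the lift is \<open>b s * v $ j\<close>; if the lift is 0,
      then \<open>b s\<close> and next \<open>\<gamma> (a s)\<close> vanish.\<close>
    have "\<gamma> (a s) + b s *s v \<noteq> 0" if "s \<in> ball 0 \<theta>" "s \<noteq> 0" for s
    proof
      assume 0: "\<gamma> (a s) + b s *s v = 0"
      then have "\<gamma> (a s) $ j + b s * v $ j = 0" by (metis vector_add_component vector_smult_component zero_index)
      then have "b s = 0" using \<gamma>(5)[OF a\<sigma>(1)[OF that(1)], of j] j by simp
      then show False using 0 \<gamma>(3)[OF a\<sigma>(1)[OF that(1)]] ab(5) that by simp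
    qed
    moreover have "(\<gamma> (a s) + b s *s v) $ i = 0" if "s \<in> ball 0 \<theta>" "i \<notin> S" for s i
      using \<gamma>(5)[OF a\<sigma>(1)[OF that(1)], of i] that v(2)[of i] by simp
    moreover have "hol_curve (ball 0 \<theta>) (\<lambda>s. \<gamma> (a s) + b s *s v)"
      using a\<sigma>(1) by (intro comp ab) auto
    moreover have "norm (\<gamma> (a s) + b s *s v) < R" if "s \<in> ball 0 \<theta>" for s
      using nb a\<sigma>[OF that] by blast
    ultimately show ?thesis
      using ab(8) by - (rule exI[of _ \<theta>], rule conjI[OF \<theta>], rule exI[of _ "\<lambda>s. \<gamma> (a s) + b s *s v"],
          simp add: ab(3,4) \<gamma>(2) \<Phi>_def)
  qed
qed

section \<open>The maximum principle along varieties\<close>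

text \<open>A curve with leading term of degree \<open>m\<close> makes its tangent circle be
  traversed \<open>m\<close> times; this does not change the mean.\<close>

lemma integral_periodic_stretch:
  fixes h :: "real \<Rightarrow> real"
  assumes cont: "continuous_on UNIV h" and per: "\<And>\<theta>. h (\<theta> + 2 * pi) = h \<theta>" and "0 < m"
  shows "integral {0..2 * pi} (\<lambda>\<theta>. h (real m * \<theta>)) = integral {0..2 * pi} h"
proof -
  have int: "h integrable_on {a..b}" for a b
    by (rule integrable_continuous_real) (rule continuous_on_subset[OF cont], simp)
  have per': "h (\<theta> + 2 * pi * real k) = h \<theta>" for \<theta> k
  proof (induction k)
    case (Suc k)
    have "h (\<theta> + 2 * pi * real (Suc k)) = h ((\<theta> + 2 * pi * real k) + 2 * pi)" by (simp add: algebra_simps)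
    then show ?case using per Suc by simp
  qed simp
  have "(h has_integral (real k * integral {0..2 * pi} h)) {0..2 * pi * real k}" for k
  proof (induction k)
    case (Suc k)
    have "((h \<circ> (+) (2 * pi * real k)) has_integral integral {0..2 * pi} h) {0..2 * pi}"
      using integrable_integral[OF int[of 0 "2 * pi"]] per' by (simp add: o_def add.commute)
    then have "(h has_integral integral {0..2 * pi} h) {2 * pi * real k..2 * pi * real (Suc k)}"
      unfolding has_integral_shift_Icc_real by (simp add: algebra_simps)
    from has_integral_combine[OF _ _ Suc this] show ?case by (simp add: algebra_simps)
  next
    case 0
    show ?case using has_integral_refl(1)[of h "0::real"] by simp
  qed
  from this[of m] have "(h has_integral (real m * integral {0..2 * pi} h)) (cbox 0 (2 * pi * real m))" by simp
  from has_integral_affinity'[OF this, of "real m" 0] \<open>0 < m\<close>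
  have "((\<lambda>\<theta>. h (real m * \<theta>)) has_integral integral {0..2 * pi} h) {0..2 * pi}"
    by (simp add: field_simps)
  then show ?thesis by (rule integral_unique)
qed

lemma has_integral_Re_holomorphic_circle:
  assumes h: "h holomorphic_on ball 0 \<rho>" and s: "0 < s" "s < \<rho>"
  shows "((\<lambda>\<theta>. Re (h (of_real s * cis \<theta>))) has_integral 2 * pi * Re (h 0)) {0..2 * pi}"
proof -
  have "h holomorphic_on cball 0 s" by (rule holomorphic_on_subset[OF h]) (use s in auto)
  then have "((\<lambda>u. h u / (u - 0)) has_contour_integral (2 * of_real pi * \<i> * h 0)) (circlepath 0 s)"
    by (rule Cauchy_integral_circlepath_simple) (use s in auto)
  then have "((\<lambda>\<theta>. h (of_real s * cis \<theta>) / (of_real s * cis \<theta>) * s * \<i> * cis \<theta>) has_integral (2 * of_real pi * \<i> * h 0)) {0..2 * pi}"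
    unfolding circlepath_def by (subst (asm) has_contour_integral_part_circlepath_iff) simp_all
  then have "((\<lambda>\<theta>. \<i> * h (of_real s * cis \<theta>)) has_integral (\<i> * (2 * of_real pi * h 0))) {0..2 * pi}"
    using s by (simp add: mult_ac)
  then have "((\<lambda>\<theta>. - \<i> * (\<i> * h (of_real s * cis \<theta>))) has_integral (- \<i> * (\<i> * (2 * of_real pi * h 0)))) {0..2 * pi}"
    by (rule has_integral_mult_right)
  then have "((\<lambda>\<theta>. h (of_real s * cis \<theta>)) has_integral (2 * of_real pi * h 0)) {0..2 * pi}"
    by (simp flip: mult.assoc)
  from has_integral_Re[OF this] show ?thesis by simp
qed

text \<open>\<open>m\<close> is the least vanishing order among the components that do not vanish
  identically, so at least one component of \<open>g 0\<close> survives.\<close>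

lemma hol_curve_factor:
  fixes \<gamma> :: "complex \<Rightarrow> complex ^ 'n::finite"
  assumes hol: "hol_curve (ball 0 \<sigma>) \<gamma>" and "0 < \<sigma>" and \<gamma>0: "\<gamma> 0 = 0"
    and ne: "s0 \<in> ball 0 \<sigma>" "\<gamma> s0 \<noteq> 0"
  obtains m \<rho> g where "0 < m" "0 < \<rho>" "\<rho> \<le> \<sigma>" "hol_curve (ball 0 \<rho>) g" "g 0 \<noteq> 0"
    "\<And>t. t \<in> ball 0 \<rho> \<Longrightarrow> \<gamma> t = t ^ m *s g t"
proof -
  define J where "J = {j. \<exists>t\<in>ball 0 \<sigma>. \<gamma> t $ j \<noteq> 0}"
  have "\<exists>j. \<gamma> s0 $ j \<noteq> 0" using ne(2) by (simp add: vec_eq_iff)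
  then have J: "J \<noteq> {}" using ne(1) unfolding J_def by blast
  have "\<exists>n r g. 0 < n \<and> 0 < r \<and> g holomorphic_on ball 0 r \<and> g 0 \<noteq> 0 \<and>
      (\<forall>t\<in>ball 0 r. \<gamma> t $ j = g t * t ^ n)" if "j \<in> J" for j
  proof -
    let ?a = "\<lambda>t. \<gamma> t $ j"
    have "?a holomorphic_on ball 0 \<sigma>" "\<exists>t\<in>ball 0 \<sigma>. ?a t \<noteq> 0" "?a 0 = 0"
      using that hol \<gamma>0 by (auto simp: J_def hol_curve_def)
    then obtain r where "zorder ?a 0 > 0" "r > 0" "zor_poly ?a 0 holomorphic_on cball 0 r"
       "\<forall>w\<in>cball 0 r. ?a w = zor_poly ?a 0 w * (w - 0) ^ nat (zorder ?a 0) \<and> zor_poly ?a 0 w \<noteq> 0"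
      using zorder_exist_zero[of ?a "ball 0 \<sigma>" 0] \<open>0 < \<sigma>\<close> by auto
    then show ?thesis
      by (intro exI[of _ "nat (zorder ?a 0)"] exI[of _ r] exI[of _ "zor_poly ?a 0"])
         (auto intro: holomorphic_on_subset)
  qed
  then obtain n r g where ng: "\<And>j. j \<in> J \<Longrightarrow> 0 < n j" "\<And>j. j \<in> J \<Longrightarrow> 0 < r j"
    "\<And>j. j \<in> J \<Longrightarrow> g j holomorphic_on ball 0 (r j)" "\<And>j. j \<in> J \<Longrightarrow> g j 0 \<noteq> (0::complex)"
    "\<And>j t. j \<in> J \<Longrightarrow> t \<in> ball 0 (r j) \<Longrightarrow> \<gamma> t $ j = g j t * t ^ n j" by metis
  define m where "m = Min (n ` J)"
  have m_le: "m \<le> n j" if "j \<in> J" for j using that by (simp add: m_def)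
  have "m \<in> n ` J" unfolding m_def using J by (intro Min_in) auto
  then obtain j0 where j0: "j0 \<in> J" "m = n j0" by auto
  define \<rho> where "\<rho> = Min (insert \<sigma> (r ` J))"
  have \<rho>: "0 < \<rho>" "\<rho> \<le> \<sigma>" "\<And>j. j \<in> J \<Longrightarrow> \<rho> \<le> r j"
    using J ng(2) \<open>0 < \<sigma>\<close> unfolding \<rho>_def by (auto intro!: Min_le simp del: Min_insert)
  define G where "G t = (\<chi> j. if j \<in> J then t ^ (n j - m) * g j t else 0)" for t
  show ?thesis
  proof (rule that[of m \<rho> G])
    have "(\<lambda>t. G t $ j) holomorphic_on ball 0 \<rho>" for j
    proof (cases "j \<in> J")
      case True
      have "g j holomorphic_on ball 0 \<rho>"
        by (rule holomorphic_on_subset[OF ng(3)[OF True]]) (use \<rho>(3)[OF True] in auto)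
      then show ?thesis using True by (auto simp: G_def intro!: holomorphic_intros)
    qed (simp add: G_def)
    then show "hol_curve (ball 0 \<rho>) G" by (simp add: hol_curve_def)
    have "G 0 $ j0 \<noteq> 0" using ng(4)[OF j0(1)] j0 by (simp add: G_def)
    then show "G 0 \<noteq> 0" by auto
    fix t :: complex assume t: "t \<in> ball 0 \<rho>"
    have "\<gamma> t $ j = (t ^ m *s G t) $ j" for j
    proof (cases "j \<in> J")
      case True
      have "t \<in> ball 0 (r j)" using t \<rho>(3)[OF True] by auto
      then have "\<gamma> t $ j = g j t * t ^ n j" by (rule ng(5)[OF True])
      also have "t ^ n j = t ^ m * t ^ (n j - m)" using m_le[OF True] by (simp flip: power_add)
      finally show ?thesis using True by (simp add: G_def mult_ac)
    next
      case False
      then show ?thesis using t \<rho>(2) by (auto simp: G_def J_def)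
    qed
    then show "\<gamma> t = t ^ m *s G t" by (simp add: vec_eq_iff)
  qed (use ng(1) j0 \<rho> in auto)
qed

section \<open>The maximum principle for locally submean functions\<close>

text \<open>The admissible radii may depend on the point and on the direction. This weak form is
  stable under gluing with a constant and is all that the maximum principle uses.\<close>

definition locally_submean :: "(complex ^ 'n::finite) set \<Rightarrow> (complex ^ 'n \<Rightarrow> real) \<Rightarrow> bool" where
  "locally_submean G v \<longleftrightarrow> open G \<and> continuous_on G v \<and> (\<forall>z\<in>G. \<forall>w. \<exists>\<rho>>0. \<forall>s. 0 < s \<longrightarrow> s < \<rho> \<longrightarrow>
     v z \<le> 1 / (2 * pi) * integral {0..2 * pi} (\<lambda>\<theta>. v (z + (of_real s * cis \<theta>) *s w)))"

lemma inner_eq_Re_sum: "x \<bullet> (y :: complex ^ 'n) = Re (\<Sum>i\<in>UNIV. cnj (x $ i) * y $ i)"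
  by (simp add: inner_vec_def inner_complex_def)

lemma norm_add_squared: "norm (x + y) ^ 2 = norm x ^ 2 + 2 * (x \<bullet> y) + norm y ^ 2" for x y :: "'a::real_inner"
  by (simp add: power2_norm_eq_inner inner_add inner_commute)

text \<open>The curve and its tangent disc are compared by doubling the variables: the maximum of
  \<open>v x - L |x - y|\<^sup>2 + \<eta> |y - p|\<^sup>2\<close> over \<open>y\<close> in the set and \<open>x\<close> nearby is incompatible with moving \<open>y\<close>
  along the curve and \<open>x\<close> along its leading term, since all first order terms have mean zero.\<close>

lemma maximum_principle_curves:
  fixes A :: "(complex ^ 'n::finite) set"
  assumes v: "locally_submean G v" and K: "compact (A \<inter> cball p \<delta>)" "A \<inter> cball p \<delta> \<subseteq> G"
    and curves: "\<And>y. y \<in> A \<Longrightarrow> dist p y < \<delta> \<Longrightarrow> \<exists>\<sigma>>0. \<exists>\<gamma>. hol_curve (ball 0 \<sigma>) \<gamma> \<and> \<gamma> 0 = y \<and>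
        (\<forall>s\<in>ball 0 \<sigma>. (s \<noteq> 0 \<longrightarrow> \<gamma> s \<noteq> y) \<and> \<gamma> s \<in> A)"
    and bound: "\<And>y. y \<in> A \<Longrightarrow> dist p y = \<delta> \<Longrightarrow> v y \<le> M"
    and y0: "y0 \<in> A" "dist p y0 \<le> \<delta>"
  shows "v y0 \<le> M"
proof (rule ccontr)
  assume "\<not> v y0 \<le> M"
  define D where "D = v y0 - M"
  have D: "0 < D" using \<open>\<not> v y0 \<le> M\<close> by (simp add: D_def)
  define K0 where "K0 = A \<inter> cball p \<delta>"
  have G: "open G" "continuous_on G v" using v by (auto simp: locally_submean_def)
  have K0: "compact K0" "K0 \<subseteq> G" "K0 \<noteq> {}" "y0 \<in> K0" using K y0 by (auto simp: K0_def)
  \<comment> \<open>The quadratic perturbation makes the comparison strict, yet on the ball it is at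
    most a quarter of the assumed excess \<open>D\<close>.\<close>
  define \<eta> where "\<eta> = D / (4 * (\<delta>\<^sup>2 + 1))"
  have d1: "0 < \<delta>\<^sup>2 + 1" by (simp add: add_nonneg_pos)
  have \<eta>: "0 < \<eta>" "\<eta> * \<delta>\<^sup>2 \<le> D / 4"
  proof -
    show "0 < \<eta>" unfolding \<eta>_def using D d1 by (intro divide_pos_pos mult_pos_pos) auto
    then have "\<eta> * \<delta>\<^sup>2 \<le> \<eta> * (\<delta>\<^sup>2 + 1)" by (intro mult_left_mono) auto
    also have "\<dots> = D / 4"
    proof -
      have "x \<noteq> 0 \<Longrightarrow> D / (4 * x) * x = D / 4" for x by simp
      then show ?thesis using d1 by (simp only: \<eta>_def)
    qed
    finally show "\<eta> * \<delta>\<^sup>2 \<le> D / 4" .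
  qed
  obtain e where e: "0 < e" "{x. infdist x K0 \<le> e} \<subseteq> G"
    using compact_in_open_separated[OF K0(3,1) G(1) K0(2)] by blast
  define K' where "K' = {x. infdist x K0 \<le> e}"
  have K': "compact K'" "K' \<subseteq> G" "K0 \<subseteq> K'"
    using compact_infdist_le[OF K0(3,1) e(1)] e by (auto simp: K'_def)
  have contK': "continuous_on K' v" by (rule continuous_on_subset[OF G(2) K'(2)])
  then have "uniformly_continuous_on K' v" by (rule compact_uniformly_continuous[OF _ K'(1)])
  moreover have "0 < D / 4" using D by simp
  ultimately obtain d' where d': "0 < d'" "\<And>x y. x \<in> K' \<Longrightarrow> y \<in> K' \<Longrightarrow> dist y x < d' \<Longrightarrow> dist (v y) (v x) < D / 4"
    unfolding uniformly_continuous_on_def by metis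
  define d where "d = min d' e"
  have d: "0 < d" "d \<le> d'" "d \<le> e" using d' e by (auto simp: d_def)
  have "bounded (v ` K')" by (intro compact_imp_bounded compact_continuous_image contK' K'(1))
  then obtain B where B: "\<And>x. x \<in> K' \<Longrightarrow> \<bar>v x\<bar> \<le> B" by (auto simp: bounded_iff)
  have "0 \<le> B" using B[of y0] K' K0 by force
  \<comment> \<open>Large enough that at distance \<open>d\<close> the penalty exceeds the
    oscillation of \<open>v\<close> together with the perturbation; so the maximising
    \<open>x1\<close> and \<open>y1\<close> are closer than \<open>d\<close>.\<close>
  define L where "L = (2 * B + \<eta> * \<delta>\<^sup>2 + 1) / d\<^sup>2"
  have L: "0 < L" "2 * B + \<eta> * \<delta>\<^sup>2 < L * d\<^sup>2"
    using d \<open>0 \<le> B\<close> \<eta>(1) by (auto simp: L_def intro!: divide_pos_pos add_nonneg_pos mult_nonneg_nonneg)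
  define W where "W x y = v x - L * (norm (x - y))\<^sup>2 + \<eta> * (norm (y - p))\<^sup>2" for x y
  have contW: "continuous_on (K' \<times> K0) (\<lambda>(x, y). W x y)"
    unfolding W_def split_def
    by (intro continuous_intros continuous_on_compose2[OF contK' continuous_on_fst]) auto
  obtain z where z: "z \<in> K' \<times> K0" "\<And>z'. z' \<in> K' \<times> K0 \<Longrightarrow> (\<lambda>(x, y). W x y) z' \<le> (\<lambda>(x, y). W x y) z"
    using continuous_attains_sup[OF compact_Times[OF K'(1) K0(1)] _ contW] K' K0 by blast
  define x1 y1 where "x1 = fst z" and "y1 = snd z"
  have xy: "x1 \<in> K'" "y1 \<in> K0" and max: "\<And>x y. x \<in> K' \<Longrightarrow> y \<in> K0 \<Longrightarrow> W x y \<le> W x1 y1"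
    using z by (auto simp: x1_def y1_def split_def)
  have y1A: "y1 \<in> A" "dist p y1 \<le> \<delta>" using xy by (auto simp: K0_def)
  have "\<eta> * (norm (y1 - p))\<^sup>2 \<le> \<eta> * \<delta>\<^sup>2"
    using y1A(2) \<eta>(1) by (intro mult_left_mono power_mono) (auto simp: dist_norm norm_minus_commute)
  moreover have "v y0 \<le> W x1 y1"
  proof -
    have "v y0 \<le> W y0 y0" using \<eta>(1) by (simp add: W_def)
    also have "\<dots> \<le> W x1 y1" by (rule max) (use K0 K' in auto)
    finally show ?thesis .
  qed
  ultimately have vx1: "v y0 + L * (norm (x1 - y1))\<^sup>2 \<le> v x1 + \<eta> * \<delta>\<^sup>2" by (simp add: W_def)
  have "L * (norm (x1 - y1))\<^sup>2 < L * d\<^sup>2"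
    using vx1 L(2) B[of x1] B[of y0] xy K0 K' by force
  then have q: "norm (x1 - y1) < d"
    using L(1) d(1) by (simp add: power_less_imp_less_base)
  \<comment> \<open>Uniform continuity transfers the excess from \<open>x1\<close> to
    \<open>y1\<close>; as \<open>v y1\<close> exceeds \<open>M\<close>, the point \<open>y1\<close>
    is not on the sphere and the curve through it may be used.\<close>
  have "dist (v y1) (v x1) < D / 4"
    using subsetD[OF K'(3) xy(2)] xy(1) q d by (intro d'(2)) (auto simp: dist_norm norm_minus_commute)
  then have "v x1 - D / 4 < v y1" unfolding dist_real_def by linarith
  moreover have "0 \<le> L * (norm (x1 - y1))\<^sup>2" using L(1) by simp
  ultimately have "M < v y1" using vx1 \<eta>(2) D D_def by linarith
  then have "dist p y1 \<noteq> \<delta>" using bound[OF y1A(1)] by auto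
  then have y1\<delta>: "dist p y1 < \<delta>" using y1A(2) by simp
  obtain \<sigma> \<gamma> where \<sigma>: "0 < \<sigma>" and \<gamma>: "hol_curve (ball 0 \<sigma>) \<gamma>" "\<gamma> 0 = y1"
    "\<And>s. s \<in> ball 0 \<sigma> \<Longrightarrow> s \<noteq> 0 \<Longrightarrow> \<gamma> s \<noteq> y1" "\<And>s. s \<in> ball 0 \<sigma> \<Longrightarrow> \<gamma> s \<in> A"
    using curves[OF y1A(1) y1\<delta>] by blast
  have h\<gamma>: "hol_curve (ball 0 \<sigma>) (\<lambda>t. \<gamma> t + (- y1))" by (intro hol_curve_add \<gamma>(1) hol_curve_const)
  have s0: "of_real (\<sigma> / 2) \<in> ball (0::complex) \<sigma>" "complex_of_real (\<sigma> / 2) \<noteq> 0" using \<sigma> by auto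
  have "\<gamma> 0 + - y1 = 0" "\<gamma> (of_real (\<sigma> / 2)) + - y1 \<noteq> 0" using \<gamma>(2) \<gamma>(3)[OF s0] by auto
  from hol_curve_factor[OF h\<gamma> \<sigma> this(1) s0(1) this(2)]
  obtain m \<rho> g where m: "0 < m" and \<rho>: "0 < \<rho>" "\<rho> \<le> \<sigma>" and g: "hol_curve (ball 0 \<rho>) g" "g 0 \<noteq> 0"
    "\<And>t. t \<in> ball 0 \<rho> \<Longrightarrow> \<gamma> t + - y1 = t ^ m *s g t" by metis
  define c where "c = g 0"
  have c: "0 < norm c" using g(2) by (simp add: c_def)
  have x1G: "x1 \<in> G" using xy K' by auto
  obtain \<rho>0 where \<rho>0: "0 < \<rho>0" "\<And>s. 0 < s \<Longrightarrow> s < \<rho>0 \<Longrightarrow>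
     v x1 \<le> 1 / (2 * pi) * integral {0..2 * pi} (\<lambda>\<theta>. v (x1 + (of_real s * cis \<theta>) *s c))"
    using v x1G unfolding locally_submean_def by blast
  define e2 where "e2 = e - norm (x1 - y1)"
  have e2: "0 < e2" using q d by (simp add: e2_def)
  have inK': "x1 + w \<in> K'" if "norm w \<le> e2" for w
  proof -
    have "infdist (x1 + w) K0 \<le> dist (x1 + w) y1" by (rule infdist_le[OF xy(2)])
    also have "\<dots> = norm ((x1 - y1) + w)" by (simp add: dist_norm algebra_simps)
    also have "\<dots> \<le> e" using norm_triangle_ineq[of "x1 - y1" w] that by (simp add: e2_def)
    finally show ?thesis by (simp add: K'_def)
  qed
  \<comment> \<open>|g - c| < \<epsilon> makes the gain \<eta> |g|^2 at least \<eta> |c|^2 / 4 and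
    the loss \<open>L\<close> |c - g|^2 at most half of that.\<close>
  define \<epsilon> where "\<epsilon> = min (norm c / 2) (norm c * sqrt (\<eta> / (8 * L)))"
  have \<epsilon>: "0 < \<epsilon>" "\<epsilon> \<le> norm c / 2" "L * \<epsilon>\<^sup>2 \<le> \<eta> * (norm c)\<^sup>2 / 8"
  proof -
    show "0 < \<epsilon>" "\<epsilon> \<le> norm c / 2" using c \<eta> L by (auto simp: \<epsilon>_def)
    then have "\<epsilon>\<^sup>2 \<le> (norm c * sqrt (\<eta> / (8 * L)))\<^sup>2" by (intro power_mono) (auto simp: \<epsilon>_def)
    also have "\<dots> = (norm c)\<^sup>2 * (\<eta> / (8 * L))" using \<eta> L by (simp add: power_mult_distrib)
    finally have "L * \<epsilon>\<^sup>2 \<le> L * ((norm c)\<^sup>2 * (\<eta> / (8 * L)))" using L by (intro mult_left_mono) auto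
    also have "\<dots> = \<eta> * (norm c)\<^sup>2 / 8" using L by simp
    finally show "L * \<epsilon>\<^sup>2 \<le> \<eta> * (norm c)\<^sup>2 / 8" .
  qed
  have "continuous (at 0) g"
    using hol_curve_imp_continuous_on[OF g(1)] \<rho>(1) by (meson centre_in_ball continuous_on_eq_continuous_at open_ball)
  then obtain r1 where r1: "0 < r1" "\<And>t. dist t 0 < r1 \<Longrightarrow> dist (g t) (g 0) < \<epsilon>"
    using \<epsilon>(1) unfolding continuous_at_eps_delta by blast
  \<comment> \<open>The constraints serve, in turn, the powers of \<open>s\<close>, the
    factorisation, |g - c| < \<epsilon>, the submean inequality at \<open>x1\<close>, and the
    requirements that \<open>x\<close> stay in \<open>K'\<close> and \<open>y\<close> in the ball.
    Halving makes them strict.\<close>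
  define s' where "s' = min (min 1 (min \<rho> r1)) (min (min \<rho>0 (e2 / norm c)) ((\<delta> - dist p y1) / (2 * norm c)))"
  define s where "s = s' / 2"
  have pos: "0 < e2 / norm c" "0 < (\<delta> - dist p y1) / (2 * norm c)" using e2 c y1\<delta> by auto
  have s: "0 < s" "s < 1" "s < \<rho>" "s < r1" "s < \<rho>0" "s < e2 / norm c" "s < (\<delta> - dist p y1) / (2 * norm c)"
  proof -
    have s': "0 < s'" using \<rho>(1) r1(1) \<rho>0(1) pos by (simp add: s'_def)
    have "s' \<le> 1" "s' \<le> \<rho>" "s' \<le> r1" "s' \<le> \<rho>0" "s' \<le> e2 / norm c" "s' \<le> (\<delta> - dist p y1) / (2 * norm c)"
      by (simp_all add: s'_def min_le_iff_disj)
    moreover have "0 < s" "s < s'" using s' by (auto simp: s_def)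
    ultimately show "0 < s" "s < 1" "s < \<rho>" "s < r1" "s < \<rho>0" "s < e2 / norm c" "s < (\<delta> - dist p y1) / (2 * norm c)"
      by linarith+
  qed
  have sm: "0 < s ^ m" "s ^ m \<le> s"
    using s m power_decreasing[of 1 m s] by auto
  define \<xi> where "\<xi> \<theta> = of_real s * cis \<theta>" for \<theta>
  have \<xi>: "norm (\<xi> \<theta>) = s" "\<xi> \<theta> \<in> ball 0 \<rho>" "\<xi> \<theta> \<in> ball 0 \<sigma>" for \<theta>
    using s \<rho> by (auto simp: \<xi>_def norm_mult)
  have gc: "norm (g (\<xi> \<theta>) - c) < \<epsilon>" for \<theta>
    using r1(2)[of "\<xi> \<theta>"] \<xi>(1)[of \<theta>] s by (simp add: dist_norm c_def)
  define b where "b = y1 - p"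
  \<comment> \<open>\<open>h\<close> collects the terms linear in the displacements: the real inner
    products are real parts of sums holomorphic in \<open>t\<close> and vanishing at 0.\<close>
  define h where "h t = of_real (- 2 * L) * (\<Sum>i\<in>UNIV. cnj ((x1 - y1) $ i) * (t ^ m * (c - g t) $ i)) +
     of_real (2 * \<eta>) * (\<Sum>i\<in>UNIV. cnj (b $ i) * (t ^ m * g t $ i))" for t
  have holh: "h holomorphic_on ball 0 \<rho>"
    unfolding h_def using g(1) by (auto simp: hol_curve_def intro!: holomorphic_intros)
  have h0: "h 0 = 0" using m by (simp add: h_def power_0_left)
  have key: "v (x1 + \<xi> \<theta> ^ m *s c) + Re (h (\<xi> \<theta>)) \<le> v x1 - s ^ (2 * m) * (\<eta> * (norm c)\<^sup>2 / 8)" for \<theta>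
  proof -
    let ?t = "\<xi> \<theta>"
    have nt: "norm (?t ^ m) = s ^ m" by (simp add: norm_power \<xi>)
    have gt: "norm c / 2 \<le> norm (g ?t)" "norm (g ?t) \<le> 2 * norm c"
      using gc[of \<theta>] \<epsilon>(2) norm_triangle_ineq2[of c "g ?t"] norm_triangle_ineq2[of "g ?t" c]
      by (auto simp: norm_minus_commute)
    have "s ^ m * norm c \<le> e2"
    proof -
      have "s ^ m * norm c \<le> s * norm c" using sm by (intro mult_right_mono) auto
      also have "\<dots> \<le> e2" using s(6) c by (simp add: field_simps)
      finally show ?thesis .
    qed
    then have xt: "x1 + ?t ^ m *s c \<in> K'"
      by (intro inK') (simp add: norm_vec_smult nt)
    have "\<gamma> ?t = y1 + ?t ^ m *s g ?t" using g(3)[OF \<xi>(2)[of \<theta>]] by (simp add: algebra_simps)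
    moreover have "dist p (y1 + ?t ^ m *s g ?t) \<le> \<delta>"
    proof -
      have "dist p (y1 + ?t ^ m *s g ?t) \<le> dist p y1 + norm (?t ^ m *s g ?t)"
        using dist_triangle[of p "y1 + ?t ^ m *s g ?t" y1] by (simp add: dist_norm)
      also have "norm (?t ^ m *s g ?t) \<le> s * (2 * norm c)"
        unfolding norm_vec_smult nt using sm gt s by (intro mult_mono) auto
      also have "\<dots> \<le> \<delta> - dist p y1" using s(7) c by (simp add: field_simps)
      finally show ?thesis by simp
    qed
    ultimately have yt: "y1 + ?t ^ m *s g ?t \<in> K0"
      using \<gamma>(4)[OF \<xi>(3)[of \<theta>]] by (simp add: K0_def)
    have 1: "(norm (x1 + ?t ^ m *s c - (y1 + ?t ^ m *s g ?t)))\<^sup>2 =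
        (norm (x1 - y1))\<^sup>2 + 2 * ((x1 - y1) \<bullet> (?t ^ m *s (c - g ?t))) + s ^ (2 * m) * (norm (c - g ?t))\<^sup>2"
    proof -
      have "x1 + ?t ^ m *s c - (y1 + ?t ^ m *s g ?t) = (x1 - y1) + ?t ^ m *s (c - g ?t)"
        by (simp add: vector_ssub_ldistrib)
      then show ?thesis
        by (simp only: norm_add_squared norm_vec_smult nt power_mult_distrib) (simp add: power_mult mult.commute)
    qed
    have 2: "(norm (y1 + ?t ^ m *s g ?t - p))\<^sup>2 =
        (norm (y1 - p))\<^sup>2 + 2 * (b \<bullet> (?t ^ m *s g ?t)) + s ^ (2 * m) * (norm (g ?t))\<^sup>2"
    proof -
      have "y1 + ?t ^ m *s g ?t - p = b + ?t ^ m *s g ?t" by (simp add: b_def)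
      then show ?thesis
        by (simp only: norm_add_squared norm_vec_smult nt power_mult_distrib b_def) (simp add: power_mult mult.commute)
    qed
    have 3: "Re (h ?t) = - 2 * L * ((x1 - y1) \<bullet> (?t ^ m *s (c - g ?t))) + 2 * \<eta> * (b \<bullet> (?t ^ m *s g ?t))"
    proof -
      have *: "Re (of_real a * S + of_real b * S') = a * Re S + b * Re S'" for a b S S'
        by simp
      show ?thesis unfolding inner_eq_Re_sum h_def vector_smult_component by (rule *)
    qed
    have 4: "\<eta> * (norm c)\<^sup>2 / 8 \<le> \<eta> * (norm (g ?t))\<^sup>2 - L * (norm (c - g ?t))\<^sup>2"
    proof -
      have "(norm c / 2)\<^sup>2 \<le> (norm (g ?t))\<^sup>2" using gt c by (intro power_mono) auto
      then have "\<eta> * (norm c / 2)\<^sup>2 \<le> \<eta> * (norm (g ?t))\<^sup>2" using \<eta> by (intro mult_left_mono) auto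
      moreover have "(norm (c - g ?t))\<^sup>2 \<le> \<epsilon>\<^sup>2"
        using gc[of \<theta>] by (intro power_mono) (auto simp: norm_minus_commute)
      then have "L * (norm (c - g ?t))\<^sup>2 \<le> L * \<epsilon>\<^sup>2" using L by (intro mult_left_mono) auto
      ultimately show ?thesis using \<epsilon>(3) by (simp add: power_divide)
    qed
    have "s ^ (2 * m) * (\<eta> * (norm c)\<^sup>2 / 8) \<le> s ^ (2 * m) * (\<eta> * (norm (g ?t))\<^sup>2 - L * (norm (c - g ?t))\<^sup>2)"
      using 4 s by (intro mult_left_mono) auto
    moreover have "W (x1 + ?t ^ m *s c) (y1 + ?t ^ m *s g ?t) \<le> W x1 y1" by (rule max[OF xt yt])
    ultimately show ?thesis
      unfolding W_def 1 2 3 by (simp add: algebra_simps)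
  qed
  \<comment> \<open>The mean inequality is known only for circles in complex lines. That is why
    \<open>x\<close> follows the leading term, with radius \<open>s ^ m\<close>, while
    \<open>y\<close> follows the curve.\<close>
  define u where "u \<theta> = v (x1 + (of_real (s ^ m) * cis \<theta>) *s c)" for \<theta>
  have contu: "continuous_on UNIV u"
    unfolding u_def
  proof (rule continuous_on_compose2[OF contK'])
    have "s ^ m * norm c \<le> s * norm c" using sm by (intro mult_right_mono) auto
    also have "\<dots> \<le> e2" using s(6) c by (simp add: field_simps)
    finally show "range (\<lambda>\<theta>. x1 + (of_real (s ^ m) * cis \<theta>) *s c) \<subseteq> K'"
      using s by (auto intro!: inK' simp: norm_vec_smult norm_mult norm_power)
  qed (intro continuous_intros continuous_on_cis)
  have "u (\<theta> + 2 * pi) = u \<theta>" for \<theta> by (simp add: u_def cis.ctr)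
  from integral_periodic_stretch[OF contu this m]
  have iu: "integral {0..2 * pi} (\<lambda>\<theta>. u (real m * \<theta>)) = integral {0..2 * pi} u" .
  have um: "u (real m * \<theta>) = v (x1 + \<xi> \<theta> ^ m *s c)" for \<theta>
  proof -
    have "\<xi> \<theta> ^ m = of_real (s ^ m) * cis (real m * \<theta>)"
      by (simp add: \<xi>_def power_mult_distrib Complex.DeMoivre)
    then show ?thesis by (simp add: u_def)
  qed
  have "s ^ m < \<rho>0" using sm s by simp
  from \<rho>0(2)[OF sm(1) this] have "v x1 \<le> 1 / (2 * pi) * integral {0..2 * pi} u"
    unfolding u_def .
  then have v_le: "2 * pi * v x1 \<le> integral {0..2 * pi} u" by (simp add: field_simps)
  have "continuous_on {0..2 * pi} (\<lambda>\<theta>. u (real m * \<theta>))"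
    by (rule continuous_on_compose2[OF contu]) (auto intro!: continuous_intros)
  then have "((\<lambda>\<theta>. u (real m * \<theta>)) has_integral integral {0..2 * pi} u) {0..2 * pi}"
    unfolding iu[symmetric] by (intro integrable_integral integrable_continuous_real)
  from has_integral_add[OF this has_integral_Re_holomorphic_circle[OF holh s(1,3)]]
  have "((\<lambda>\<theta>. u (real m * \<theta>) + Re (h (\<xi> \<theta>))) has_integral integral {0..2 * pi} u) {0..2 * pi}"
    by (simp add: h0 \<xi>_def)
  moreover have "((\<lambda>\<theta>. v x1 - s ^ (2 * m) * (\<eta> * (norm c)\<^sup>2 / 8)) has_integral
      2 * pi * (v x1 - s ^ (2 * m) * (\<eta> * (norm c)\<^sup>2 / 8))) {0..2 * pi}"
    using has_integral_const_real[of "v x1 - s ^ (2 * m) * (\<eta> * (norm c)\<^sup>2 / 8)" 0 "2 * pi"] by simp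
  ultimately have "integral {0..2 * pi} u \<le> 2 * pi * (v x1 - s ^ (2 * m) * (\<eta> * (norm c)\<^sup>2 / 8))"
    by (rule has_integral_le) (use key um in auto)
  with v_le have "2 * pi * v x1 \<le> 2 * pi * v x1 - 2 * pi * (s ^ (2 * m) * (\<eta> * (norm c)\<^sup>2 / 8))"
    unfolding right_diff_distrib by linarith
  moreover have "0 < 2 * pi * (s ^ (2 * m) * (\<eta> * (norm c)\<^sup>2 / 8))"
    using s \<eta> c by (intro mult_pos_pos) auto
  ultimately show False by linarith
qed

section \<open>Holomorphic curves through the points of a variety\<close>

lemma vec_eq_sum_axis: "(v :: 'a::comm_monoid_add ^ 'n::finite) = (\<Sum>i\<in>UNIV. axis i (v $ i))"
  by (simp add: vec_eq_iff axis_def)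

lemma bounded_linear_axis: "bounded_linear (axis i :: complex \<Rightarrow> complex ^ 'n::finite)"
proof -
  have "linear (axis i :: complex \<Rightarrow> complex ^ 'n)"
    by (rule linearI) (auto simp: vec_eq_iff axis_def)
  then show ?thesis by (simp add: linear_conv_bounded_linear)
qed

lemma hol_curve_has_derivative:
  fixes \<gamma> :: "complex \<Rightarrow> complex ^ 'n::finite"
  assumes "hol_curve T \<gamma>" "open T" "t \<in> T"
  obtains \<gamma>' where "(\<gamma> has_derivative (\<lambda>\<tau>. \<tau> *s \<gamma>')) (at t)"
proof -
  let ?d = "\<lambda>i. deriv (\<lambda>t. \<gamma> t $ i) t"
  have "((\<lambda>t. \<gamma> t $ i) has_derivative (\<lambda>\<tau>. ?d i * \<tau>)) (at t)" for i
    using assms by (auto simp: hol_curve_def has_field_derivative_def[symmetric] intro!: holomorphic_derivI)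
  then have "((\<lambda>t. \<Sum>i\<in>UNIV. axis i (\<gamma> t $ i)) has_derivative (\<lambda>\<tau>. \<Sum>i\<in>UNIV. axis i (?d i * \<tau>))) (at t)"
    by (intro has_derivative_sum bounded_linear.has_derivative[OF bounded_linear_axis]) blast
  moreover have "(\<Sum>i\<in>UNIV. axis i (?d i * \<tau>)) = \<tau> *s (\<chi> i. ?d i)" for \<tau>
    by (subst vec_eq_sum_axis[of "\<tau> *s (\<chi> i. ?d i)"]) (simp add: mult.commute)
  ultimately have "(\<gamma> has_derivative (\<lambda>\<tau>. \<tau> *s (\<chi> i. ?d i))) (at t)"
    by (simp flip: vec_eq_sum_axis)
  then show ?thesis by (rule that)
qed

text \<open>By the chain rule a complex linear derivative along a holomorphic curve gives a complex
  derivative in the curve parameter.\<close>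

lemma curve_hol_of_holomorphic_fun:
  fixes h :: "complex ^ 'n::finite \<Rightarrow> complex"
  assumes h: "holomorphic_fun_on W h" and W: "ball y R \<subseteq> W"
  shows "curve_hol R (\<lambda>z. h (y + z))"
  unfolding curve_hol_def
proof (intro conjI allI impI)
  have "continuous (at z) h" if "z \<in> W" for z
    using h that unfolding holomorphic_fun_on_def by (meson has_derivative_continuous)
  then have "continuous_on W h" by (rule continuous_at_imp_continuous_on[rule_format])
  then show "continuous_on (ball 0 R) (\<lambda>z. h (y + z))"
    by (rule continuous_on_compose2) (use W in \<open>auto intro!: continuous_intros simp: dist_norm\<close>)
  fix T and \<gamma> :: "complex \<Rightarrow> complex ^ 'n"
  assume T: "open T" and \<gamma>: "hol_curve T \<gamma>" and sub: "\<gamma> ` T \<subseteq> ball 0 R"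
  show "(\<lambda>t. h (y + \<gamma> t)) holomorphic_on T"
    unfolding holomorphic_on_open[OF T]
  proof
    fix t assume t: "t \<in> T"
    have "norm (\<gamma> t) < R" using sub t by auto
    then have "y + \<gamma> t \<in> W" using W by (auto simp: dist_norm)
    then obtain h' where h': "(h has_derivative h') (at (y + \<gamma> t))" "\<And>c v. h' (c *s v) = c * h' v"
      using h unfolding holomorphic_fun_on_def by blast
    obtain \<gamma>' where \<gamma>': "(\<gamma> has_derivative (\<lambda>\<tau>. \<tau> *s \<gamma>')) (at t)"
      by (rule hol_curve_has_derivative[OF \<gamma> T t]) (rule that)
    have "((\<lambda>t. y + \<gamma> t) has_derivative (\<lambda>\<tau>. \<tau> *s \<gamma>')) (at t)"
      using has_derivative_add[OF has_derivative_const \<gamma>'] by simp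
    from has_derivative_compose[OF this h'(1)]
    have "((\<lambda>t. h (y + \<gamma> t)) has_field_derivative h' \<gamma>') (at t)"
      by (simp add: has_field_derivative_def h'(2) mult.commute[of _ "h' \<gamma>'"])
    then show "\<exists>f'. ((\<lambda>t. h (y + \<gamma> t)) has_field_derivative f') (at t)" by blast
  qed
qed

lemma variety_curve:
  fixes Z :: "(complex ^ 'n::finite) set"
  assumes "analytic_variety Z" "y \<in> Z" "y islimpt Z"
  shows "\<exists>\<sigma>>0. \<exists>\<gamma>. hol_curve (ball 0 \<sigma>) \<gamma> \<and> \<gamma> 0 = y \<and> (\<forall>s\<in>ball 0 \<sigma>. (s \<noteq> 0 \<longrightarrow> \<gamma> s \<noteq> y) \<and> \<gamma> s \<in> Z)"
proof -
  obtain W H where "open W \<and> y \<in> W \<and> finite H \<and> (\<forall>h\<in>H. holomorphic_fun_on W h) \<and> Z \<inter> W = {z\<in>W. \<forall>h\<in>H. h z = 0}"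
    using bspec[OF assms(1)[unfolded analytic_variety_def] assms(2)] by (elim exE) (rule that)
  then have W: "open W" "y \<in> W" "\<And>h. h \<in> H \<Longrightarrow> holomorphic_fun_on W h" "Z \<inter> W = {z\<in>W. \<forall>h\<in>H. h z = 0}"
    by auto
  obtain R where R: "0 < R" "ball y R \<subseteq> W" using W(1,2) open_contains_ball by blast
  have mem: "y + z \<in> Z \<longleftrightarrow> (\<forall>h\<in>H. h (y + z) = 0)" if "norm z < R" for z
  proof -
    have "y + z \<in> W" using R(2) that by (auto simp: dist_norm)
    then show ?thesis using W(4) by blast
  qed
  let ?H = "(\<lambda>h z. h (y + z)) ` H"
  have ch: "curve_hol R k" if "k \<in> ?H" for k
    using that curve_hol_of_holomorphic_fun[OF W(3) R(2)] by auto
  have "\<exists>z. z \<noteq> 0 \<and> norm z < e \<and> (\<forall>j. j \<notin> UNIV \<longrightarrow> z $ j = 0) \<and> (\<forall>h\<in>?H. h z = 0)" if "0 < e" for e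
  proof -
    obtain x where x: "x \<in> Z" "x \<noteq> y" "dist x y < min e R"
      using assms(3) \<open>0 < e\<close> R(1) unfolding islimpt_approachable by (metis min_less_iff_conj)
    then show ?thesis
      using mem[of "x - y"] by (intro exI[of _ "x - y"]) (auto simp: dist_norm)
  qed
  from curve_selection_at_0[OF R(1) ch this]
  obtain \<sigma> \<gamma> where \<sigma>: "0 < \<sigma>" "hol_curve (ball 0 \<sigma>) \<gamma>" "\<gamma> 0 = 0" and
    \<gamma>: "\<forall>s\<in>ball 0 \<sigma>. (s \<noteq> 0 \<longrightarrow> \<gamma> s \<noteq> 0) \<and> norm (\<gamma> s) < R \<and> (\<forall>h\<in>?H. h (\<gamma> s) = 0)" by auto
  have "y + \<gamma> s \<in> Z" "s \<noteq> 0 \<longrightarrow> y + \<gamma> s \<noteq> y" if "s \<in> ball 0 \<sigma>" for s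
    using \<gamma> that mem[of "\<gamma> s"] by auto
  then show ?thesis
    using \<sigma> by (intro exI[of _ \<sigma>] conjI, simp, intro exI[of _ "\<lambda>s. y + \<gamma> s"] conjI ballI)
      (auto intro!: hol_curve_add hol_curve_const)
qed

text \<open>An isolated point is regular of dimension 0, and near it there are no regular points of
  another dimension; so the dimension there would be 0 instead of 1.\<close>

lemma one_dim_variety_islimpt:
  fixes Z :: "(complex ^ 'n::finite) set"
  assumes Z: "one_dim_variety Z" and p: "p \<in> Z"
  shows "p islimpt Z"
proof (rule ccontr)
  assume "\<not> p islimpt Z"
  then obtain e where e: "0 < e" "\<And>x. x \<in> Z \<Longrightarrow> dist x p < e \<Longrightarrow> x = p"
    unfolding islimpt_approachable by blast
  have "p \<in> regular_points Z 0"
  proof -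
    have hol: "holomorphic_map_on W (\<lambda>z. z + a)" for W and a :: "complex ^ 'n"
      unfolding holomorphic_map_on_def holomorphic_fun_on_def
    proof (intro allI ballI exI conjI)
      show "((\<lambda>z. (z + a) $ i) has_derivative (\<lambda>h. h $ i)) (at z)" for i and z :: "complex ^ 'n"
        by (auto intro!: derivative_eq_intros bounded_linear.has_derivative[OF bounded_linear_vec_nth])
    qed auto
    have img: "(\<lambda>z. z + - p) ` ball p e = ball 0 e"
      by (auto simp: dist_norm norm_minus_commute image_iff intro!: bexI[of _ "_ + p"])
    show ?thesis
      unfolding regular_points_def
    proof (intro CollectI conjI p exI)
      show "open (ball p e)" "p \<in> ball p e" using e by auto
      show "open ((\<lambda>z. z + - p) ` ball p e)" unfolding img by simp
      show "holomorphic_map_on (ball p e) (\<lambda>z. z + - p)"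
        "holomorphic_map_on ((\<lambda>z. z + - p) ` ball p e) (\<lambda>z. z + p)" by (rule hol)+
      show "\<forall>z\<in>ball p e. z + - p + p = z" by simp
      show "vec.subspace ({0} :: (complex ^ 'n) set)" by (simp add: vec.subspace_def)
      show "vec.dim ({0} :: (complex ^ 'n) set) = 0" by simp
      have "Z \<inter> ball p e = {p}" using e p by (auto simp: dist_commute)
      then show "(\<lambda>z. z + - p) ` (Z \<inter> ball p e) = (\<lambda>z. z + - p) ` ball p e \<inter> {0}"
        unfolding img using e by auto
    qed
  qed
  then have "0 \<in> {d. p \<in> closure (regular_points Z d)}" using closure_subset by fastforce
  \<comment> \<open>The set of dimensions is shown to be exactly {0}, so that \<open>Max\<close> can
    be evaluated.\<close>
  moreover have "d = 0" if dcl: "p \<in> closure (regular_points Z d)" for d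
  proof (rule ccontr)
    assume "d \<noteq> 0"
    obtain x where x: "x \<in> regular_points Z d" "dist x p < e"
      using dcl e(1) unfolding closure_approachable by blast
    then have "x = p" using e(2) by (auto simp: regular_points_def)
    with x(1) have "\<exists>W \<psi> \<eta> L. open W \<and> p \<in> W \<and> open (\<psi> ` W) \<and>
       holomorphic_map_on W \<psi> \<and> holomorphic_map_on (\<psi> ` W) \<eta> \<and> (\<forall>z\<in>W. \<eta> (\<psi> z) = z) \<and>
       vec.subspace (L :: (complex ^ 'n) set) \<and> vec.dim L = d \<and> \<psi> ` (Z \<inter> W) = \<psi> ` W \<inter> L"
      by (simp only: regular_points_def mem_Collect_eq)
    then obtain W \<psi> \<eta> and L :: "(complex ^ 'n) set" where "open W \<and> p \<in> W \<and> open (\<psi> ` W) \<and>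
       holomorphic_map_on W \<psi> \<and> holomorphic_map_on (\<psi> ` W) \<eta> \<and> (\<forall>z\<in>W. \<eta> (\<psi> z) = z) \<and>
       vec.subspace L \<and> vec.dim L = d \<and> \<psi> ` (Z \<inter> W) = \<psi> ` W \<inter> L"
      by (elim exE) (rule that)
    note WW = this
    have W: "open W" "p \<in> W" "open (\<psi> ` W)" "holomorphic_map_on (\<psi> ` W) \<eta>" "\<forall>z\<in>W. \<eta> (\<psi> z) = z"
      "vec.subspace L" "vec.dim L = d" "\<psi> ` (Z \<inter> W) = \<psi> ` W \<inter> L"
      by (insert WW, (elim conjE, assumption)+)
    \<comment> \<open>A nonzero vector of \<open>L\<close> yields points of \<open>L\<close> tending
      to \<open>\<psi> p\<close>; their images under \<eta> are points of \<open>Z\<close> near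
      \<open>p\<close>, hence equal to \<open>p\<close>, against injectivity of the chart.\<close>
    have "\<not> L \<subseteq> {0}" using W(7) \<open>d \<noteq> 0\<close> by (simp flip: vec.dim_eq_0)
    then obtain l where l: "l \<in> L" "l \<noteq> 0" by auto
    have \<psi>pL: "\<psi> p \<in> L" using W(2,8) p by blast
    have "continuous (at (\<psi> p)) (\<lambda>z. \<eta> z $ i)" for i
      using W(2,4) unfolding holomorphic_map_on_def holomorphic_fun_on_def
      by (meson has_derivative_continuous imageI)
    then have \<eta>: "((\<lambda>z. \<eta> z) \<longlongrightarrow> \<eta> (\<psi> p)) (at (\<psi> p))"
      by (intro vec_tendstoI) (simp add: continuous_at)
    define x where "x n = \<psi> p + of_real (inverse (real (Suc n))) *s l" for n
    have "(\<lambda>n. complex_of_real (inverse (real (Suc n)))) \<longlonglongrightarrow> of_real 0"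
      by (intro tendsto_of_real LIMSEQ_inverse_real_of_nat)
    then have "(\<lambda>n. norm (complex_of_real (inverse (real (Suc n)))) * norm l) \<longlonglongrightarrow> 0"
      by (intro tendsto_mult_left_zero tendsto_norm_zero) simp
    then have "(\<lambda>n. norm (x n - \<psi> p)) \<longlonglongrightarrow> 0" by (simp add: x_def norm_vec_smult)
    then have x: "x \<longlonglongrightarrow> \<psi> p" by (simp add: tendsto_norm_zero_iff LIM_zero_iff)
    have xne: "x n \<noteq> \<psi> p" for n
    proof
      assume "x n = \<psi> p"
      then have "of_real (inverse (real (Suc n))) *s l = 0" by (simp add: x_def)
      then have "norm (complex_of_real (inverse (real (Suc n)))) * norm l = 0"
        by (simp only: norm_vec_smult[symmetric] norm_zero)
      then show False using l(2) by (simp del: of_nat_Suc)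
    qed
    have xL: "x n \<in> L" for n
      using W(6) \<psi>pL l(1) unfolding x_def by (intro vec.subspace_add vec.subspace_scale)
    have "(\<lambda>n. \<eta> (x n)) \<longlonglongrightarrow> \<eta> (\<psi> p)"
      by (rule tendsto_compose_at[OF x \<eta>, unfolded o_def]) simp
    then have "\<forall>\<^sub>F n in sequentially. dist (\<eta> (x n)) p < e"
      using W(2,5) e(1) by (auto simp: tendsto_iff)
    moreover have "\<forall>\<^sub>F n in sequentially. x n \<in> \<psi> ` W"
      using W(2) by (intro topological_tendstoD[OF x W(3)]) auto
    ultimately have "\<forall>\<^sub>F n in sequentially. dist (\<eta> (x n)) p < e \<and> x n \<in> \<psi> ` W"
      by eventually_elim auto
    then obtain n where n: "dist (\<eta> (x n)) p < e" "x n \<in> \<psi> ` W"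
      using eventually_happens'[OF sequentially_bot] by blast
    then have "x n \<in> \<psi> ` (Z \<inter> W)" using W(8) xL by blast
    then obtain y where y: "y \<in> Z" "y \<in> W" "x n = \<psi> y" by auto
    then have "y = p" using e(2)[of y] n(1) W(5) by simp
    then show False using xne y(3) by simp
  qed
  ultimately have "{d. p \<in> closure (regular_points Z d)} = {0}" by auto
  then have "variety_dim_at Z p = 0" by (simp add: variety_dim_at_def)
  then show False using Z p by (simp add: one_dim_variety_def)
qed

lemma maximum_principle_variety:
  fixes Z :: "(complex ^ 'n::finite) set"
  assumes Z: "one_dim_variety Z" and v: "locally_submean G v"
    and K: "compact (Z \<inter> cball p \<delta>)" "Z \<inter> cball p \<delta> \<subseteq> G"
    and bound: "\<And>y. y \<in> Z \<Longrightarrow> dist p y = \<delta> \<Longrightarrow> v y \<le> M"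
    and y0: "y0 \<in> Z" "dist p y0 \<le> \<delta>"
  shows "v y0 \<le> M"
proof (rule maximum_principle_curves[OF v K _ bound y0])
  fix y assume y: "y \<in> Z"
  have "analytic_variety Z" using Z by (simp add: one_dim_variety_def)
  from variety_curve[OF this y one_dim_variety_islimpt[OF Z y]]
  show "\<exists>\<sigma>>0. \<exists>\<gamma>. hol_curve (ball 0 \<sigma>) \<gamma> \<and> \<gamma> 0 = y \<and>
        (\<forall>s\<in>ball 0 \<sigma>. (s \<noteq> 0 \<longrightarrow> \<gamma> s \<noteq> y) \<and> \<gamma> s \<in> Z)" .
qed auto

text \<open>\<open>Z\<close> is only locally closed, so the radius has to keep the ball inside a
  neighbourhood where \<open>Z\<close> is a zero set.\<close>

lemma compact_variety_cball:
  fixes Z :: "(complex ^ 'n::finite) set"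
  assumes "analytic_variety Z" "p \<in> Z"
  obtains R where "0 < R" "\<And>\<delta>. \<delta> < R \<Longrightarrow> compact (Z \<inter> cball p \<delta>)"
proof -
  obtain W H where "open W \<and> p \<in> W \<and> finite H \<and> (\<forall>h\<in>H. holomorphic_fun_on W h) \<and> Z \<inter> W = {z\<in>W. \<forall>h\<in>H. h z = 0}"
    using bspec[OF assms(1)[unfolded analytic_variety_def] assms(2)] by (elim exE) (rule that)
  then have W: "open W" "p \<in> W" "\<And>h. h \<in> H \<Longrightarrow> holomorphic_fun_on W h" "Z \<inter> W = {z\<in>W. \<forall>h\<in>H. h z = 0}"
    by auto
  obtain R where R: "0 < R" "ball p R \<subseteq> W" using W(1,2) open_contains_ball by blast
  show ?thesis
  proof (rule that[OF R(1)])
    fix \<delta> assume \<delta>: "\<delta> < R"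
    have sub: "cball p \<delta> \<subseteq> W" using R(2) \<delta> by auto
    have "closed {z \<in> cball p \<delta>. h z = 0}" if "h \<in> H" for h
    proof (rule continuous_closed_preimage_constant)
      have "continuous (at z) h" if "z \<in> W" for z
        using W(3)[OF \<open>h \<in> H\<close>] that unfolding holomorphic_fun_on_def by (meson has_derivative_continuous)
      then have "continuous_on W h" by (rule continuous_at_imp_continuous_on[rule_format])
      then show "continuous_on (cball p \<delta>) h" by (rule continuous_on_subset[OF _ sub])
    qed auto
    then have "closed (cball p \<delta> \<inter> (\<Inter>h\<in>H. {z \<in> cball p \<delta>. h z = 0}))"
      by (intro closed_Int closed_INT) auto
    moreover have "Z \<inter> cball p \<delta> = cball p \<delta> \<inter> (\<Inter>h\<in>H. {z \<in> cball p \<delta>. h z = 0})"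
      using W(4) sub by blast
    ultimately have "closed (Z \<inter> cball p \<delta>)" by simp
    then have "compact (cball p \<delta> \<inter> (Z \<inter> cball p \<delta>))" by (intro compact_Int_closed) auto
    then show "compact (Z \<inter> cball p \<delta>)" by (simp add: Int_ac)
  qed
qed

section \<open>Plurisubharmonic functions\<close>

lemma continuous_on_circle:
  fixes v :: "complex ^ 'n::finite \<Rightarrow> real"
  assumes "continuous_on G v" "ball z R \<subseteq> G" "s * norm w < R" "0 \<le> s"
  shows "continuous_on A (\<lambda>\<theta>. v (z + (of_real s * cis \<theta>) *s w))"
proof (rule continuous_on_compose2[OF assms(1)])
  show "(\<lambda>\<theta>. z + (of_real s * cis \<theta>) *s w) ` A \<subseteq> G"
    using assms(2-4) by (auto simp: subset_iff dist_norm norm_vec_smult norm_mult)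
qed (intro continuous_intros continuous_on_cis)

lemma integrable_circle:
  fixes v :: "complex ^ 'n::finite \<Rightarrow> real"
  assumes "continuous_on G v" "ball z R \<subseteq> G" "s * norm w < R" "0 \<le> s"
  shows "(\<lambda>\<theta>. v (z + (of_real s * cis \<theta>) *s w)) integrable_on {0..2 * pi}"
  by (rule integrable_continuous_real[OF continuous_on_circle[OF assms]])

lemma small_circle_ex:
  fixes z w :: "complex ^ 'n::finite"
  assumes "open G" "z \<in> G"
  obtains R \<rho> where "0 < R" "ball z R \<subseteq> G" "0 < \<rho>" "\<And>s. 0 < s \<Longrightarrow> s < \<rho> \<Longrightarrow> s * norm w < R"
proof -
  obtain R where R: "0 < R" "ball z R \<subseteq> G" using assms open_contains_ball by blast
  have nw: "0 < norm w + 1" using norm_ge_zero[of w] by linarith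
  show ?thesis
  proof (rule that[OF R, of "R / (norm w + 1)"])
    show "0 < R / (norm w + 1)" using R nw by simp
    fix s assume s: "0 < s" "s < R / (norm w + 1)"
    then have "s * (norm w + 1) < R" using nw by (simp add: field_simps)
    moreover have "s * norm w \<le> s * (norm w + 1)" using s by (intro mult_left_mono) auto
    ultimately show "s * norm w < R" by simp
  qed
qed

lemma locally_submean_psh:
  fixes u :: "complex ^ 'n::finite \<Rightarrow> real"
  assumes u: "continuous_psh_on U u" and "open U" shows "locally_submean U u"
  unfolding locally_submean_def
proof (intro conjI ballI allI)
  show "continuous_on U u" using u by (simp add: continuous_psh_on_def)
  fix z w :: "complex ^ 'n" assume z: "z \<in> U"
  obtain R \<rho> where R: "0 < R" "ball z R \<subseteq> U" "0 < \<rho>" "\<And>s. 0 < s \<Longrightarrow> s < \<rho> \<Longrightarrow> s * norm w < R"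
    by (rule small_circle_ex[OF \<open>open U\<close> z, of w]) (rule that, assumption+)
  have "u z \<le> 1 / (2 * pi) * integral {0..2 * pi} (\<lambda>\<theta>. u (z + (of_real s * cis \<theta>) *s w))"
    if s: "0 < s" "s < \<rho>" for s
  proof -
    have "z + \<tau> *s (of_real s *s w) \<in> U" if "norm \<tau> \<le> 1" for \<tau>
    proof -
      have "norm (\<tau> *s (of_real s *s w)) \<le> 1 * (s * norm w)"
        unfolding norm_vec_smult using that s by (intro mult_mono) (auto simp: norm_vec_smult)
      also have "\<dots> < R" using R(4)[OF s] by simp
      finally have "z + \<tau> *s (of_real s *s w) \<in> ball z R" by (simp add: dist_norm)
      then show ?thesis using R(2) by blast
    qed
    then have "u z \<le> 1 / (2 * pi) * integral {0..2 * pi} (\<lambda>\<theta>. u (z + cis \<theta> *s (of_real s *s w)))"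
      using u unfolding continuous_psh_on_def by blast
    then show ?thesis by (simp add: mult.commute)
  qed
  then show "\<exists>\<rho>>0. \<forall>s. 0 < s \<longrightarrow> s < \<rho> \<longrightarrow>
     u z \<le> 1 / (2 * pi) * integral {0..2 * pi} (\<lambda>\<theta>. u (z + (of_real s * cis \<theta>) *s w))"
    using R(3) by blast
qed fact

lemma locally_submean_translate:
  fixes v :: "complex ^ 'n::finite \<Rightarrow> real"
  assumes "locally_submean G v" shows "locally_submean ((\<lambda>z. z + a) -` G) (\<lambda>z. v (z + a))"
  unfolding locally_submean_def
proof (intro conjI ballI allI)
  show "open ((\<lambda>z. z + a) -` G)"
    using assms by (intro open_vimage) (auto simp: locally_submean_def intro!: continuous_intros)
  show "continuous_on ((\<lambda>z. z + a) -` G) (\<lambda>z. v (z + a))"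
    using assms by (auto simp: locally_submean_def intro!: continuous_intros elim!: continuous_on_compose2)
  fix z w assume "z \<in> (\<lambda>z. z + a) -` G"
  then have "z + a \<in> G" by simp
  then show "\<exists>\<rho>>0. \<forall>s. 0 < s \<longrightarrow> s < \<rho> \<longrightarrow>
     v (z + a) \<le> 1 / (2 * pi) * integral {0..2 * pi} (\<lambda>\<theta>. v (z + (of_real s * cis \<theta>) *s w + a))"
    using assms unfolding locally_submean_def add.assoc[of z] add.commute[of _ a]
    by (simp add: add.assoc[symmetric] add.commute[of a])
qed

lemma locally_submean_subset:
  assumes "locally_submean G v" "open E" "E \<subseteq> G" shows "locally_submean E v"
  using assms unfolding locally_submean_def by (blast intro: continuous_on_subset)

lemma locally_submean_add:
  fixes u v :: "complex ^ 'n::finite \<Rightarrow> real"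
  assumes u: "locally_submean G u" and v: "locally_submean G v"
  shows "locally_submean G (\<lambda>z. u z + v z)"
  unfolding locally_submean_def
proof (intro conjI ballI allI)
  have G: "open G" and cu: "continuous_on G u" and cv: "continuous_on G v"
    using u v by (auto simp: locally_submean_def)
  show "open G" by fact
  show "continuous_on G (\<lambda>z. u z + v z)" by (intro continuous_intros cu cv)
  fix z w :: "complex ^ 'n" assume z: "z \<in> G"
  obtain R \<rho> where R: "0 < R" "ball z R \<subseteq> G" "0 < \<rho>" "\<And>s. 0 < s \<Longrightarrow> s < \<rho> \<Longrightarrow> s * norm w < R"
    by (rule small_circle_ex[OF G z, of w]) (rule that, assumption+)
  let ?m = "\<lambda>u s. 1 / (2 * pi) * integral {0..2 * pi} (\<lambda>\<theta>. u (z + (of_real s * cis \<theta>) *s w))"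
  obtain \<rho>1 where \<rho>1: "\<rho>1 > 0" "\<And>s. 0 < s \<Longrightarrow> s < \<rho>1 \<Longrightarrow> u z \<le> ?m u s"
    using u z unfolding locally_submean_def by blast
  obtain \<rho>2 where \<rho>2: "\<rho>2 > 0" "\<And>s. 0 < s \<Longrightarrow> s < \<rho>2 \<Longrightarrow> v z \<le> ?m v s"
    using v z unfolding locally_submean_def by blast
  have "u z + v z \<le> ?m (\<lambda>z. u z + v z) s" if s: "0 < s" "s < min \<rho> (min \<rho>1 \<rho>2)" for s
  proof -
    have i: "(\<lambda>\<theta>. u (z + (of_real s * cis \<theta>) *s w)) integrable_on {0..2 * pi}"
      "(\<lambda>\<theta>. v (z + (of_real s * cis \<theta>) *s w)) integrable_on {0..2 * pi}"
      using s R(4)[of s] by (auto intro!: integrable_circle[OF cu R(2)] integrable_circle[OF cv R(2)])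
    show ?thesis
      unfolding Henstock_Kurzweil_Integration.integral_add[OF i] distrib_left
      using \<rho>1(2)[of s] \<rho>2(2)[of s] s by (intro add_mono) auto
  qed
  then show "\<exists>\<rho>>0. \<forall>s. 0 < s \<longrightarrow> s < \<rho> \<longrightarrow> u z + v z \<le> ?m (\<lambda>z. u z + v z) s"
    using R(3) \<rho>1(1) \<rho>2(1) by (intro exI[of _ "min \<rho> (min \<rho>1 \<rho>2)"]) auto
qed

text \<open>The real part of \<open>h\<close> has mean zero over the circle, so it may be added to a
  pointwise lower bound without affecting the bound for the mean.\<close>

lemma circle_mean_ge:
  assumes cont: "continuous_on {0..2 * pi} F" and h: "h holomorphic_on UNIV" "h 0 = 0" and "0 < s"
    and ge: "\<And>\<theta>. c + Re (h (of_real s * cis \<theta>)) \<le> F \<theta>"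
  shows "c \<le> 1 / (2 * pi) * integral {0..2 * pi} F"
proof -
  have hb: "h holomorphic_on ball 0 (s + 1)" by (rule holomorphic_on_subset[OF h(1)]) simp
  have "((\<lambda>\<theta>. Re (h (of_real s * cis \<theta>))) has_integral 0) {0..2 * pi}"
    using has_integral_Re_holomorphic_circle[OF hb \<open>0 < s\<close>] h(2) by simp
  from has_integral_add[OF has_integral_const_real[of c 0 "2 * pi"] this]
  have "((\<lambda>\<theta>. c + Re (h (of_real s * cis \<theta>))) has_integral 2 * pi * c) {0..2 * pi}" by simp
  moreover have "(F has_integral integral {0..2 * pi} F) {0..2 * pi}"
    by (intro integrable_integral integrable_continuous_real cont)
  ultimately have "2 * pi * c \<le> integral {0..2 * pi} F"
    by (rule has_integral_le) (rule ge)
  then show ?thesis by (simp add: field_simps)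
qed

text \<open>Gluing with the constant 0. Where \<open>v\<close> is 0, nonnegativity of
  \<open>v\<close> suffices; where it is positive, it equals \<open>A\<close> at the centre and
  dominates \<open>A\<close> on small circles.\<close>

lemma locally_submean_max_0:
  fixes A :: "complex ^ 'n::finite \<Rightarrow> real"
  assumes G: "open G" and E: "open E" "E \<subseteq> G" and A: "locally_submean E A"
    and cont: "continuous_on G v" and v: "\<And>z. z \<in> G \<Longrightarrow> 0 \<le> v z" "\<And>z. z \<in> E \<Longrightarrow> A z \<le> v z"
    and eq: "\<And>z. z \<in> G \<Longrightarrow> 0 < v z \<Longrightarrow> z \<in> E \<and> v z = A z"
  shows "locally_submean G v"
  unfolding locally_submean_def
proof (intro conjI ballI allI G cont)
  fix z w :: "complex ^ 'n" assume z: "z \<in> G"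
  let ?m = "\<lambda>u s. 1 / (2 * pi) * integral {0..2 * pi} (\<lambda>\<theta>. u (z + (of_real s * cis \<theta>) *s w))"
  show "\<exists>\<rho>>0. \<forall>s. 0 < s \<longrightarrow> s < \<rho> \<longrightarrow> v z \<le> ?m v s"
  proof (cases "0 < v z")
    case True
    then have zE: "z \<in> E" and vz: "v z = A z" using eq[OF z] by auto
    have cA: "continuous_on E A" using A by (simp add: locally_submean_def)
    obtain R \<rho> where R: "0 < R" "ball z R \<subseteq> E" "0 < \<rho>" "\<And>s. 0 < s \<Longrightarrow> s < \<rho> \<Longrightarrow> s * norm w < R"
      by (rule small_circle_ex[OF E(1) zE, of w]) (rule that, assumption+)
    obtain \<rho>1 where \<rho>1: "\<rho>1 > 0" "\<And>s. 0 < s \<Longrightarrow> s < \<rho>1 \<Longrightarrow> A z \<le> ?m A s"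
      using A zE unfolding locally_submean_def by blast
    have "v z \<le> ?m v s" if s: "0 < s" "s < min \<rho> \<rho>1" for s
    proof -
      have sw: "s * norm w < R" using R(4) s by simp
      have "integral {0..2 * pi} (\<lambda>\<theta>. A (z + (of_real s * cis \<theta>) *s w)) \<le>
            integral {0..2 * pi} (\<lambda>\<theta>. v (z + (of_real s * cis \<theta>) *s w))"
      proof (rule integral_le)
        show "(\<lambda>\<theta>. A (z + (of_real s * cis \<theta>) *s w)) integrable_on {0..2 * pi}"
          using s by (intro integrable_circle[OF cA R(2) sw]) simp
        show "(\<lambda>\<theta>. v (z + (of_real s * cis \<theta>) *s w)) integrable_on {0..2 * pi}"
          using s E(2) R(2) by (intro integrable_circle[OF cont _ sw]) auto
        fix \<theta>
        have "z + (of_real s * cis \<theta>) *s w \<in> ball z R"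
          using sw s by (simp add: dist_norm norm_vec_smult norm_mult)
        then show "A (z + (of_real s * cis \<theta>) *s w) \<le> v (z + (of_real s * cis \<theta>) *s w)"
          using v(2) R(2) by blast
      qed
      then have "?m A s \<le> ?m v s" by (intro mult_left_mono) auto
      then show ?thesis using \<rho>1(2)[of s] s vz by simp
    qed
    then show ?thesis using R(3) \<rho>1(1) by (intro exI[of _ "min \<rho> \<rho>1"]) auto
  next
    case False
    then have vz: "v z = 0" using v(1)[OF z] by simp
    obtain R \<rho> where R: "0 < R" "ball z R \<subseteq> G" "0 < \<rho>" "\<And>s. 0 < s \<Longrightarrow> s < \<rho> \<Longrightarrow> s * norm w < R"
      by (rule small_circle_ex[OF G z, of w]) (rule that, assumption+)
    have "v z \<le> ?m v s" if s: "0 < s" "s < \<rho>" for s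
    proof -
      have "0 \<le> integral {0..2 * pi} (\<lambda>\<theta>. v (z + (of_real s * cis \<theta>) *s w))"
      proof (rule integral_nonneg)
        show "(\<lambda>\<theta>. v (z + (of_real s * cis \<theta>) *s w)) integrable_on {0..2 * pi}"
          using s R(4)[OF s] by (intro integrable_circle[OF cont R(2)]) auto
        fix \<theta>
        have "z + (of_real s * cis \<theta>) *s w \<in> ball z R"
          using R(4)[OF s] s by (simp add: dist_norm norm_vec_smult norm_mult)
        then show "0 \<le> v (z + (of_real s * cis \<theta>) *s w)" using v(1) R(2) by blast
      qed
      then show ?thesis using vz by simp
    qed
    then show ?thesis using R(3) by blast
  qed
qed

section \<open>From a lower bound of the Levi form to the mean inequality\<close>

lemma second_order_expansion:
  fixes u :: "'a::real_normed_vector \<Rightarrow> real"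
  assumes u': "\<And>y. y \<in> E \<Longrightarrow> (u has_derivative blinfun_apply (u' y)) (at y)"
    and u'': "(u' has_derivative blinfun_apply (u'' z)) (at z)" and E: "open E" "z \<in> E" and "0 < e"
  obtains d where "0 < d" "\<And>h. norm h < d \<Longrightarrow> \<bar>u (z + h) - u z - u' z h - u'' z h h / 2\<bar> \<le> e * (norm h)\<^sup>2"
proof -
  obtain R where R: "0 < R" "ball z R \<subseteq> E" using E open_contains_ball by blast
  obtain d where d: "0 < d" "\<And>y. norm (y - z) < d \<Longrightarrow> norm (u' y - u' z - u'' z (y - z)) \<le> e * norm (y - z)"
    using u'' \<open>0 < e\<close> unfolding has_derivative_at_alt by blast
  show ?thesis
  proof (rule that[of "min d R"])
    show "0 < min d R" using d R by simp
    fix h :: 'a assume h: "norm h < min d R"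
    \<comment> \<open>With the linear and quadratic terms removed, the derivative of \<psi> is the
      first order remainder of \<open>u'\<close>; the mean value theorem on [0, 1] then gives the
      estimate.\<close>
    define \<psi> where "\<psi> s = u (z + s *\<^sub>R h) - s * u' z h - s\<^sup>2 * (u'' z h h / 2)" for s
    have der: "(\<psi> has_real_derivative (u' (z + s *\<^sub>R h) h - u' z h - s * u'' z h h)) (at s)"
      if "0 \<le> s" "s \<le> 1" for s
    proof -
      have "s * norm h \<le> 1 * norm h" using that by (intro mult_right_mono) auto
      then have "z + s *\<^sub>R h \<in> E" using R(2) h that by (auto simp: dist_norm)
      note u = u'[OF this]
      have "((\<lambda>s. z + s *\<^sub>R h) has_derivative (\<lambda>x. x *\<^sub>R h)) (at s)" by (auto intro!: derivative_eq_intros)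
      from has_derivative_compose[OF this u]
      have "((\<lambda>s. u (z + s *\<^sub>R h)) has_real_derivative u' (z + s *\<^sub>R h) h) (at s)"
        by (simp add: has_field_derivative_def blinfun.scaleR_right mult.commute[of _ "u' (z + s *\<^sub>R h) h"])
      then show ?thesis unfolding \<psi>_def by (auto intro!: derivative_eq_intros)
    qed
    obtain s where s: "0 < s" "s < 1" "\<psi> 1 - \<psi> 0 = (1 - 0) * (u' (z + s *\<^sub>R h) h - u' z h - s * u'' z h h)"
      using MVT2[OF zero_less_one der] by auto
    have "norm (u' (z + s *\<^sub>R h) - u' z - u'' z (s *\<^sub>R h)) \<le> e * norm (s *\<^sub>R h)"
    proof -
      have "s * norm h \<le> 1 * norm h" using s by (intro mult_right_mono) auto
      then show ?thesis using d(2)[of "z + s *\<^sub>R h"] h s by simp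
    qed
    also have "\<dots> \<le> e * norm h"
      using s \<open>0 < e\<close> mult_right_mono[of s 1 "norm h"] by (intro mult_left_mono) auto
    finally have "norm (u' (z + s *\<^sub>R h) - u' z - u'' z (s *\<^sub>R h)) * norm h \<le> e * norm h * norm h"
      by (intro mult_right_mono) auto
    then have "\<bar>(u' (z + s *\<^sub>R h) - u' z - u'' z (s *\<^sub>R h)) h\<bar> \<le> e * (norm h)\<^sup>2"
      using norm_blinfun[of "u' (z + s *\<^sub>R h) - u' z - u'' z (s *\<^sub>R h)" h] by (simp add: power2_eq_square mult.assoc)
    then have "\<bar>\<psi> 1 - \<psi> 0\<bar> \<le> e * (norm h)\<^sup>2"
      using s(3) by (simp add: blinfun.bilinear_simps)
    then show "\<bar>u (z + h) - u z - u' z h - u'' z h h / 2\<bar> \<le> e * (norm h)\<^sup>2"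
      by (simp add: \<psi>_def algebra_simps)
  qed
qed

text \<open>The Levi form is a quarter of the real Laplacian along a complex line, which is the
  quantity that the mean over a circle sees at second order.\<close>

lemma levi_form_eq:
  fixes u :: "complex ^ 'n::finite \<Rightarrow> real"
  assumes u': "\<And>y. y \<in> U \<Longrightarrow> (u has_derivative blinfun_apply (u' y)) (at y)"
    and u'': "(u' has_derivative blinfun_apply (u'' z)) (at z)" and U: "open U" "z \<in> U"
  shows "u'' z w w + u'' z (\<i> *s w) (\<i> *s w) = 4 * levi_form u z w"
proof -
  define B where "B h k = blinfun_apply (blinfun_apply (u'' z) h) k" for h k
  let ?e = "\<lambda>j. axis j (1::complex) :: complex ^ 'n" and ?f = "\<lambda>j. axis j \<i> :: complex ^ 'n"
  let ?q = "\<lambda>k y. (complex_of_real (u' y (?e k)) + \<i> * complex_of_real (u' y (?f k))) / 2"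
  have wb: "wirtinger_bar k (\<lambda>w. complex_of_real (u w)) y = ?q k y" if "y \<in> U" for k y
  proof -
    have "((\<lambda>w. complex_of_real (u w)) has_derivative (\<lambda>h. complex_of_real (u' y h))) (at y)"
      by (rule bounded_linear.has_derivative[OF bounded_linear_of_real u'[OF that]])
    from frechet_derivative_at[OF this, symmetric] show ?thesis by (simp add: wirtinger_bar_def)
  qed
  have w: "wirtinger j (wirtinger_bar k (\<lambda>w. complex_of_real (u w))) z =
      ((complex_of_real (B (?e j) (?e k)) + \<i> * complex_of_real (B (?e j) (?f k))) / 2
      - \<i> * ((complex_of_real (B (?f j) (?e k)) + \<i> * complex_of_real (B (?f j) (?f k))) / 2)) / 2" for j k
  proof -
    have d: "((\<lambda>y. blinfun_apply (u' y) v) has_derivative (\<lambda>h. B h v)) (at z)" for v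
      unfolding B_def by (rule bounded_linear.has_derivative[OF blinfun.bounded_linear_left u''])
    have "((\<lambda>y. ?q k y) has_derivative
       (\<lambda>h. (complex_of_real (B h (?e k)) + \<i> * complex_of_real (B h (?f k))) / 2)) (at z)"
      by (rule bounded_linear.has_derivative[OF bounded_linear_divide])
         (intro has_derivative_add has_derivative_mult_right bounded_linear.has_derivative[OF bounded_linear_of_real d])
    then have "(wirtinger_bar k (\<lambda>w. complex_of_real (u w)) has_derivative
       (\<lambda>h. (complex_of_real (B h (?e k)) + \<i> * complex_of_real (B h (?f k))) / 2)) (at z)"
      by (rule has_derivative_transform_within_open[OF _ U]) (simp add: wb)
    from frechet_derivative_at[OF this, symmetric] show ?thesis by (simp add: wirtinger_def)
  qed
  have ax: "axis j (c::complex) = Re c *\<^sub>R ?e j + Im c *\<^sub>R ?f j" for j c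
    by (simp add: vec_eq_iff axis_def complex_eq_iff)
  define X where "X v j k = Re (v $ j) * Re (v $ k) * B (?e j) (?e k) + Re (v $ j) * Im (v $ k) * B (?e j) (?f k) +
      Im (v $ j) * Re (v $ k) * B (?f j) (?e k) + Im (v $ j) * Im (v $ k) * B (?f j) (?f k)" for v j k
  have BB: "B v v = (\<Sum>j\<in>UNIV. \<Sum>k\<in>UNIV. X v j k)" for v
  proof -
    have "B v v = B (\<Sum>j\<in>UNIV. axis j (v $ j)) (\<Sum>k\<in>UNIV. axis k (v $ k))"
      by (simp flip: vec_eq_sum_axis)
    also have "\<dots> = (\<Sum>j\<in>UNIV. \<Sum>k\<in>UNIV. B (axis j (v $ j)) (axis k (v $ k)))"
      unfolding B_def blinfun.sum_left blinfun.sum_right by (rule sum.swap)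
    also have "\<dots> = (\<Sum>j\<in>UNIV. \<Sum>k\<in>UNIV. X v j k)"
    proof (intro sum.cong refl)
      show "B (axis j (v $ j)) (axis k (v $ k)) = X v j k" for j k
        unfolding ax[of j "v $ j"] ax[of k "v $ k"] B_def X_def by (simp add: blinfun.bilinear_simps algebra_simps)
    qed
    finally show ?thesis .
  qed
  \<comment> \<open>Passing from \<open>w\<close> to \<open>\<i> *s w\<close> replaces (Re, Im) by
    (-Im, Re); the identity holds for each pair of indices separately.\<close>
  have alg: "(a * a' * p + a * b' * q + b * a' * r + b * b' * s) +
     ((- b) * (- b') * p + (- b) * a' * q + a * (- b') * r + a * a' * s) =
     4 * Re (((complex_of_real p + \<i> * complex_of_real q) / 2 - \<i> * ((complex_of_real r + \<i> * complex_of_real s) / 2)) / 2 *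
        Complex a b * cnj (Complex a' b'))" for a b a' b' p q r s :: real
    by (simp add: field_simps)
  have XX: "X w j k + X (\<i> *s w) j k = 4 * Re
    (wirtinger j (wirtinger_bar k (\<lambda>w. complex_of_real (u w))) z * w $ j * cnj (w $ k))" for j k
    using alg[of "Re (w $ j)" "Re (w $ k)" "B (?e j) (?e k)" "Im (w $ k)" "B (?e j) (?f k)" "Im (w $ j)" "B (?f j) (?e k)" "B (?f j) (?f k)"]
    unfolding w X_def by simp
  have "B w w + B (\<i> *s w) (\<i> *s w) = (\<Sum>j\<in>UNIV. \<Sum>k\<in>UNIV. X w j k + X (\<i> *s w) j k)"
    by (simp only: BB sum.distrib)
  also have "\<dots> = 4 * levi_form u z w" unfolding XX by (simp add: levi_form_def sum_distrib_left Re_sum)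
  finally show ?thesis by (simp add: B_def)
qed

text \<open>On a circle of radius \<open>s\<close> the Levi form contributes at least \<Lambda> s^2
  |w|^2. Of this, \<Lambda>' s^2 |w|^2 pays for the subtracted square and the rest for the Taylor
  error, which is at most (\<Lambda> - \<Lambda>') s^2 |w|^2 on small circles.\<close>

lemma locally_submean_strictly_psh:
  fixes \<phi> :: "complex ^ 'n::finite \<Rightarrow> real"
  assumes \<phi>: "C2_on U \<phi>" and U: "open U" and E: "open E" "E \<subseteq> U"
    and levi: "\<And>z \<zeta>. z \<in> E \<Longrightarrow> \<Lambda> * (norm \<zeta>)\<^sup>2 \<le> levi_form \<phi> z \<zeta>" and "\<Lambda>' < \<Lambda>"
  shows "locally_submean E (\<lambda>z. \<phi> z - \<Lambda>' * (norm (z - p))\<^sup>2)"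
  unfolding locally_submean_def
proof (intro conjI ballI allI)
  obtain u' u'' where u': "\<And>y. y \<in> U \<Longrightarrow> (\<phi> has_derivative blinfun_apply (u' y)) (at y)"
    and u'': "\<And>z. z \<in> U \<Longrightarrow> (u' has_derivative blinfun_apply (u'' z)) (at z)"
    using \<phi> unfolding C2_on_def by blast
  show "open E" by fact
  have "continuous (at y) \<phi>" if "y \<in> U" for y using u'[OF that] by (rule has_derivative_continuous)
  then have "continuous_on U \<phi>" by (rule continuous_at_imp_continuous_on[rule_format])
  then have "continuous_on E \<phi>" using E(2) by (rule continuous_on_subset)
  then show cont: "continuous_on E (\<lambda>z. \<phi> z - \<Lambda>' * (norm (z - p))\<^sup>2)" by (intro continuous_intros)
  fix z w :: "complex ^ 'n" assume z: "z \<in> E"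
  then have zU: "z \<in> U" using E(2) by blast
  have "0 < \<Lambda> - \<Lambda>'" using \<open>\<Lambda>' < \<Lambda>\<close> by simp
  obtain d where d: "0 < d" "\<And>h. norm h < d \<Longrightarrow> \<bar>\<phi> (z + h) - \<phi> z - u' z h - u'' z h h / 2\<bar> \<le> (\<Lambda> - \<Lambda>') * (norm h)\<^sup>2"
    by (rule second_order_expansion[where u = \<phi> and u' = u' and u'' = u'' and z = z, OF u' u''[OF zU] U zU \<open>0 < \<Lambda> - \<Lambda>'\<close>]) (assumption | rule that)+
  have zEb: "z \<in> E \<inter> ball z d" "open (E \<inter> ball z d)" using z d(1) E(1) by auto
  obtain R \<rho> where R: "0 < R" "ball z R \<subseteq> E \<inter> ball z d" "0 < \<rho>" "\<And>s. 0 < s \<Longrightarrow> s < \<rho> \<Longrightarrow> s * norm w < R"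
    by (rule small_circle_ex[OF zEb(2,1), of w]) (rule that, assumption+)
  have "R \<le> d" using R(1,2) by (simp add: ball_subset_ball_iff)
  define a b where "a = u' z w" and "b = u' z (\<i> *s w)"
  define P Q S T where "P = u'' z w w" and "Q = u'' z w (\<i> *s w)" and "S = u'' z (\<i> *s w) w" and "T = u'' z (\<i> *s w) (\<i> *s w)"
  define \<Sigma> where "\<Sigma> = (\<Sum>i\<in>UNIV. cnj ((z - p) $ i) * w $ i)"
  \<comment> \<open>All terms of the expansion that are real parts of holomorphic functions
    vanishing at 0: the linear terms and the trace-free part of the real Hessian on the
    line.\<close>
  define h where "h t = Complex a (- b) * t + Complex ((P - T) / 4) (- (Q + S) / 4) * t ^ 2 - of_real (2 * \<Lambda>') * (\<Sigma> * t)" for t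
  have "\<phi> z - \<Lambda>' * (norm (z - p))\<^sup>2 \<le> 1 / (2 * pi) * integral {0..2 * pi}
     (\<lambda>\<theta>. \<phi> (z + (of_real s * cis \<theta>) *s w) - \<Lambda>' * (norm (z + (of_real s * cis \<theta>) *s w - p))\<^sup>2)"
    if s: "0 < s" "s < \<rho>" for s
  proof (rule circle_mean_ge[where h = h and s = s])
    show "continuous_on {0..2 * pi} (\<lambda>\<theta>. \<phi> (z + (of_real s * cis \<theta>) *s w) - \<Lambda>' * (norm (z + (of_real s * cis \<theta>) *s w - p))\<^sup>2)"
      using s R(2) R(4)[OF s] by (intro continuous_on_circle[OF cont]) auto
    show "h holomorphic_on UNIV" unfolding h_def by (intro holomorphic_intros)
    show "h 0 = 0" by (simp add: h_def)
    fix \<theta>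
    define t where "t = of_real s * cis \<theta>"
    have nt: "norm t = s" using s by (simp add: t_def norm_mult)
    have xy: "(Re t)\<^sup>2 + (Im t)\<^sup>2 = s\<^sup>2" unfolding nt[symmetric] by (simp add: cmod_power2)
    have nh: "norm (t *s w) = s * norm w" by (simp add: norm_vec_smult nt)
    have split: "t *s w = Re t *\<^sub>R w + Im t *\<^sub>R (\<i> *s w)"
      by (simp add: vec_eq_iff complex_eq_iff)
    have 1: "u' z (t *s w) = Re t * a + Im t * b"
      unfolding split by (simp add: blinfun.bilinear_simps a_def b_def)
    have 2: "u'' z (t *s w) (t *s w) = (Re t)\<^sup>2 * P + Re t * Im t * (Q + S) + (Im t)\<^sup>2 * T"
      unfolding split by (simp add: blinfun.bilinear_simps P_def Q_def S_def T_def algebra_simps power2_eq_square)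
    have "P + T = 4 * levi_form \<phi> z w"
      unfolding P_def T_def by (rule levi_form_eq[where u = \<phi> and u' = u' and u'' = u'' and z = z, OF u' u''[OF zU] U zU])
    then have PT: "4 * (\<Lambda> * (norm w)\<^sup>2) \<le> P + T" using levi[OF z, of w] by simp
    have 3: "(norm (z + t *s w - p))\<^sup>2 = (norm (z - p))\<^sup>2 + 2 * Re (\<Sigma> * t) + s\<^sup>2 * (norm w)\<^sup>2"
    proof -
      have "z + t *s w - p = (z - p) + t *s w" by simp
      moreover have "(z - p) \<bullet> (t *s w) = Re (\<Sigma> * t)"
        unfolding inner_eq_Re_sum \<Sigma>_def sum_distrib_right by (simp add: mult_ac)
      ultimately show ?thesis by (simp only: norm_add_squared nh power_mult_distrib)
    qed
    have 4: "Re (h t) = Re t * a + Im t * b + ((Re t)\<^sup>2 - (Im t)\<^sup>2) * ((P - T) / 4) + 2 * Re t * Im t * ((Q + S) / 4) - 2 * \<Lambda>' * Re (\<Sigma> * t)"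
    proof -
      have "Re (Complex a (- b) * t) = Re t * a + Im t * b" by simp
      moreover have "Re (Complex ((P - T) / 4) (- (Q + S) / 4) * t ^ 2) =
          ((Re t)\<^sup>2 - (Im t)\<^sup>2) * ((P - T) / 4) + 2 * Re t * Im t * ((Q + S) / 4)"
        by (simp add: power2_eq_square algebra_simps)
      moreover have "Re (of_real c * y) = c * Re y" for c y by simp
      then have "Re (of_real (2 * \<Lambda>') * (\<Sigma> * t)) = 2 * \<Lambda>' * Re (\<Sigma> * t)" .
      ultimately show ?thesis unfolding h_def by simp
    qed
    have "norm (t *s w) < d" using R(4)[OF s] \<open>R \<le> d\<close> nh by simp
    from d(2)[OF this] have 5: "\<phi> z + (Re t * a + Im t * b) + ((Re t)\<^sup>2 * P + Re t * Im t * (Q + S) + (Im t)\<^sup>2 * T) / 2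
        - (\<Lambda> - \<Lambda>') * (s\<^sup>2 * (norm w)\<^sup>2) \<le> \<phi> (z + t *s w)"
      unfolding 1 2 nh power_mult_distrib by linarith
    have 6: "s\<^sup>2 * (\<Lambda> * (norm w)\<^sup>2) \<le> ((Re t)\<^sup>2 + (Im t)\<^sup>2) * ((P + T) / 4)"
      unfolding xy using PT by (intro mult_left_mono) auto
    have "((Re t)\<^sup>2 * P + Re t * Im t * (Q + S) + (Im t)\<^sup>2 * T) / 2 =
       ((Re t)\<^sup>2 + (Im t)\<^sup>2) * ((P + T) / 4) + ((Re t)\<^sup>2 - (Im t)\<^sup>2) * ((P - T) / 4) + 2 * Re t * Im t * ((Q + S) / 4)"
      by (simp add: field_simps)
    with 5 6 show "\<phi> z - \<Lambda>' * (norm (z - p))\<^sup>2 + Re (h (of_real s * cis \<theta>))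
       \<le> \<phi> (z + (of_real s * cis \<theta>) *s w) - \<Lambda>' * (norm (z + (of_real s * cis \<theta>) *s w - p))\<^sup>2"
      unfolding t_def[symmetric] 3 4 by (simp add: algebra_simps)
  qed fact
  then show "\<exists>\<rho>>0. \<forall>s. 0 < s \<longrightarrow> s < \<rho> \<longrightarrow> \<phi> z - \<Lambda>' * (norm (z - p))\<^sup>2 \<le> 1 / (2 * pi) * integral {0..2 * pi}
     (\<lambda>\<theta>. \<phi> (z + (of_real s * cis \<theta>) *s w) - \<Lambda>' * (norm (z + (of_real s * cis \<theta>) *s w - p))\<^sup>2)"
    using R(3) by blast
qed

section \<open>The function G\<close>

context
  fixes f :: "real \<Rightarrow> real"
  assumes cont: "continuous_on {1..} f" and mono: "mono_on {1..} f"
    and f_ge: "\<And>t. 1 \<le> t \<Longrightarrow> 1 \<le> f t"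
    and int: "\<exists>t>1. (\<lambda>a. 1 / (a * f a)) integrable_on {t..}"
begin

lemma integrand_pos: "1 \<le> a \<Longrightarrow> 0 < 1 / (a * f a)"
  using f_ge[of a] by simp

lemma integrand_integrable_Icc:
  assumes "1 \<le> s" shows "(\<lambda>a. 1 / (a * f a)) integrable_on {s..t}"
proof (rule integrable_continuous_real)
  have "f a \<noteq> 0" if "s \<le> a" for a using f_ge[of a] assms that by simp
  then show "continuous_on {s..t} (\<lambda>a. 1 / (a * f a))"
    using assms by (intro continuous_intros continuous_on_subset[OF cont]) auto
qed

text \<open>The compact interval up to \<open>t0\<close> is added by continuity; positivity makes
  the integral absolute and allows restriction to smaller half-lines.\<close>

lemma integrand_integrable:
  assumes "1 \<le> s" shows "(\<lambda>a. 1 / (a * f a)) integrable_on {s..}"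
proof -
  obtain t0 where t0: "1 < t0" "(\<lambda>a. 1 / (a * f a)) integrable_on {t0..}" using int by blast
  have "(\<lambda>a. 1 / (a * f a)) integrable_on ({1..t0} \<union> {t0..})"
  proof (rule integrable_Un)
    have "{1..t0} \<inter> {t0..} = {t0}" using t0 by auto
    then show "negligible ({1..t0} \<inter> {t0..})" by simp
  qed (use t0 integrand_integrable_Icc in auto)
  moreover have "{1..t0} \<union> {t0..} = {1..}" using t0 by auto
  ultimately have "(\<lambda>a. 1 / (a * f a)) absolutely_integrable_on {1..}"
    using integrand_pos by (intro nonnegative_absolutely_integrable_1) (auto intro: less_imp_le)
  then have "(\<lambda>a. 1 / (a * f a)) absolutely_integrable_on {s..}"
    by (rule set_integrable_subset) (use assms in auto)
  then show ?thesis by (rule set_lebesgue_integral_eq_integral(1))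
qed

lemma tail_split:
  assumes "1 \<le> s" "s \<le> t"
  shows "integral {s..} (\<lambda>a. 1 / (a * f a)) = integral {s..t} (\<lambda>a. 1 / (a * f a)) + integral {t..} (\<lambda>a. 1 / (a * f a))"
proof -
  have "{s..} = {s..t} \<union> {t..}" "{s..t} \<inter> {t..} = {t}" using assms by auto
  then show ?thesis
    using has_integral_Un[OF integrable_integral[OF integrand_integrable_Icc[OF assms(1), of t]]
        integrable_integral[OF integrand_integrable[of t]]] assms
    by (simp add: integral_unique)
qed

lemma integral_Icc_ge:
  assumes "1 \<le> s" "s \<le> t" shows "(t - s) * (1 / (t * f t)) \<le> integral {s..t} (\<lambda>a. 1 / (a * f a))"
proof -
  have "integral {s..t} (\<lambda>_. 1 / (t * f t)) \<le> integral {s..t} (\<lambda>a. 1 / (a * f a))"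
  proof (rule integral_le)
    fix a assume a: "a \<in> {s..t}"
    have "f a \<le> f t" using mono_onD[OF mono, of a t] a assms by auto
    then have "a * f a \<le> t * f t" using a assms f_ge[of a] by (intro mult_mono) auto
    moreover have "0 < a * f a" using a assms f_ge[of a] by simp
    ultimately show "1 / (t * f t) \<le> 1 / (a * f a)" by (simp add: frac_le)
  qed (use integrand_integrable_Icc[OF assms(1)] in auto)
  then show ?thesis using assms by simp
qed

lemma tail_nonneg: "1 \<le> s \<Longrightarrow> 0 \<le> integral {s..} (\<lambda>a. 1 / (a * f a))"
  using integrand_integrable[of s] integrand_pos by (intro integral_nonneg) (auto intro: less_imp_le)

lemma tail_strict_decreasing:
  assumes "1 \<le> s" "s < t"
  shows "integral {t..} (\<lambda>a. 1 / (a * f a)) < integral {s..} (\<lambda>a. 1 / (a * f a))"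
proof -
  have "0 < (t - s) * (1 / (t * f t))" using assms integrand_pos[of t] by (intro mult_pos_pos) auto
  then show ?thesis using integral_Icc_ge[of s t] tail_split[of s t] assms by simp
qed

lemma tail_pos: "1 \<le> s \<Longrightarrow> 0 < integral {s..} (\<lambda>a. 1 / (a * f a))"
  using tail_strict_decreasing[of s "s + 1"] tail_nonneg[of "s + 1"] by simp

text \<open>The integral over a half-line is a limit of integrals over large intervals, so its tails
  tend to 0.\<close>

lemma tail_small:
  assumes "0 < e" obtains T where "1 \<le> T" "integral {T..} (\<lambda>a. 1 / (a * f a)) < e"
proof -
  have "((\<lambda>a. 1 / (a * f a)) has_integral integral {1..} (\<lambda>a. 1 / (a * f a))) {1..}"
    by (intro integrable_integral integrand_integrable) simp
  then obtain B where B: "0 < B" "\<And>a b. ball 0 B \<subseteq> cbox a b \<Longrightarrow>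
      \<exists>z. ((\<lambda>x. if x \<in> {1..} then 1 / (x * f x) else 0) has_integral z) (cbox a b) \<and>
        norm (z - integral {1..} (\<lambda>a. 1 / (a * f a))) < e"
    using \<open>0 < e\<close> unfolding has_integral'[of _ _ "{1..}"] by blast
  define T where "T = max B 1"
  have "ball 0 B \<subseteq> cbox (- T) T" by (auto simp: T_def dist_norm)
  then obtain z where z: "((\<lambda>x. if x \<in> {1..} then 1 / (x * f x) else 0) has_integral z) (cbox (- T) T)"
    "norm (z - integral {1..} (\<lambda>a. 1 / (a * f a))) < e" using B(2) by blast
  have *: "{1..} \<inter> cbox (- T) T = {1..T}" by (auto simp: T_def)
  have "z = integral {1..T} (\<lambda>a. 1 / (a * f a))"
    using z(1)[unfolded has_integral_restrict_Int *] by (rule integral_unique[symmetric])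
  then have "integral {T..} (\<lambda>a. 1 / (a * f a)) < e"
    using z(2) tail_split[of 1 T] tail_nonneg[of T] by (simp add: T_def)
  then show ?thesis using that[of T] by (simp add: T_def)
qed

text \<open>The intermediate value theorem for the tail integral shows that \<open>y\<close> is
  attained, so \<open>X\<close> is a genuine preimage. The tail from \<open>t / 2\<close> is at
  least \<open>1 / (2 * f t)\<close>, which is at least \<open>1 / y\<close>, the tail from
  \<open>X\<close>; as tails decrease strictly, \<open>t / 2 \<le> X\<close>.\<close>

lemma G_of_bounds:
  assumes y: "g_of f 1 \<le> y"
  defines "X \<equiv> inv_into {1..} (g_of f) y"
  shows "1 \<le> X" "\<And>t. 2 \<le> t \<Longrightarrow> 2 * f t \<le> y \<Longrightarrow> t / 2 \<le> X"
proof -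
  let ?I = "\<lambda>s. integral {s..} (\<lambda>a. 1 / (a * f a))"
  have y0: "0 < y" using y tail_pos[of 1] by (simp add: g_of_def) (smt (verit) divide_pos_pos)
  then obtain T where T: "1 \<le> T" "?I T < 1 / y" using tail_small[of "1 / y"] by auto
  have "1 / y \<le> ?I 1" using y y0 tail_pos[of 1] by (simp add: g_of_def field_simps)
  moreover have "continuous_on {1..T} ?I"
  proof (rule continuous_on_eq)
    show "continuous_on {1..T} (\<lambda>s. ?I 1 - integral {1..s} (\<lambda>a. 1 / (a * f a)))"
      by (intro continuous_intros indefinite_integral_continuous_1 integrand_integrable_Icc) simp
    show "?I 1 - integral {1..s} (\<lambda>a. 1 / (a * f a)) = ?I s" if "s \<in> {1..T}" for s
      using tail_split[of 1 s] that by simp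
  qed
  ultimately obtain x where x: "1 \<le> x" "?I x = 1 / y"
    using IVT2'[of ?I T "1 / y" 1] T by auto
  then have "y = g_of f x" using y0 by (simp add: g_of_def)
  then have yim: "y \<in> g_of f ` {1..}" using x by auto
  show X1: "1 \<le> X" using inv_into_into[OF yim] by (simp add: X_def)
  have "g_of f X = y" unfolding X_def by (rule f_inv_into_f[OF yim])
  then have IX: "?I X = 1 / y" by (auto simp: g_of_def)
  fix t assume t: "2 \<le> t" "2 * f t \<le> y"
  show "t / 2 \<le> X"
  proof (rule ccontr)
    assume "\<not> t / 2 \<le> X"
    then have "?I (t / 2) < ?I X" using X1 by (intro tail_strict_decreasing) auto
    moreover have "(t - t / 2) * (1 / (t * f t)) \<le> ?I (t / 2)"
      using integral_Icc_ge[of "t / 2" t] tail_split[of "t / 2" t] tail_nonneg[of t] t by simp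
    moreover have "1 / y \<le> (t - t / 2) * (1 / (t * f t))"
    proof -
      have "1 / y \<le> 1 / (2 * f t)" using t f_ge[of t] by (intro divide_left_mono) auto
      also have "\<dots> = (t - t / 2) * (1 / (t * f t))" using t by (simp add: field_simps)
      finally show ?thesis .
    qed
    ultimately show False using IX by simp
  qed
qed

end

section \<open>Geometry of the boundary\<close>

text \<open>The definition prescribes only the sign of \<open>r\<close> relative to \<Omega>.
  Openness of \<Omega> excludes negative values on the boundary, and a positive value would keep
  \<Omega> away from \<open>p\<close>.\<close>

lemma defining_function_zero:
  assumes "defining_function_on V \<Omega> r" "open \<Omega>" "p \<in> frontier \<Omega>" "p \<in> V"
  shows "r p = 0"
proof -
  have V: "open V" and C2: "C2_on V r" and sub: "\<Omega> \<inter> V = {z\<in>V. r z < 0}"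
    using assms(1) by (auto simp: defining_function_on_def)
  have "continuous (at p) r"
    using C2 assms(4) unfolding C2_on_def by (meson has_derivative_continuous)
  then have lim: "(r \<longlongrightarrow> r p) (at p)" by (simp add: continuous_at)
  have "p \<notin> \<Omega>" using assms(2,3) by (simp add: frontier_def interior_open)
  then have "0 \<le> r p" using sub assms(4) by force
  moreover have "\<not> 0 < r p"
  proof
    assume "0 < r p"
    then have "\<forall>\<^sub>F z in at p. 0 < r z" by (rule order_tendstoD(1)[OF lim])
    then have "\<forall>\<^sub>F z in nhds p. 0 < r z" using \<open>0 < r p\<close> by (simp add: eventually_nhds_conv_at)
    moreover have "\<forall>\<^sub>F z in nhds p. z \<in> V" using V assms(4) by (rule eventually_nhds_in_open)
    ultimately have "\<forall>\<^sub>F z in nhds p. z \<notin> \<Omega>"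
      by eventually_elim (use sub in force)
    then obtain S where "open S" "p \<in> S" "\<forall>z\<in>S. z \<notin> \<Omega>" unfolding eventually_nhds by blast
    moreover have "p \<in> closure \<Omega>" using assms(3) by (simp add: frontier_def)
    ultimately show False by (metis closure_iff_nhds_not_empty disjoint_iff subset_refl)
  qed
  ultimately show ?thesis by simp
qed

text \<open>The ball of radius equal to the boundary distance is connected, so it cannot meet both
  \<Omega> and its complement without meeting the boundary.\<close>

lemma in_open_if_close:
  fixes \<Omega> :: "'a::euclidean_space set"
  assumes "open \<Omega>" "z \<in> \<Omega>" "dist z y < infdist z (frontier \<Omega>)"
  shows "y \<in> \<Omega>"
proof (rule ccontr)
  assume "y \<notin> \<Omega>"
  let ?B = "ball z (infdist z (frontier \<Omega>))"
  have "0 < infdist z (frontier \<Omega>)" using assms(3) zero_le_dist[of z y] by linarith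
  then have "z \<in> ?B" "y \<in> ?B" using assms(3) by auto
  then have "?B \<inter> \<Omega> \<noteq> {}" "?B - \<Omega> \<noteq> {}" using assms(2) \<open>y \<notin> \<Omega>\<close> by blast+
  then have "?B \<inter> frontier \<Omega> \<noteq> {}" using connected_Int_frontier[of ?B \<Omega>] by simp
  then obtain x where "x \<in> frontier \<Omega>" "dist z x < infdist z (frontier \<Omega>)" by (auto simp: disjoint_iff)
  then show False using infdist_le[of x "frontier \<Omega>" z] by simp
qed

lemma boundary_geometry:
  fixes r :: "complex ^ 'n::finite \<Rightarrow> real"
  assumes r: "defining_function_on V \<Omega> r" and "open \<Omega>" and z0: "z\<^sub>0 \<in> frontier \<Omega>" "z\<^sub>0 \<in> V"
    and N: "open N" "z\<^sub>0 \<in> N"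
  obtains R K s1 \<nu> where "0 < R" "0 < K" "0 < s1" "\<nu> \<noteq> 0" "ball z\<^sub>0 R \<subseteq> V \<inter> N"
    "\<And>z. z \<in> ball z\<^sub>0 (R / 2) \<Longrightarrow> \<bar>r z\<bar> \<le> K * infdist z (frontier \<Omega>)"
    "\<And>z. z \<in> ball z\<^sub>0 R \<Longrightarrow> \<bar>r z\<bar> \<le> K * dist z z\<^sub>0"
    "\<And>z s. z \<in> ball z\<^sub>0 (R / 4) \<Longrightarrow> 0 \<le> s \<Longrightarrow> s \<le> s1 \<Longrightarrow> z + s *\<^sub>R \<nu> \<in> ball z\<^sub>0 (R / 2) \<and> r (z + s *\<^sub>R \<nu>) \<le> r z - s / 2"
proof -
  have V: "open V" and C2: "C2_on V r" and nz: "frechet_derivative r (at z\<^sub>0) \<noteq> (\<lambda>v. 0)"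
    using r z0 by (auto simp: defining_function_on_def)
  obtain r' r'' where r': "\<And>z. z \<in> V \<Longrightarrow> (r has_derivative blinfun_apply (r' z)) (at z)"
    and r'': "\<And>z. z \<in> V \<Longrightarrow> (r' has_derivative blinfun_apply (r'' z)) (at z)"
    using C2 unfolding C2_on_def by blast
  have r0: "r p = 0" if "p \<in> frontier \<Omega>" "p \<in> V" for p
    using defining_function_zero[OF r \<open>open \<Omega>\<close> that] .
  have "blinfun_apply (r' z\<^sub>0) \<noteq> (\<lambda>v. 0)" using nz frechet_derivative_at[OF r'[OF z0(2)]] by simp
  then obtain h where h: "r' z\<^sub>0 h \<noteq> 0" by fastforce
  \<comment> \<open>Normalised so that \<open>r\<close> decreases at unit rate in direction \<nu> at
    the base point.\<close>
  define \<nu> where "\<nu> = (- 1 / r' z\<^sub>0 h) *\<^sub>R h"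
  have \<nu>: "r' z\<^sub>0 \<nu> = - 1" using h by (simp add: \<nu>_def blinfun.bilinear_simps)
  then have "\<nu> \<noteq> 0" by auto
  \<comment> \<open>If the derivative of \<open>r\<close> varies by at most \<open>e\<close>, its
    value on \<nu> remains at most -1/2.\<close>
  define e where "e = 1 / (2 * (norm \<nu> + 1))"
  have n1: "0 < norm \<nu> + 1" using norm_ge_zero[of \<nu>] by linarith
  have e: "0 < e" "e * norm \<nu> \<le> 1 / 2" "e \<le> 1"
  proof -
    show "0 < e" using n1 by (simp add: e_def)
    have "e * (norm \<nu> + 1) = 1 / 2"
    proof -
      have "x \<noteq> 0 \<Longrightarrow> 1 / (2 * x) * x = 1 / 2" for x :: real by simp
      moreover have "norm \<nu> + 1 \<noteq> 0" using n1 by simp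
      ultimately show ?thesis unfolding e_def by blast
    qed
    moreover have "0 \<le> e * norm \<nu>" using \<open>0 < e\<close> by simp
    ultimately show "e * norm \<nu> \<le> 1 / 2" "e \<le> 1" using \<open>0 < e\<close> unfolding distrib_left by linarith+
  qed
  have "continuous (at z\<^sub>0) r'" using r''[OF z0(2)] by (rule has_derivative_continuous)
  then obtain d where d: "0 < d" "\<And>z. dist z z\<^sub>0 < d \<Longrightarrow> dist (r' z) (r' z\<^sub>0) < e"
    using e(1) unfolding continuous_at_eps_delta by blast
  have "open (V \<inter> N)" "z\<^sub>0 \<in> V \<inter> N" using V N z0 by auto
  then obtain R0 where R0: "0 < R0" "ball z\<^sub>0 R0 \<subseteq> V \<inter> N" using open_contains_ball by blast
  define R where "R = min d R0"
  have R: "0 < R" "R \<le> d" "ball z\<^sub>0 R \<subseteq> V \<inter> N" using d R0 by (auto simp: R_def)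
  have close: "norm (r' z - r' z\<^sub>0) \<le> e" if "z \<in> ball z\<^sub>0 R" for z
    using d(2)[of z] that R(2) by (simp add: dist_norm norm_minus_commute)
  define K where "K = norm (r' z\<^sub>0) + 1"
  have K: "0 < K" using norm_ge_zero[of "r' z\<^sub>0"] unfolding K_def by linarith
  have lip: "\<bar>r x - r y\<bar> \<le> K * dist x y" if "x \<in> ball z\<^sub>0 R" "y \<in> ball z\<^sub>0 R" for x y
  proof -
    have "norm (r x - r y) \<le> K * norm (x - y)"
    proof (rule differentiable_bound[OF convex_ball _ _ that])
      fix z assume z: "z \<in> ball z\<^sub>0 R"
      then have "z \<in> V" using R(3) by auto
      then show "(r has_derivative blinfun_apply (r' z)) (at z within ball z\<^sub>0 R)"
        by (rule has_derivative_at_withinI[OF r'])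
      have "norm (r' z) \<le> norm (r' z\<^sub>0) + norm (r' z - r' z\<^sub>0)"
        using norm_triangle_ineq[of "r' z\<^sub>0" "r' z - r' z\<^sub>0"] by simp
      then show "onorm (blinfun_apply (r' z)) \<le> K"
        using close[OF z] e(3) by (simp add: K_def norm_blinfun.rep_eq)
    qed
    then show ?thesis by (simp add: dist_norm)
  qed
  \<comment> \<open>A shift by at most \<open>s1\<close> moves the ball of radius
    \<open>R / 4\<close> into the ball of radius \<open>R / 2\<close>.\<close>
  define s1 where "s1 = R / (4 * (norm \<nu> + 1))"
  have s1: "0 < s1" "s1 * norm \<nu> < R / 4"
  proof -
    show "0 < s1" using R(1) n1 unfolding s1_def by (intro divide_pos_pos) auto
    have "s1 * (norm \<nu> + 1) = R / 4"
    proof -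
      have "x \<noteq> 0 \<Longrightarrow> R / (4 * x) * x = R / 4" for x by simp
      moreover have "norm \<nu> + 1 \<noteq> 0" using n1 by simp
      ultimately show ?thesis unfolding s1_def by blast
    qed
    then show "s1 * norm \<nu> < R / 4" using \<open>0 < s1\<close> unfolding distrib_left by linarith
  qed
  show ?thesis
  proof (rule that[OF R(1) K s1(1) \<open>\<nu> \<noteq> 0\<close> R(3)])
    fix z assume z: "z \<in> ball z\<^sub>0 (R / 2)"
    have ne: "frontier \<Omega> \<noteq> {}" using z0 by auto
    obtain p where p: "p \<in> frontier \<Omega>" "infdist z (frontier \<Omega>) = dist z p"
      using infdist_attains_inf[OF frontier_closed ne] by blast
    \<comment> \<open>As \<open>z\<^sub>0\<close> is itself a boundary point, the nearest one is no
      farther from \<open>z\<close>. It thus lies in the full ball, where the Lipschitz bound holds,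
      and \<open>r\<close> vanishes at it.\<close>
    have "dist z p \<le> dist z z\<^sub>0" using infdist_le[OF z0(1), of z] p(2) by simp
    then have "dist z\<^sub>0 p < R"
      using z dist_triangle[of z\<^sub>0 p z] by (simp add: dist_commute)
    then have pR: "p \<in> ball z\<^sub>0 R" by simp
    then have "r p = 0" using r0[OF p(1)] R(3) by auto
    then show "\<bar>r z\<bar> \<le> K * infdist z (frontier \<Omega>)"
      using lip[OF _ pR, of z] z R(1) p(2) by simp
  next
    fix z assume "z \<in> ball z\<^sub>0 R"
    then show "\<bar>r z\<bar> \<le> K * dist z z\<^sub>0" using lip[of z z\<^sub>0] r0[OF z0] R(1) by simp
  next
    fix z s assume z: "z \<in> ball z\<^sub>0 (R / 4)" and s: "0 \<le> (s::real)" "s \<le> s1"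
    have in_ball: "z + t *\<^sub>R \<nu> \<in> ball z\<^sub>0 (R / 2)" if "0 \<le> t" "t \<le> s" for t
    proof -
      have "norm (t *\<^sub>R \<nu>) \<le> s1 * norm \<nu>" using that s by (simp add: mult_right_mono)
      then have "norm (t *\<^sub>R \<nu>) < R / 4" using s1(2) by linarith
      then show ?thesis using z norm_triangle_ineq4[of "z\<^sub>0 - z" "t *\<^sub>R \<nu>"]
        by (simp add: dist_norm algebra_simps)
    qed
    have der: "((\<lambda>t. r (z + t *\<^sub>R \<nu>)) has_real_derivative r' (z + t *\<^sub>R \<nu>) \<nu>) (at t)" if "0 \<le> t" "t \<le> s" for t
    proof -
      have "z + t *\<^sub>R \<nu> \<in> V" using in_ball[OF that] R(1,3) by auto
      note u = r'[OF this]
      have "((\<lambda>t. z + t *\<^sub>R \<nu>) has_derivative (\<lambda>x. x *\<^sub>R \<nu>)) (at t)" by (auto intro!: derivative_eq_intros)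
      from has_derivative_compose[OF this u] show ?thesis
        by (simp add: has_field_derivative_def blinfun.scaleR_right mult.commute[of _ "r' (z + t *\<^sub>R \<nu>) \<nu>"])
    qed
    have "r (z + s *\<^sub>R \<nu>) \<le> r z - s / 2"
    proof (cases "s = 0")
      case False
      then obtain t where t: "0 < t" "t < s" "r (z + s *\<^sub>R \<nu>) - r (z + 0 *\<^sub>R \<nu>) = (s - 0) * r' (z + t *\<^sub>R \<nu>) \<nu>"
        using MVT2[OF _ der, of 0 s] s(1) by force
      have "z + t *\<^sub>R \<nu> \<in> ball z\<^sub>0 R" using in_ball[of t] t R(1) by auto
      then have "norm ((r' (z + t *\<^sub>R \<nu>) - r' z\<^sub>0) \<nu>) \<le> e * norm \<nu>"
        using close norm_blinfun[of "r' (z + t *\<^sub>R \<nu>) - r' z\<^sub>0" \<nu>] mult_right_mono[OF _ norm_ge_zero] by (meson order_trans)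
      then have "r' (z + t *\<^sub>R \<nu>) \<nu> \<le> - 1 / 2" using e(2) \<nu> by (simp add: blinfun.diff_left abs_le_iff)
      then have "s * r' (z + t *\<^sub>R \<nu>) \<nu> \<le> s * (- 1 / 2)" using s by (intro mult_left_mono) auto
      then show ?thesis using t(3) by simp
    qed simp
    then show "z + s *\<^sub>R \<nu> \<in> ball z\<^sub>0 (R / 2) \<and> r (z + s *\<^sub>R \<nu>) \<le> r z - s / 2"
      using in_ball[of s] s by simp
  qed
qed

lemma locally_submean_const: "open G \<Longrightarrow> locally_submean G (\<lambda>_. c)"
  unfolding locally_submean_def by (auto intro!: exI[of _ 1])

section \<open>The type bound\<close>

text \<open>A continuity method in the shift, from \<open>s1\<close> down to \<epsilon>. While the
  translate lies in \<Omega>, the maximum principle carries the distance bound from the sphere to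
  the whole piece; this uniform distance allows the shift to decrease by a fixed amount.\<close>

lemma inward_translate:
  fixes Z \<Omega> :: "(complex ^ 'n::finite) set"
  assumes Z: "one_dim_variety Z" and psh: "continuous_psh_on \<Omega> (\<lambda>z. - ln (infdist z (frontier \<Omega>)))"
    and \<Omega>: "open \<Omega>" "frontier \<Omega> \<noteq> {}" and cpt: "compact (Z \<inter> cball z\<^sub>0 \<delta>)" and c: "0 < c"
    and \<epsilon>: "0 < \<epsilon>" "\<epsilon> \<le> s1"
    and top: "\<And>z. z \<in> Z \<Longrightarrow> dist z\<^sub>0 z \<le> \<delta> \<Longrightarrow> z + s1 *\<^sub>R \<nu> \<in> \<Omega>"
    and sphere: "\<And>z s. z \<in> Z \<Longrightarrow> dist z\<^sub>0 z = \<delta> \<Longrightarrow> \<epsilon> \<le> s \<Longrightarrow> s \<le> s1 \<Longrightarrow>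
        z + s *\<^sub>R \<nu> \<in> \<Omega> \<Longrightarrow> c * s \<le> infdist (z + s *\<^sub>R \<nu>) (frontier \<Omega>)"
  shows "\<And>z. z \<in> Z \<Longrightarrow> dist z\<^sub>0 z \<le> \<delta> \<Longrightarrow> z + \<epsilon> *\<^sub>R \<nu> \<in> \<Omega>"
    and "\<And>z. z \<in> Z \<Longrightarrow> dist z\<^sub>0 z \<le> \<delta> \<Longrightarrow> c * \<epsilon> \<le> infdist (z + \<epsilon> *\<^sub>R \<nu>) (frontier \<Omega>)"
proof -
  define P where "P s \<longleftrightarrow> (\<forall>z\<in>Z. dist z\<^sub>0 z \<le> \<delta> \<longrightarrow> z + s *\<^sub>R \<nu> \<in> \<Omega>)" for s
  have pos: "0 < infdist z (frontier \<Omega>)" if "z \<in> \<Omega>" for z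
  proof -
    have "z \<notin> frontier \<Omega>" using that \<Omega>(1) by (simp add: frontier_def interior_open)
    then show ?thesis using \<Omega>(2) by (simp add: infdist_pos_not_in_closed)
  qed
  have dist: "c * s \<le> infdist (z + s *\<^sub>R \<nu>) (frontier \<Omega>)"
    if P: "P s" and s: "\<epsilon> \<le> s" "s \<le> s1" and z: "z \<in> Z" "dist z\<^sub>0 z \<le> \<delta>" for s z
  proof -
    have "locally_submean ((\<lambda>z. z + s *\<^sub>R \<nu>) -` \<Omega>) (\<lambda>z. - ln (infdist (z + s *\<^sub>R \<nu>) (frontier \<Omega>)))"
      by (rule locally_submean_translate[OF locally_submean_psh[OF psh \<Omega>(1)]])
    then have "- ln (infdist (z + s *\<^sub>R \<nu>) (frontier \<Omega>)) \<le> - ln (c * s)"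
    proof (rule maximum_principle_variety[OF Z _ cpt _ _ z])
      show "Z \<inter> cball z\<^sub>0 \<delta> \<subseteq> (\<lambda>z. z + s *\<^sub>R \<nu>) -` \<Omega>" using P by (auto simp: P_def)
      fix y assume y: "y \<in> Z" "dist z\<^sub>0 y = \<delta>"
      then have "y + s *\<^sub>R \<nu> \<in> \<Omega>" using P by (auto simp: P_def)
      from sphere[OF y s this] show "- ln (infdist (y + s *\<^sub>R \<nu>) (frontier \<Omega>)) \<le> - ln (c * s)"
        using c \<epsilon>(1) s(1) pos[OF \<open>y + s *\<^sub>R \<nu> \<in> \<Omega>\<close>] by simp
    qed
    moreover have "0 < infdist (z + s *\<^sub>R \<nu>) (frontier \<Omega>)" using P z by (intro pos) (auto simp: P_def)
    ultimately show ?thesis using c \<epsilon>(1) s(1) by simp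
  qed
  \<comment> \<open>The step length: \<eta> |\<nu>| is less than \<open>c * \<epsilon>\<close>, the
    distance guaranteed at every stage.\<close>
  define \<eta> where "\<eta> = c * \<epsilon> / (2 * (norm \<nu> + 1))"
  have n1: "0 < norm \<nu> + 1" using norm_ge_zero[of \<nu>] by linarith
  have \<eta>: "0 < \<eta>" "\<eta> * norm \<nu> < c * \<epsilon>"
  proof -
    show "0 < \<eta>" using c \<epsilon> n1 by (simp add: \<eta>_def)
    have "\<eta> * (norm \<nu> + 1) = c * \<epsilon> / 2"
    proof -
      have "x \<noteq> 0 \<Longrightarrow> c * \<epsilon> / (2 * x) * x = c * \<epsilon> / 2" for x by simp
      moreover have "norm \<nu> + 1 \<noteq> 0" using n1 by simp
      ultimately show ?thesis unfolding \<eta>_def by blast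
    qed
    moreover have "0 < c * \<epsilon>" using c \<epsilon> by simp
    ultimately show "\<eta> * norm \<nu> < c * \<epsilon>" using \<open>0 < \<eta>\<close> unfolding distrib_left by linarith
  qed
  have step: "P s'" if P: "P s" and s: "\<epsilon> \<le> s" "s \<le> s1" and s': "s' \<le> s" "s - \<eta> \<le> s'" for s s'
    unfolding P_def
  proof (intro ballI impI)
    fix z assume z: "z \<in> Z" "dist z\<^sub>0 z \<le> \<delta>"
    have "dist (z + s *\<^sub>R \<nu>) (z + s' *\<^sub>R \<nu>) = (s - s') * norm \<nu>"
      using s'(1) by (simp add: dist_norm flip: scaleR_left_diff_distrib)
    also have "\<dots> \<le> \<eta> * norm \<nu>" using s' by (intro mult_right_mono) auto
    also have "\<dots> < c * \<epsilon>" by (rule \<eta>(2))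
    also have "\<dots> \<le> c * s" using c s by simp
    also have "\<dots> \<le> infdist (z + s *\<^sub>R \<nu>) (frontier \<Omega>)" by (rule dist[OF P s z])
    finally have less: "dist (z + s *\<^sub>R \<nu>) (z + s' *\<^sub>R \<nu>) < infdist (z + s *\<^sub>R \<nu>) (frontier \<Omega>)" .
    have "z + s *\<^sub>R \<nu> \<in> \<Omega>" using P z by (simp add: P_def)
    then show "z + s' *\<^sub>R \<nu> \<in> \<Omega>" using less by (rule in_open_if_close[OF \<Omega>(1)])
  qed
  \<comment> \<open>Capping at \<epsilon> lets finitely many steps end exactly there.\<close>
  have "P (max \<epsilon> (s1 - real n * \<eta>))" for n
  proof (induction n)
    case 0
    show ?case using top \<epsilon>(2) by (simp add: P_def max_absorb2)
  next
    case (Suc n)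
    show ?case
    proof (rule step[OF Suc])
      show "\<epsilon> \<le> max \<epsilon> (s1 - real n * \<eta>)" by simp
      have "0 \<le> real n * \<eta>" using \<eta>(1) by simp
      then show "max \<epsilon> (s1 - real n * \<eta>) \<le> s1" using \<epsilon>(2) by simp
      show "max \<epsilon> (s1 - real (Suc n) * \<eta>) \<le> max \<epsilon> (s1 - real n * \<eta>)"
        "max \<epsilon> (s1 - real n * \<eta>) - \<eta> \<le> max \<epsilon> (s1 - real (Suc n) * \<eta>)"
        using \<eta>(1) by (auto simp: algebra_simps max_def)
    qed
  qed
  moreover obtain n where "s1 < real n * \<eta>" using reals_Archimedean3[OF \<eta>(1)] by blast
  moreover from this have "max \<epsilon> (s1 - real n * \<eta>) = \<epsilon>" using \<epsilon>(1) by simp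
  ultimately have P\<epsilon>: "P \<epsilon>" by metis
  show "z + \<epsilon> *\<^sub>R \<nu> \<in> \<Omega>" if "z \<in> Z" "dist z\<^sub>0 z \<le> \<delta>" for z
    using P\<epsilon> that by (auto simp: P_def)
  show "c * \<epsilon> \<le> infdist (z + \<epsilon> *\<^sub>R \<nu>) (frontier \<Omega>)" if "z \<in> Z" "dist z\<^sub>0 z \<le> \<delta>" for z
    by (rule dist[OF P\<epsilon> _ \<epsilon>(2) that]) simp
qed

text \<open>The constants come from the distance \<open>D\<close> of the translated point. Outside
  the strip \<open>- \<tau> < r\<close> one has D >= e^3 |\<nu>| \<epsilon>, so \<open>u + M\<close>
  is at most -1. At the centre D <= |\<nu>| \<epsilon>, so \<open>u + M\<close> is at least 2, and
  \<phi> costs at most 1. On the sphere D >= \<epsilon> / (4 K) bounds the value by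
  \<open>ln (4 * K) + M\<close> minus \<Lambda> \<delta>^2 / 2. The maximum principle compares the
  last two.\<close>

lemma levi_bound_on_variety:
  fixes Z \<Omega> U B :: "(complex ^ 'n::finite) set"
  assumes Z: "one_dim_variety Z" and z0: "z\<^sub>0 \<in> Z" and \<delta>: "0 < \<delta>"
    and psh: "continuous_psh_on \<Omega> (\<lambda>z. - ln (infdist z (frontier \<Omega>)))"
    and \<Omega>: "open \<Omega>" "z\<^sub>0 \<in> frontier \<Omega>" and cpt: "compact (Z \<inter> cball z\<^sub>0 \<delta>)"
    and B: "open B" "B \<subseteq> U" "continuous_on B r" and U: "open U"
    and \<phi>: "C2_on U \<phi>" "\<And>z. z \<in> U \<Longrightarrow> - 1 \<le> \<phi> z \<and> \<phi> z \<le> 0"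
    and levi: "\<And>z \<zeta>. z \<in> B \<inter> \<Omega> \<Longrightarrow> - \<tau> < r z \<Longrightarrow> \<Lambda> * (norm \<zeta>)\<^sup>2 \<le> levi_form \<phi> z \<zeta>"
    and K: "0 < K" "\<And>z. z \<in> B \<inter> \<Omega> \<Longrightarrow> \<bar>r z\<bar> \<le> K * infdist z (frontier \<Omega>)"
    and \<Lambda>: "0 < \<Lambda>" and \<epsilon>: "0 < \<epsilon>" and \<nu>: "\<nu> \<noteq> 0" and \<tau>: "\<tau> = K * norm \<nu> * exp 3 * \<epsilon>"
    and shift: "\<And>z. z \<in> Z \<Longrightarrow> dist z\<^sub>0 z \<le> \<delta> \<Longrightarrow> z + \<epsilon> *\<^sub>R \<nu> \<in> \<Omega> \<inter> B"
      "\<And>z. z \<in> Z \<Longrightarrow> dist z\<^sub>0 z \<le> \<delta> \<Longrightarrow> \<epsilon> / (4 * K) \<le> infdist (z + \<epsilon> *\<^sub>R \<nu>) (frontier \<Omega>)"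
  shows "\<Lambda> / 2 * \<delta>\<^sup>2 \<le> ln (4 * K) + ln (norm \<nu>) + 1"
proof -
  define a where "a = \<epsilon> *\<^sub>R \<nu>"
  define M where "M = ln (norm \<nu>) + 2"
  define G where "G = (\<lambda>z. z + a) -` (\<Omega> \<inter> B)"
  have G: "open G" unfolding G_def using \<Omega>(1) B(1) by (intro open_vimage) (auto intro!: continuous_intros)
  define D where "D z = infdist (z + a) (frontier \<Omega>)" for z
  have Dpos: "0 < D z" if "z \<in> G" for z
  proof -
    have "z + a \<notin> frontier \<Omega>" using that \<Omega>(1) by (simp add: G_def frontier_def interior_open)
    then show ?thesis using \<Omega>(2) unfolding D_def by (intro infdist_pos_not_in_closed) auto
  qed
  define u where "u z = - ln (D z) + ln \<epsilon>" for z
  have smD: "locally_submean G (\<lambda>z. - ln (D z))"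
    unfolding G_def D_def
    by (rule locally_submean_translate[OF locally_submean_subset[OF locally_submean_psh[OF psh \<Omega>(1)]]])
       (use \<Omega>(1) B(1) in auto)
  have smu: "locally_submean G (\<lambda>z. u z + M)"
    unfolding u_def by (intro locally_submean_add smD locally_submean_const G)
  have "continuous_on G (\<lambda>z. - ln (D z))" using smD by (simp add: locally_submean_def)
  then have contu: "continuous_on G u"
    unfolding u_def by (rule continuous_on_add[OF _ continuous_on_const])
  have contr: "continuous_on G (\<lambda>z. r (z + a))"
    by (rule continuous_on_compose2[OF B(3)]) (auto simp: G_def intro!: continuous_intros)
  define E where "E = {z \<in> G. - \<tau> < r (z + a)}"
  have E: "open E" "E \<subseteq> G"
  proof -
    have "E = G \<inter> (\<lambda>z. r (z + a)) -` {- \<tau><..}" by (auto simp: E_def)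
    then show "open E" using continuous_open_preimage[OF contr G, of "{- \<tau><..}"] by simp
    show "E \<subseteq> G" by (auto simp: E_def)
  qed
  define A where "A z = \<phi> (z + a) - \<Lambda> / 2 * (norm (z - z\<^sub>0))\<^sup>2 + (u z + M)" for z
  define E' where "E' = {z \<in> \<Omega> \<inter> B. - \<tau> < r z}"
  have "open E'"
  proof -
    have "E' = (\<Omega> \<inter> B) \<inter> r -` {- \<tau><..}" by (auto simp: E'_def)
    moreover have "continuous_on (\<Omega> \<inter> B) r" by (rule continuous_on_subset[OF B(3)]) auto
    ultimately show ?thesis using continuous_open_preimage[of "\<Omega> \<inter> B" r "{- \<tau><..}"] \<Omega>(1) B(1) by auto
  qed
  \<comment> \<open>Half of \<Lambda> is subtracted, since
    \<open>locally_submean_strictly_psh\<close> needs a strictly smaller coefficient.\<close>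
  then have "locally_submean E' (\<lambda>z. \<phi> z - \<Lambda> / 2 * (norm (z - (z\<^sub>0 + a)))\<^sup>2)"
    using B(2) levi \<Lambda> by (intro locally_submean_strictly_psh[OF \<phi>(1) U]) (auto simp: E'_def)
  from locally_submean_translate[OF this, of a]
  have "locally_submean E (\<lambda>z. \<phi> (z + a) - \<Lambda> / 2 * (norm (z - z\<^sub>0))\<^sup>2)"
    by (simp add: E'_def E_def G_def vimage_def)
  then have smA: "locally_submean E A"
    unfolding A_def by (intro locally_submean_add locally_submean_subset[OF smu] E)
  define v where "v z = (if z \<in> E then max (A z) 0 else 0)" for z
  have \<phi>le: "\<phi> (z + a) \<le> 0" "- 1 \<le> \<phi> (z + a)" if "z \<in> G" for z
    using \<phi>(2)[of "z + a"] that B(2) by (auto simp: G_def)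
  have Ale: "A z \<le> - \<Lambda> / 2 * (norm (z - z\<^sub>0))\<^sup>2 + (u z + M)" if "z \<in> G" for z
    using \<phi>le[OF that] by (simp add: A_def)
  have Ale': "A z \<le> u z + M" if "z \<in> G" for z
  proof -
    have "0 \<le> \<Lambda> / 2 * (norm (z - z\<^sub>0))\<^sup>2" using \<Lambda> by simp
    then show ?thesis using Ale[OF that] by simp
  qed
  \<comment> \<open>On \<open>E2\<close> the logarithmic term alone makes \<open>A\<close> negative,
    so the cut-off function is 0 there. \<open>E\<close> and \<open>E2\<close> are open and cover
    \<open>G\<close>, which gives continuity across the edge of the strip.\<close>
  define E2 where "E2 = {z \<in> G. u z + M < 0}"
  have "open E2"
  proof -
    have "E2 = G \<inter> (\<lambda>z. u z + M) -` {..<0}" by (auto simp: E2_def)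
    moreover have "continuous_on G (\<lambda>z. u z + M)" by (intro continuous_intros contu)
    ultimately show ?thesis using continuous_open_preimage[OF _ G, of "\<lambda>z. u z + M" "{..<0}"] by simp
  qed
  have nn: "0 < norm \<nu>" using \<nu> by simp
  have deep: "z \<in> E2" if z: "z \<in> G" "z \<notin> E" for z
  proof -
    have "\<tau> \<le> \<bar>r (z + a)\<bar>" using z by (auto simp: E_def)
    also have "\<dots> \<le> K * D z" using K(2)[of "z + a"] z by (simp add: G_def D_def)
    finally have "norm \<nu> * exp 3 * \<epsilon> \<le> D z" using K(1) by (simp add: \<tau> mult.assoc)
    then have "ln (norm \<nu> * exp 3 * \<epsilon>) \<le> ln (D z)" using nn \<epsilon> Dpos[OF z(1)] by simp
    also have "ln (norm \<nu> * exp 3 * \<epsilon>) = ln (norm \<nu>) + 3 + ln \<epsilon>" using nn \<epsilon> by (simp add: ln_mult)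
    finally show ?thesis using z by (simp add: E2_def u_def M_def)
  qed
  have "continuous_on E v"
  proof -
    have "continuous_on E (\<lambda>z. max (A z) 0)"
      using smA by (intro continuous_on_max continuous_on_const) (simp add: locally_submean_def)
    then show ?thesis by (rule continuous_on_eq) (simp add: v_def)
  qed
  moreover have "continuous_on E2 v"
  proof (rule continuous_on_eq[OF continuous_on_const])
    show "0 = v z" if "z \<in> E2" for z
      using that Ale'[of z] by (auto simp: v_def E2_def)
  qed
  ultimately have "continuous_on (E \<union> E2) v" using E(1) \<open>open E2\<close> by (intro continuous_on_open_Un)
  moreover have "E \<union> E2 = G" using deep E(2) by (auto simp: E2_def)
  ultimately have contv: "continuous_on G v" by simp
  have smv: "locally_submean G v"
    by (rule locally_submean_max_0[OF G E smA contv]) (auto simp: v_def split: if_splits)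
  let ?b = "ln (4 * K) + M - \<Lambda> / 2 * \<delta>\<^sup>2"
  have "v z\<^sub>0 \<le> max ?b 0"
  proof (rule maximum_principle_variety[OF Z smv cpt _ _ z0])
    show "Z \<inter> cball z\<^sub>0 \<delta> \<subseteq> G" using shift(1) by (auto simp: G_def a_def)
    show "dist z\<^sub>0 z\<^sub>0 \<le> \<delta>" using \<delta> by simp
    fix y assume y: "y \<in> Z" "dist z\<^sub>0 y = \<delta>"
    then have yG: "y \<in> G" using shift(1)[of y] by (simp add: G_def a_def)
    have "\<epsilon> / (4 * K) \<le> D y" using shift(2)[of y] y by (simp add: D_def a_def)
    then have "ln (\<epsilon> / (4 * K)) \<le> ln (D y)" using \<epsilon> K(1) Dpos[OF yG] by simp
    then have "u y \<le> ln (4 * K)" using \<epsilon> K(1) by (simp add: u_def ln_div)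
    moreover have "norm (y - z\<^sub>0) = \<delta>" using y(2) by (simp add: dist_norm norm_minus_commute)
    ultimately have "A y \<le> ?b" using Ale[OF yG] by simp
    then show "v y \<le> max ?b 0" by (auto simp: v_def)
  qed
  moreover have "1 \<le> v z\<^sub>0"
  proof -
    have z0G: "z\<^sub>0 \<in> G" using shift(1)[OF z0] \<delta> by (simp add: G_def a_def)
    have Dz: "D z\<^sub>0 \<le> \<epsilon> * norm \<nu>"
      using infdist_le[OF \<Omega>(2), of "z\<^sub>0 + a"] \<epsilon> by (simp add: D_def a_def dist_norm)
    then have "ln (D z\<^sub>0) \<le> ln (\<epsilon> * norm \<nu>)" using Dpos[OF z0G] by simp
    also have "\<dots> = ln \<epsilon> + ln (norm \<nu>)" using \<epsilon> nn by (simp add: ln_mult)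
    finally have "1 \<le> A z\<^sub>0" using \<phi>le[OF z0G] by (simp add: A_def u_def M_def)
    have "\<bar>r (z\<^sub>0 + a)\<bar> \<le> K * D z\<^sub>0" using K(2)[of "z\<^sub>0 + a"] z0G by (simp add: G_def D_def)
    also have "\<dots> \<le> K * (\<epsilon> * norm \<nu>)" using Dz K(1) by simp
    also have "\<dots> < K * (\<epsilon> * norm \<nu>) * exp 3"
      using mult_strict_left_mono[of 1 "exp 3" "K * (\<epsilon> * norm \<nu>)"] K(1) \<epsilon> nn by simp
    finally have "- \<tau> < r (z\<^sub>0 + a)" by (simp add: \<tau> mult_ac)
    then have "z\<^sub>0 \<in> E" using z0G by (simp add: E_def)
    then show ?thesis using \<open>1 \<le> A z\<^sub>0\<close> by (simp add: v_def)
  qed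
  ultimately have "1 \<le> ?b" by (auto simp: max_def split: if_splits)
  then show ?thesis by (simp add: M_def)
qed

text \<open>Fixes all constants independently of \<delta> and \<epsilon>. Keeping \<epsilon> free,
  subject to \<open>4 * F \<delta> \<le> \<epsilon>\<close>, also covers values of \<open>F\<close>
  that are not positive.\<close>

lemma f_bound_along_variety:
  fixes \<Omega> V Z :: "(complex ^ 'n::finite) set"
  assumes "pseudoconvex_domain \<Omega>" and fr: "z\<^sub>0 \<in> frontier \<Omega>" and "z\<^sub>0 \<in> V" and r: "defining_function_on V \<Omega> r"
    and f_ge: "\<And>t. t \<ge> 1 \<Longrightarrow> 1 \<le> f t"
    and f: "f_property f \<Omega> r z\<^sub>0" and Z: "one_dim_variety Z" "z\<^sub>0 \<in> Z" and F: "type_le_along r F Z z\<^sub>0"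
  obtains m C s2 \<delta>1 where "0 < m" "0 < C" "0 < s2" "0 < \<delta>1" "m * s2 \<le> 1 / 2"
    "\<And>\<delta> \<epsilon>. 0 < \<delta> \<Longrightarrow> \<delta> < \<delta>1 \<Longrightarrow> 0 < \<epsilon> \<Longrightarrow> \<epsilon> \<le> s2 \<Longrightarrow> 4 * F \<delta> \<le> \<epsilon> \<Longrightarrow> f (1 / (m * \<epsilon>)) \<le> C / \<delta>"
proof -
  have \<Omega>: "open \<Omega>" and psh: "continuous_psh_on \<Omega> (\<lambda>z. - ln (infdist z (frontier \<Omega>)))"
    using assms(1) by (auto simp: pseudoconvex_domain_def)
  obtain U C1 C2 where U: "open U" "z\<^sub>0 \<in> U" and C1: "C1 > 0" and
    "\<forall>\<^sub>F \<delta> in at_right 0. \<exists>\<phi> :: complex ^ 'n \<Rightarrow> real.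
           continuous_psh_on U \<phi> \<and> C2_on U \<phi> \<and> (\<forall>z\<in>U. -1 \<le> \<phi> z \<and> \<phi> z \<le> 0) \<and>
           (\<forall>z \<in> U \<inter> {z\<in>\<Omega>. - \<delta> < r z \<and> r z < 0}.
              (\<forall>\<zeta>. levi_form \<phi> z \<zeta> \<ge> C1 * (f (1 / \<delta>))\<^sup>2 * (norm \<zeta>)\<^sup>2) \<and>
              onorm (frechet_derivative \<phi> (at z)) \<le> C2 / \<delta>)"
    using f unfolding f_property_def by (elim exE conjE) (rule that)
  then obtain \<delta>0 where \<delta>0: "0 < \<delta>0" and \<phi>_ex: "\<And>\<delta>. 0 < \<delta> \<Longrightarrow> \<delta> < \<delta>0 \<Longrightarrow> \<exists>\<phi> :: complex ^ 'n \<Rightarrow> real.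
           continuous_psh_on U \<phi> \<and> C2_on U \<phi> \<and> (\<forall>z\<in>U. -1 \<le> \<phi> z \<and> \<phi> z \<le> 0) \<and>
           (\<forall>z \<in> U \<inter> {z\<in>\<Omega>. - \<delta> < r z \<and> r z < 0}.
              (\<forall>\<zeta>. levi_form \<phi> z \<zeta> \<ge> C1 * (f (1 / \<delta>))\<^sup>2 * (norm \<zeta>)\<^sup>2) \<and>
              onorm (frechet_derivative \<phi> (at z)) \<le> C2 / \<delta>)"
    unfolding eventually_at_right_field by auto
  obtain R K s1 \<nu> where R: "0 < R" "0 < K" "0 < s1" "\<nu> \<noteq> 0" "ball z\<^sub>0 R \<subseteq> V \<inter> U"
    and rK: "\<And>z. z \<in> ball z\<^sub>0 (R / 2) \<Longrightarrow> \<bar>r z\<bar> \<le> K * infdist z (frontier \<Omega>)"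
    and rK': "\<And>z. z \<in> ball z\<^sub>0 R \<Longrightarrow> \<bar>r z\<bar> \<le> K * dist z z\<^sub>0"
    and r\<nu>: "\<And>z s. z \<in> ball z\<^sub>0 (R / 4) \<Longrightarrow> 0 \<le> s \<Longrightarrow> s \<le> s1 \<Longrightarrow>
       z + s *\<^sub>R \<nu> \<in> ball z\<^sub>0 (R / 2) \<and> r (z + s *\<^sub>R \<nu>) \<le> r z - s / 2"
    by (rule boundary_geometry[OF r \<Omega> fr \<open>z\<^sub>0 \<in> V\<close> U]) (assumption | rule that)+
  have V: "\<Omega> \<inter> V = {z\<in>V. r z < 0}" and "C2_on V r" using r by (auto simp: defining_function_on_def)
  have contr: "continuous_on V r"
  proof (rule continuous_at_imp_continuous_on, rule ballI)
    fix z assume "z \<in> V"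
    then show "continuous (at z) r"
      using \<open>C2_on V r\<close> unfolding C2_on_def by (meson has_derivative_continuous)
  qed
  have in\<Omega>: "z \<in> \<Omega>" if "z \<in> ball z\<^sub>0 R" "r z < 0" for z using that V R(5) by auto
  obtain d0 where d0: "0 < d0" "\<And>z. z \<in> Z \<Longrightarrow> z \<noteq> z\<^sub>0 \<Longrightarrow> dist z z\<^sub>0 < d0 \<Longrightarrow> \<bar>r z\<bar> \<le> F (norm (z - z\<^sub>0))"
    using F unfolding type_le_along_def eventually_at by auto
  have "analytic_variety Z" using Z(1) by (simp add: one_dim_variety_def)
  then obtain R0 where R0: "0 < R0" "\<And>\<delta>. \<delta> < R0 \<Longrightarrow> compact (Z \<inter> cball z\<^sub>0 \<delta>)"
    using compact_variety_cball Z(2) by metis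
  \<comment> \<open>The strip in which the Hessian bound is used has width
    \<open>m * \<epsilon>\<close>.\<close>
  define m where "m = K * norm \<nu> * exp 3"
  have m: "0 < m" using R(2,4) by (simp add: m_def)
  \<comment> \<open>\<open>m * s2 < \<delta>0\<close> makes the function \<phi> for this strip
    available; \<open>m * s2 \<le> 1 / 2\<close> puts the argument of \<open>f\<close> at 2 or
    beyond.\<close>
  define s2 where "s2 = min s1 (min (\<delta>0 / (2 * m)) (1 / (2 * m)))"
  have s2: "0 < s2" "s2 \<le> s1" "m * s2 < \<delta>0" "m * s2 \<le> 1 / 2"
  proof -
    show "0 < s2" "s2 \<le> s1" using R(3) \<delta>0 m by (auto simp: s2_def)
    have "m * s2 \<le> m * (\<delta>0 / (2 * m))" "m * s2 \<le> m * (1 / (2 * m))"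
      using m by (intro mult_left_mono; simp add: s2_def)+
    then show "m * s2 < \<delta>0" "m * s2 \<le> 1 / 2" using m \<delta>0 by auto
  qed
  \<comment> \<open>In order: the inward shift is controlled, the type bound holds, the piece of
    \<open>Z\<close> is compact, and |r| < s1 / 2 on it, so that the shift by \<open>s1\<close> ends
    in \<Omega>.\<close>
  define \<delta>1 where "\<delta>1 = min (min (R / 4) d0) (min R0 (s1 / (2 * K)))"
  have \<delta>1: "0 < \<delta>1" using R d0(1) R0(1) by (simp add: \<delta>1_def)
  define C0 where "C0 = \<bar>ln (4 * K) + ln (norm \<nu>) + 1\<bar> + 1"
  define C where "C = sqrt (2 * C0 / C1)"
  have C0: "0 < C0" by (simp add: C0_def)
  then have C: "0 < C" using C1 by (simp add: C_def)
  show ?thesis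
  proof (rule that[OF m C s2(1) \<delta>1 s2(4)])
    fix \<delta> \<epsilon> assume \<delta>: "0 < \<delta>" "\<delta> < \<delta>1" and \<epsilon>: "0 < \<epsilon>" "\<epsilon> \<le> s2" and F\<epsilon>: "4 * F \<delta> \<le> \<epsilon>"
    have \<delta>': "\<delta> < R / 4" "\<delta> < d0" "\<delta> < R0" "\<delta> < s1 / (2 * K)" using \<delta>(2) by (auto simp: \<delta>1_def)
    have \<epsilon>s1: "\<epsilon> \<le> s1" using \<epsilon>(2) s2(2) by simp
    have cpt: "compact (Z \<inter> cball z\<^sub>0 \<delta>)" using R0(2) \<delta>'(3) by blast
    have nb: "z \<in> ball z\<^sub>0 (R / 4)" if "dist z\<^sub>0 z \<le> \<delta>" for z using that \<delta>'(1) by simp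
    have sub: "ball z\<^sub>0 (R / 2) \<subseteq> ball z\<^sub>0 R" using R(1) by auto
    have top: "z + s1 *\<^sub>R \<nu> \<in> \<Omega>" if "z \<in> Z" "dist z\<^sub>0 z \<le> \<delta>" for z
    proof (rule in\<Omega>)
      note b = r\<nu>[OF nb[OF that(2)], of s1]
      then show "z + s1 *\<^sub>R \<nu> \<in> ball z\<^sub>0 R" using R(3) sub by auto
      have "r z \<le> K * dist z z\<^sub>0" using rK'[of z] nb[OF that(2)] R(1) by auto
      also have "\<dots> \<le> K * \<delta>" using that(2) R(2) by (simp add: dist_commute)
      also have "\<dots> < s1 / 2" using \<delta>'(4) R(2) by (simp add: field_simps)
      finally show "r (z + s1 *\<^sub>R \<nu>) < 0" using b R(3) by simp
    qed
    \<comment> \<open>Here |r z| <= F \<delta> <= s/4, and the shift lowers \<open>r\<close> by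
      \<open>s / 2\<close>, so r <= -s/4 at the shifted point; comparison of |r| with the distance
      finishes.\<close>
    have sphere: "1 / (4 * K) * s \<le> infdist (z + s *\<^sub>R \<nu>) (frontier \<Omega>)"
      if z: "z \<in> Z" "dist z\<^sub>0 z = \<delta>" and s: "\<epsilon> \<le> s" "s \<le> s1" for z s
    proof -
      have "z \<noteq> z\<^sub>0" "dist z z\<^sub>0 < d0" "norm (z - z\<^sub>0) = \<delta>"
        using z(2) \<delta>(1) \<delta>'(2) by (auto simp: dist_commute) (simp add: dist_norm norm_minus_commute)
      then have rz: "\<bar>r z\<bar> \<le> F \<delta>" using d0(2)[OF z(1)] by simp
      have b: "z + s *\<^sub>R \<nu> \<in> ball z\<^sub>0 (R / 2) \<and> r (z + s *\<^sub>R \<nu>) \<le> r z - s / 2"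
        using z s \<epsilon>(1) by (intro r\<nu> nb) auto
      then have "r (z + s *\<^sub>R \<nu>) \<le> - (s / 4)" using rz F\<epsilon> s(1) by linarith
      then have "s / 4 \<le> K * infdist (z + s *\<^sub>R \<nu>) (frontier \<Omega>)" using rK b by fastforce
      then show ?thesis using R(2) by (simp add: field_simps)
    qed
    have c: "0 < 1 / (4 * K)" using R(2) by simp
    have ne: "frontier \<Omega> \<noteq> {}" using fr by auto
    note it = inward_translate[OF Z(1) psh \<Omega> ne cpt c \<epsilon>(1) \<epsilon>s1]
    have it1: "z + \<epsilon> *\<^sub>R \<nu> \<in> \<Omega>" if "z \<in> Z" "dist z\<^sub>0 z \<le> \<delta>" for z
      by (rule it(1)[OF top sphere that])
    have it2: "1 / (4 * K) * \<epsilon> \<le> infdist (z + \<epsilon> *\<^sub>R \<nu>) (frontier \<Omega>)" if "z \<in> Z" "dist z\<^sub>0 z \<le> \<delta>" for z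
      by (rule it(2)[OF top sphere that])
    define \<tau> where "\<tau> = m * \<epsilon>"
    have "m * \<epsilon> \<le> m * s2" using m \<epsilon>(2) by simp
    then have \<tau>: "0 < \<tau>" "\<tau> < \<delta>0" "\<tau> \<le> 1 / 2" using mult_pos_pos[OF m \<epsilon>(1)] s2(3,4) unfolding \<tau>_def by linarith+
    obtain \<phi> :: "complex ^ 'n \<Rightarrow> real" where \<phi>: "C2_on U \<phi>" "\<forall>z\<in>U. -1 \<le> \<phi> z \<and> \<phi> z \<le> 0"
      "\<forall>z \<in> U \<inter> {z\<in>\<Omega>. - \<tau> < r z \<and> r z < 0}. \<forall>\<zeta>. levi_form \<phi> z \<zeta> \<ge> C1 * (f (1 / \<tau>))\<^sup>2 * (norm \<zeta>)\<^sup>2"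
      using \<phi>_ex[OF \<tau>(1,2)] by blast
    have "1 \<le> 1 / \<tau>" using \<tau> by simp
    then have f1: "1 \<le> f (1 / \<tau>)" by (rule f_ge)
    have "C1 * (f (1 / \<tau>))\<^sup>2 / 2 * \<delta>\<^sup>2 \<le> ln (4 * K) + ln (norm \<nu>) + 1"
    proof (rule levi_bound_on_variety[OF Z \<delta>(1) psh \<Omega> fr cpt open_ball _ _ U(1) \<phi>(1), where r = r and K = K and \<nu> = \<nu> and \<epsilon> = \<epsilon>])
      show "ball z\<^sub>0 (R / 2) \<subseteq> U" using R(5) sub by auto
      show "continuous_on (ball z\<^sub>0 (R / 2)) r" by (rule continuous_on_subset[OF contr]) (use R(5) sub in auto)
      show "- 1 \<le> \<phi> z \<and> \<phi> z \<le> 0" if "z \<in> U" for z using \<phi>(2) that by blast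
      show "C1 * (f (1 / \<tau>))\<^sup>2 * (norm \<zeta>)\<^sup>2 \<le> levi_form \<phi> z \<zeta>" if "z \<in> ball z\<^sub>0 (R / 2) \<inter> \<Omega>" "- \<tau> < r z" for z \<zeta>
      proof -
        have "z \<in> U" "z \<in> V" using that(1) R(5) sub by auto
        then have "z \<in> U \<inter> {z\<in>\<Omega>. - \<tau> < r z \<and> r z < 0}" using that V by auto
        then show ?thesis using \<phi>(3) by blast
      qed
      show "\<bar>r z\<bar> \<le> K * infdist z (frontier \<Omega>)" if "z \<in> ball z\<^sub>0 (R / 2) \<inter> \<Omega>" for z using rK that by blast
      show "0 < C1 * (f (1 / \<tau>))\<^sup>2" using C1 f1 by simp
      show "\<tau> = K * norm \<nu> * exp 3 * \<epsilon>" by (simp add: \<tau>_def m_def)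
      show "z + \<epsilon> *\<^sub>R \<nu> \<in> \<Omega> \<inter> ball z\<^sub>0 (R / 2)" if "z \<in> Z" "dist z\<^sub>0 z \<le> \<delta>" for z
        using it1[OF that] r\<nu>[OF nb[OF that(2)], of \<epsilon>] \<epsilon>(1) \<epsilon>s1 by simp
      show "\<epsilon> / (4 * K) \<le> infdist (z + \<epsilon> *\<^sub>R \<nu>) (frontier \<Omega>)" if "z \<in> Z" "dist z\<^sub>0 z \<le> \<delta>" for z
        using it2[OF that] by simp
    qed (use R \<epsilon> in auto)
    also have "\<dots> \<le> C0" by (simp add: C0_def)
    finally have "(f (1 / \<tau>) * \<delta>)\<^sup>2 \<le> 2 * C0 / C1" using C1 by (simp add: field_simps power_mult_distrib)
    then have "f (1 / \<tau>) * \<delta> \<le> C" unfolding C_def by (rule real_le_rsqrt)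
    then show "f (1 / (m * \<epsilon>)) \<le> C / \<delta>" using \<delta>(1) by (simp add: \<tau>_def field_simps)
  qed
qed

theorem theorem1p2:
  fixes \<Omega> V Z :: "(complex ^ 'n::finite) set"
    and r :: "complex ^ 'n \<Rightarrow> real"
    and z\<^sub>0 :: "complex ^ 'n"
    and f F :: "real \<Rightarrow> real"
  assumes "pseudoconvex_domain \<Omega>" and "C2_boundary \<Omega>" and "z\<^sub>0 \<in> frontier \<Omega>"
    and "z\<^sub>0 \<in> V" and "defining_function_on V \<Omega> r"
    and "smooth_real_on {1..} f" and "mono_on {1..} f"
    and "\<And>t. t \<ge> 1 \<Longrightarrow> 1 \<le> f t" and "\<And>t. t \<ge> 1 \<Longrightarrow> f t \<le> t powr (1/2)"
    and "f_property f \<Omega> r z\<^sub>0"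
    and "\<exists>t>1. (\<lambda>a. 1 / (a * f a)) integrable_on {t..}"
    and "one_dim_variety Z" and "z\<^sub>0 \<in> Z"
    and "type_le_along r F Z z\<^sub>0"
  shows "\<exists>\<alpha>>0. \<exists>\<beta>>0. \<forall>\<^sub>F \<delta> in at_right 0. F \<delta> \<ge> \<beta> * G_of f (\<alpha> * \<delta>)"
proof -
  have contf: "continuous_on {1..} f"
  proof -
    obtain D :: "nat \<Rightarrow> real \<Rightarrow> real" where D: "\<forall>x\<in>{1..}. D 0 x = f x"
      "\<forall>k. \<forall>x\<in>{1..}. (D k has_real_derivative D (Suc k) x) (at x within {1..})"
      using assms(6) unfolding smooth_real_on_def by blast
    have "continuous_on {1..} (D 0)" by (rule DERIV_continuous_on[where D = "D (Suc 0)"]) (use D(2) in blast)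
    then show ?thesis by (rule continuous_on_eq) (use D(1) in blast)
  qed
  note G = G_of_bounds[OF contf assms(7,8,11)]
  obtain m C s2 \<delta>1 where m: "0 < m" and C: "0 < C" and s2: "0 < s2" and \<delta>1: "0 < \<delta>1" and ms2: "m * s2 \<le> 1 / 2"
    and bound: "\<And>\<delta> \<epsilon>. 0 < \<delta> \<Longrightarrow> \<delta> < \<delta>1 \<Longrightarrow> 0 < \<epsilon> \<Longrightarrow> \<epsilon> \<le> s2 \<Longrightarrow> 4 * F \<delta> \<le> \<epsilon> \<Longrightarrow> f (1 / (m * \<epsilon>)) \<le> C / \<delta>"
    by (rule f_bound_along_variety[OF assms(1,3,4,5,8,10,12,13,14)]) (assumption | rule that)+
  \<comment> \<open>With this choice \<open>y = 2 * (C / \<delta>)\<close> below, and the bound for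
    \<open>f\<close> reads \<open>2 * f t \<le> y\<close>.\<close>
  define \<alpha> where "\<alpha> = 1 / (2 * C)"
  \<comment> \<open>The first entry serves the case where \<open>F \<delta>\<close> is not small,
    the second the main case.\<close>
  define \<beta> where "\<beta> = min (s2 / 4) (1 / (8 * m))"
  have \<alpha>: "0 < \<alpha>" and \<beta>: "0 < \<beta>" "\<beta> \<le> s2 / 4" "\<beta> \<le> 1 / (8 * m)" using C s2 m by (auto simp: \<alpha>_def \<beta>_def)
  define g1 where "g1 = \<bar>g_of f 1\<bar> + 1"
  \<comment> \<open>The second entry ensures that \<open>y\<close> is at least
    \<open>g_of f 1\<close>, where the inverse of \<open>g_of f\<close> is meaningful.\<close>
  define \<delta>2 where "\<delta>2 = min \<delta>1 (1 / (\<alpha> * g1))"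
  have g1: "0 < g1" "g_of f 1 \<le> g1" by (auto simp: g1_def)
  have "0 < \<delta>2" using \<delta>1 \<alpha> g1(1) by (simp add: \<delta>2_def)
  moreover have "\<beta> * G_of f (\<alpha> * \<delta>) \<le> F \<delta>" if \<delta>: "0 < \<delta>" "\<delta> < \<delta>2" for \<delta>
  proof -
    define y where "y = 1 / (\<alpha> * \<delta>)"
    define X where "X = inv_into {1..} (g_of f) y"
    have "\<alpha> * \<delta> * g1 \<le> 1" using \<delta> \<alpha> g1(1) by (simp add: \<delta>2_def field_simps)
    then have "g1 \<le> y" using \<alpha> \<delta>(1) by (simp add: y_def field_simps)
    then have y: "g_of f 1 \<le> y" using g1(2) by simp
    have X: "1 \<le> X" unfolding X_def by (rule G(1)[OF _ y])
    have yC: "y = 2 * (C / \<delta>)" using C \<delta>(1) by (simp add: y_def \<alpha>_def)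
    have key: "1 / (2 * m * \<epsilon>) \<le> X" if \<epsilon>: "0 < \<epsilon>" "\<epsilon> \<le> s2" "4 * F \<delta> \<le> \<epsilon>" for \<epsilon>
    proof -
      have "m * \<epsilon> \<le> 1 / 2" using ms2 mult_left_mono[OF \<epsilon>(2), of m] m by linarith
      then have "2 \<le> 1 / (m * \<epsilon>)" using m \<epsilon>(1) by (simp add: field_simps)
      moreover have "2 * f (1 / (m * \<epsilon>)) \<le> y"
        using bound[OF \<delta>(1) _ \<epsilon>] \<delta>(2) unfolding yC by (simp add: \<delta>2_def)
      ultimately have "1 / (m * \<epsilon>) / 2 \<le> X" unfolding X_def by (intro G(2)[OF _ y])
      then show ?thesis by (simp add: field_simps)
    qed
    have GX: "G_of f (\<alpha> * \<delta>) = 1 / X" by (simp add: G_of_def X_def y_def)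
    have \<beta>X: "\<beta> * (1 / X) \<le> \<beta>" using \<beta>(1) X by (simp add: field_simps)
    show ?thesis
    proof (cases "s2 < 4 * F \<delta>")
      \<comment> \<open>Here \<open>F \<delta>\<close> exceeds \<open>s2 / 4\<close>, hence \<beta>,
        while G is at most 1.\<close>
      case True
      then show ?thesis using \<beta>X \<beta>(2) unfolding GX by linarith
    next
      case False
      \<comment> \<open>Otherwise every small \<epsilon> would be admissible, and
        \<open>1 / (2 * m * \<epsilon>)\<close> would exceed \<open>X\<close>.\<close>
      have "0 < F \<delta>"
      proof (rule ccontr)
        assume "\<not> 0 < F \<delta>"
        define \<epsilon> where "\<epsilon> = min s2 (1 / (4 * m * X))"
        have p: "0 < 1 / (4 * m * X)" using m X by simp
        then have \<epsilon>: "0 < \<epsilon>" "\<epsilon> \<le> s2" "\<epsilon> \<le> 1 / (4 * m * X)" using s2 by (auto simp: \<epsilon>_def)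
        have "1 / (2 * m * \<epsilon>) \<le> X" using \<epsilon> \<open>\<not> 0 < F \<delta>\<close> by (intro key) auto
        then have "1 \<le> X * (2 * m * \<epsilon>)" using m \<epsilon>(1) by (simp add: field_simps)
        also have "\<dots> \<le> X * (2 * m * (1 / (4 * m * X)))" using m X \<epsilon>(3) by (intro mult_left_mono) auto
        also have "\<dots> = 1 / 2" using m X by simp
        finally show False by simp
      qed
      then have "1 / (2 * m * (4 * F \<delta>)) \<le> X" using False by (intro key) auto
      then have "1 / X \<le> 8 * m * F \<delta>" using m X \<open>0 < F \<delta>\<close> by (simp add: field_simps)
      then have "1 / (8 * m) * (1 / X) \<le> 1 / (8 * m) * (8 * m * F \<delta>)" using m by (intro mult_left_mono) auto
      then have "1 / (8 * m) * (1 / X) \<le> F \<delta>" using m by simp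
      moreover have "\<beta> * (1 / X) \<le> 1 / (8 * m) * (1 / X)" using \<beta>(3) X by (intro mult_right_mono) auto
      ultimately show ?thesis unfolding GX by linarith
    qed
  qed
  ultimately have "\<forall>\<^sub>F \<delta> in at_right 0. F \<delta> \<ge> \<beta> * G_of f (\<alpha> * \<delta>)"
    unfolding eventually_at_right_field by blast
  then show ?thesis using \<alpha> \<beta>(1) by blast
qed

end
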